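(* Let $\gamma>0$, let $k\ge1$ be an integer, let $T>0$, $N\ge1$ an integer and $\tau=T/N$. Let $u_h^n,v_h^n\in V_h^k$ ($0\le n\le N$) solve the following fully discrete scheme. The starting value is $u_h^0=R_hu_0$, and $v_h^0\in V_h^k$ is given by $m_h(v_h^0,\psi_h)=a_h(u_h^0,\psi_h)$ for all $\psi_h\in V_h^k$. For $n=1$, for all $\phi_h,\psi_h\in V_h^k$, $$m_h(D_\tau u_h^1,\phi_h)+\gamma a_h(\hat v_h^1,\phi_h)+a_h(\hat u_h^1,\phi_h)+\big((\Pi_h^{0,k}u_h^0)^2\,\Pi_h^{0,k}\hat u_h^1,\Pi_h^{0,k}\phi_h\big)-m_h(\hat u_h^1,\phi_h)=0,\qquad m_h(v_h^1,\psi_h)=a_h(u_h^1,\psi_h).$$ For $2\le n\le N$, for all $\phi_h,\psi_h\in V_h^k$, $$m_h(D_\tau u_h^n,\phi_h)+\gamma a_h(\hat v_h^n,\phi_h)+a_h(\hat u_h^n,\phi_h)+\big((\Pi_h^{0,k}u_h^{n-1})^2\,\Pi_h^{0,k}\hat u_h^n,\Pi_h^{0,k}\phi_h\big)-m_h(\hat u_h^n,\phi_h)=0,\qquad m_h(v_h^n,\psi_h)=a_h(u_h^n,\psi_h).$$ Define the discrete energy by $$E_h^0=\frac{\gamma}{2}\|v_h^0\|_{m_h}^2+\frac12\|u_h^0\|_{a_h}^2+\frac14\|(\Pi_h^{0,k}u_h^0)^2\|^2-\frac12\|u_h^0\|_{m_h}^2$$ and, for $1\le n\le N$, $$E_h^n=\frac{\gamma}{4}\big(\|v_h^n\|_{m_h}^2+\|v_h^{n-1}\|_{m_h}^2\big)+\frac14\big(\|u_h^n\|_{a_h}^2+\|u_h^{n-1}\|_{a_h}^2\big)+\frac14\big((\Pi_h^{0,k}u_h^n)^2,(\Pi_h^{0,k}u_h^{n-1})^2\big)-\frac14\big(\|u_h^n\|_{m_h}^2+\|u_h^{n-1}\|_{m_h}^2\big).$$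 Then $$E_h^n\le E_h^{n-1},\qquad 1\le n\le N.$$
   Context: $\Omega\subset\mathbb R^2$ is a bounded convex polygonal domain; $(\cdot,\cdot)_D$ is the $L^2(D)$ inner product, $\|\cdot\|_D$ the $L^2(D)$ norm, and the subscript is dropped for $D=\Omega$. $u_0\in H_0^1(\Omega)\cap H^{k+1}(\Omega)$ is the initial datum. Mesh: $\mathcal T_h$ is a polygonal mesh of $\Omega$ from a family, $h_K$ is the diameter of $K$, $h=\max_K h_K$. There is $\varrho\in(0,1)$, the same for the whole family, such that for every $K\in\mathcal T_h$: every edge $E\subset\partial K$ has length $h_E\ge\varrho h_K$; $K$ is star-shaped with respect to a disc of radius $\ge\varrho h_K$; $h_K\ge\varrho h$. Projections: $\mathbb P_k(K)$ is the space of polynomials of degree $\le k$ on $K$. $\Pi_K^{1,k}v\in\mathbb P_k(K)$ is defined by $(\nabla\Pi_K^{1,k}v,\nabla q)_K=(\nabla v,\nabla q)_K$ for all $q\in\mathbb P_k(K)$ and $P_0^K(\Pi_K^{1,k}v)=P_0^Kv$, where $P_0^Kv$ is the average of the values of $v$ at the vertices of $K$ if $k=1$, and $P_0^Kv=\frac1{|K|}\int_Kv\,d\boldsymbol x$ if $k\ge2$. $\Pi_K^{0,k}:L^2(K)\to\mathbb P_k(K)$ is the $L^2(K)$-orthogonal projection, and $(\Pi_h^{0,k}v)|_K=\Pi_K^{0,k}(v|_K)$. Virtual element space: $\mathbb B_k(\partial K)=\{v\in C(\partial K): v|_E\in\mathbb P_k(E)\ \forall E\subset\partial K\}$, $W_K^k=\{v\in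 H^1(K):\Delta v\in\mathbb P_k(K),\ v|_{\partial K}\in\mathbb B_k(\partial K)\}$; $\mathcal M_k(K)=\{((\boldsymbol x-\boldsymbol x_K)/h_K)^{\boldsymbol s}:|\boldsymbol s|\le k\}$ with $\boldsymbol x_K$ the centroid of $K$ and $\boldsymbol s$ a multi-index ($\mathcal M_{-1}=\emptyset$), and $\mathcal M_k(E)$ is defined analogously on an edge $E$. $V_K^k=\{v\in W_K^k:(v,q)_K=(\Pi_K^{1,k}v,q)_K\ \forall q\in\mathcal M_k(K)\setminus\mathcal M_{k-2}(K)\}$. Its degrees of freedom, denoted $\phi_1,\dots,\phi_{N_K}$ with $N_K=\dim V_K^k$, are: the values at the vertices of $K$; for $k\ge2$ the moments $\frac1{|E|}\int_Evm\,ds$, $m\in\mathcal M_{k-2}(E)$, $E\subset\partial K$; and for $k\ge2$ the moments $\frac1{|K|}\int_Kvm\,d\boldsymbol x$, $m\in\mathcal M_{k-2}(K)$. The global space is $V_h^k=\{v_h\in H_0^1(\Omega):v_h|_K\in V_K^k\ \forall K\in\mathcal T_h\}$. Discrete bilinear forms on $V_h^k\times V_h^k$ (restrictions to $K$ understood): $a_h(u_h,v_h)=\sum_K\big[(\nabla\Pi_K^{1,k}u_h,\nabla\Pi_K^{1,k}v_h)_K+\sum_{i=1}^{N_K}\phi_i(u_h-\Pi_K^{1,k}u_h)\phi_i(v_h-\Pi_K^{1,k}v_h)\big]$, $m_h(u_h,v_h)=\sum_K\big[(\Pi_K^{0,k}u_h,\Pi_K^{0,k}v_h)_K+h_K^2\sum_{i=1}^{N_K}\phi_i(u_h-\Pi_K^{0,k}u_h)\phi_i(v_h-\Pi_K^{0,k}v_h)\big]$.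 Write $\|w_h\|_{a_h}^2=a_h(w_h,w_h)$ and $\|w_h\|_{m_h}^2=m_h(w_h,w_h)$. Elliptic projection: $R_h:H_0^1(\Omega)\cap H^{k+1}(\Omega)\to V_h^k$ is defined by $a_h(R_hu,v_h)=-(\Delta u,\Pi_h^{0,k}v_h)$ for all $v_h\in V_h^k$. Time grid: $t_n=n\tau$, $0\le n\le N$. For a sequence $(w^n)_{n=0}^N$: $D_\tau w^1=(w^1-w^0)/\tau$, $\hat w^1=(w^1+w^0)/2$, and for $2\le n\le N$, $D_\tau w^n=(w^n-w^{n-2})/(2\tau)$, $\hat w^n=(w^n+w^{n-2})/2$. *)

theory Defs
  imports "HOL-Analysis.Analysis" "HOL-Computational_Algebra.Polynomial"
begin

section \<open>Smooth functions and Sobolev spaces in the plane\<close>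

text \<open>Elements of Lebesgue and Sobolev spaces on \<open>D\<close> are represented by functions on the whole
  plane, of which only the values on \<open>D\<close> (up to a null set) matter.\<close>

definition partial :: "2 \<Rightarrow> (real^2 \<Rightarrow> real) \<Rightarrow> real^2 \<Rightarrow> real" where
  "partial i f x = frechet_derivative f (at x) (axis i 1)"

definition grad :: "(real^2 \<Rightarrow> real) \<Rightarrow> real^2 \<Rightarrow> real^2" where
  "grad f x = (\<chi> i. partial i f x)"

definition laplacian :: "(real^2 \<Rightarrow> real) \<Rightarrow> real^2 \<Rightarrow> real" where
  "laplacian f x = (\<Sum>i\<in>UNIV. partial i (partial i f) x)"

text \<open>All iterated partial derivatives, in any order, exist in the Frechet sense; hence they are
  also continuous.\<close>

definition smooth :: "(real^2 \<Rightarrow> real) \<Rightarrow> bool" where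
  "smooth f \<longleftrightarrow> (\<forall>is. foldr partial is f differentiable_on UNIV)"

definition test_functions :: "(real^2) set \<Rightarrow> (real^2 \<Rightarrow> real) set" where
  "test_functions D = {\<phi>. smooth \<phi> \<and> compact (closure {x. \<phi> x \<noteq> 0}) \<and> closure {x. \<phi> x \<noteq> 0} \<subseteq> D}"

definition L2 :: "(real^2) set \<Rightarrow> (real^2 \<Rightarrow> 'a::euclidean_space) set" where
  "L2 D = {f. set_borel_measurable lebesgue D f \<and>
              set_integrable lebesgue D (\<lambda>x. (norm (f x))\<^sup>2)}"

definition l2_inner :: "(real^2) set \<Rightarrow> (real^2 \<Rightarrow> 'a::euclidean_space) \<Rightarrow> (real^2 \<Rightarrow> 'a) \<Rightarrow> real" where
  "l2_inner D f g = (LINT x:D|lebesgue. f x \<bullet> g x)"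

definition l2_norm :: "(real^2) set \<Rightarrow> (real^2 \<Rightarrow> 'a::euclidean_space) \<Rightarrow> real" where
  "l2_norm D f = sqrt (l2_inner D f f)"

text \<open>\<open>w\<close> is the weak derivative of \<open>v\<close> of multi-index \<open>(a, b)\<close>.\<close>

definition has_weak_deriv ::
  "(real^2) set \<Rightarrow> nat \<Rightarrow> nat \<Rightarrow> (real^2 \<Rightarrow> real) \<Rightarrow> (real^2 \<Rightarrow> real) \<Rightarrow> bool" where
  "has_weak_deriv D a b v w \<longleftrightarrow>
     (\<forall>\<phi>\<in>test_functions D.
        l2_inner D v ((partial 1 ^^ a) ((partial 2 ^^ b) \<phi>)) = (- 1) ^ (a + b) * l2_inner D w \<phi>)"

definition sobolev :: "(real^2) set \<Rightarrow> nat \<Rightarrow> (real^2 \<Rightarrow> real) set" where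
  "sobolev D m = {v \<in> L2 D. \<forall>a b. a + b \<le> m \<longrightarrow> (\<exists>w\<in>L2 D. has_weak_deriv D a b v w)}"

text \<open>The weak gradient and weak Laplacian are unique up to null sets; a representative is
  chosen.\<close>

definition weak_grad :: "(real^2) set \<Rightarrow> (real^2 \<Rightarrow> real) \<Rightarrow> real^2 \<Rightarrow> real^2" where
  "weak_grad D v = (SOME G. G \<in> L2 D \<and> has_weak_deriv D 1 0 v (\<lambda>x. G x $ 1)
                                     \<and> has_weak_deriv D 0 1 v (\<lambda>x. G x $ 2))"

definition has_weak_laplacian :: "(real^2) set \<Rightarrow> (real^2 \<Rightarrow> real) \<Rightarrow> (real^2 \<Rightarrow> real) \<Rightarrow> bool" where
  "has_weak_laplacian D v w \<longleftrightarrow>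
     (\<forall>\<phi>\<in>test_functions D. l2_inner D v (laplacian \<phi>) = l2_inner D w \<phi>)"

definition weak_laplacian :: "(real^2) set \<Rightarrow> (real^2 \<Rightarrow> real) \<Rightarrow> real^2 \<Rightarrow> real" where
  "weak_laplacian D v = (SOME w. w \<in> L2 D \<and> has_weak_laplacian D v w)"

definition smooth_tends_H1 ::
  "(real^2) set \<Rightarrow> (nat \<Rightarrow> real^2 \<Rightarrow> real) \<Rightarrow> (real^2 \<Rightarrow> real) \<Rightarrow> bool" where
  "smooth_tends_H1 D \<phi> v \<longleftrightarrow>
     (\<forall>j. smooth (\<phi> j)) \<and>
     (\<lambda>j. l2_norm D (\<lambda>x. \<phi> j x - v x)) \<longlonglongrightarrow> 0 \<and>
     (\<lambda>j. l2_norm D (\<lambda>x. grad (\<phi> j) x - weak_grad D v x)) \<longlonglongrightarrow> 0"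

text \<open>The closure of the test functions in the first-order Sobolev space.\<close>

definition sobolev_zero :: "(real^2) set \<Rightarrow> (real^2 \<Rightarrow> real) set" where
  "sobolev_zero D =
     {v \<in> sobolev D 1. \<exists>\<phi>. (\<forall>j. \<phi> j \<in> test_functions D) \<and> smooth_tends_H1 D \<phi> v}"


section \<open>Polygons and meshes\<close>

text \<open>A polygon is given by the cyclic list of its vertices. Interior angles equal to \<open>\<pi>\<close> are
  allowed, so that hanging nodes are vertices.\<close>

type_synonym polygon = "(real^2) list"

definition edges :: "polygon \<Rightarrow> ((real^2) \<times> (real^2)) list" where
  "edges P = zip P (rotate1 P)"

definition edge_set :: "(real^2) \<times> (real^2) \<Rightarrow> (real^2) set" where
  "edge_set e = closed_segment (fst e) (snd e)"

definition edge_length :: "(real^2) \<times> (real^2) \<Rightarrow> real" where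
  "edge_length e = dist (fst e) (snd e)"

definition boundary :: "polygon \<Rightarrow> (real^2) set" where
  "boundary P = (\<Union>e\<in>set (edges P). edge_set e)"

definition cell :: "polygon \<Rightarrow> (real^2) set" where
  "cell P = inside (boundary P)"

definition simple_polygon :: "polygon \<Rightarrow> bool" where
  "simple_polygon P \<longleftrightarrow> 3 \<le> length P \<and> distinct P \<and>
     (\<forall>e\<in>set (edges P). \<forall>f\<in>set (edges P). e \<noteq> f \<longrightarrow>
        edge_set e \<inter> edge_set f = {fst e, snd e} \<inter> {fst f, snd f})"

abbreviation cell_diam :: "polygon \<Rightarrow> real" where
  "cell_diam P \<equiv> diameter (cell P)"

abbreviation area :: "polygon \<Rightarrow> real" where
  "area P \<equiv> measure lebesgue (cell P)"

definition centroid :: "polygon \<Rightarrow> real^2" where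
  "centroid P = (1 / area P) *\<^sub>R (LINT x:cell P|lebesgue. x)"

definition convex_polygonal_domain :: "(real^2) set \<Rightarrow> bool" where
  "convex_polygonal_domain \<Omega> \<longleftrightarrow> convex \<Omega> \<and> (\<exists>P. simple_polygon P \<and> \<Omega> = cell P)"

definition polygonal_mesh :: "(real^2) set \<Rightarrow> polygon set \<Rightarrow> bool" where
  "polygonal_mesh \<Omega> \<T> \<longleftrightarrow> finite \<T> \<and> (\<forall>P\<in>\<T>. simple_polygon P) \<and>
     (\<forall>P\<in>\<T>. \<forall>Q\<in>\<T>. P \<noteq> Q \<longrightarrow> cell P \<inter> cell Q = {}) \<and>
     closure \<Omega> = (\<Union>P\<in>\<T>. closure (cell P))"

definition mesh_size :: "polygon set \<Rightarrow> real" where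
  "mesh_size \<T> = Max (cell_diam ` \<T>)"

definition star_shaped_wrt_disc :: "(real^2) set \<Rightarrow> real^2 \<Rightarrow> real \<Rightarrow> bool" where
  "star_shaped_wrt_disc K c r \<longleftrightarrow>
     ball c r \<subseteq> K \<and> (\<forall>y\<in>ball c r. \<forall>x\<in>K. closed_segment y x \<subseteq> K)"

definition mesh_regular :: "real \<Rightarrow> polygon set \<Rightarrow> bool" where
  "mesh_regular \<rho> \<T> \<longleftrightarrow> (\<forall>P\<in>\<T>.
     (\<forall>e\<in>set (edges P). \<rho> * cell_diam P \<le> edge_length e) \<and>
     (\<exists>c r. \<rho> * cell_diam P \<le> r \<and> star_shaped_wrt_disc (cell P) c r) \<and>
     \<rho> * mesh_size \<T> \<le> cell_diam P)"


section \<open>Polynomials, traces and projections\<close>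

text \<open>Polynomials on a polygon are identified with their unique extensions to the plane.\<close>

definition polys :: "nat \<Rightarrow> (real^2 \<Rightarrow> real) set" where
  "polys k = {p. \<exists>c :: nat \<Rightarrow> nat \<Rightarrow> real.
                \<forall>x. p x = (\<Sum>a\<le>k. \<Sum>b\<le>k - a. c a b * (x $ 1) ^ a * (x $ 2) ^ b)}"

definition scaled_monomial :: "polygon \<Rightarrow> nat \<Rightarrow> nat \<Rightarrow> real^2 \<Rightarrow> real" where
  "scaled_monomial P a b x =
     ((x $ 1 - centroid P $ 1) / cell_diam P) ^ a * ((x $ 2 - centroid P $ 2) / cell_diam P) ^ b"

text \<open>The degree is an integer: the set is empty for degree \<open>-1\<close>.\<close>

definition scaled_monomials :: "polygon \<Rightarrow> int \<Rightarrow> (real^2 \<Rightarrow> real) set" where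
  "scaled_monomials P s = {scaled_monomial P a b |a b. int (a + b) \<le> s}"

text \<open>Powers of the arc-length coordinate along the edge, centred at its midpoint and scaled by its
  length. Reversing the edge changes odd powers by a sign only, which cancels in the products of
  degrees of freedom occurring in the bilinear forms.\<close>

definition edge_monomial :: "(real^2) \<times> (real^2) \<Rightarrow> nat \<Rightarrow> real^2 \<Rightarrow> real" where
  "edge_monomial e j x =
     (((x - midpoint (fst e) (snd e)) \<bullet> sgn (snd e - fst e)) / edge_length e) ^ j"

definition edge_integral :: "(real^2) \<times> (real^2) \<Rightarrow> (real^2 \<Rightarrow> real) \<Rightarrow> real" where
  "edge_integral e f = edge_length e * (LINT t:{0..1}|lebesgue. f (linepath (fst e) (snd e) t))"

definition edge_L2 :: "(real^2) \<times> (real^2) \<Rightarrow> (real^2 \<Rightarrow> real) set" where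
  "edge_L2 e = {g. set_borel_measurable lebesgue {0..1::real} (\<lambda>t. g (linepath (fst e) (snd e) t)) \<and>
                   set_integrable lebesgue {0..1} (\<lambda>t. (g (linepath (fst e) (snd e) t))\<^sup>2)}"

text \<open>The trace operator is the extension by continuity, from the first-order Sobolev space to
  \<open>L2\<close> of the boundary, of the restriction of smooth functions.\<close>

definition has_trace :: "polygon \<Rightarrow> (real^2 \<Rightarrow> real) \<Rightarrow> (real^2 \<Rightarrow> real) \<Rightarrow> bool" where
  "has_trace P v g \<longleftrightarrow> v \<in> sobolev (cell P) 1 \<and> (\<forall>e\<in>set (edges P). g \<in> edge_L2 e) \<and>
     (\<exists>\<phi>. smooth_tends_H1 (cell P) \<phi> v \<and>
          (\<forall>e\<in>set (edges P). (\<lambda>j. edge_integral e (\<lambda>x. (\<phi> j x - g x)\<^sup>2)) \<longlonglongrightarrow> 0))"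

text \<open>The continuous representative of the trace, where there is one; boundary point values are
  taken from it.\<close>

definition bdry_val :: "polygon \<Rightarrow> (real^2 \<Rightarrow> real) \<Rightarrow> real^2 \<Rightarrow> real" where
  "bdry_val P v = (SOME g. continuous_on (boundary P) g \<and> has_trace P v g)"

definition P0 :: "polygon \<Rightarrow> nat \<Rightarrow> (real^2 \<Rightarrow> real) \<Rightarrow> real" where
  "P0 P k v = (if k = 1 then (\<Sum>z\<in>set P. bdry_val P v z) / real (length P)
               else (1 / area P) * (LINT x:cell P|lebesgue. v x))"

definition Pi1 :: "polygon \<Rightarrow> nat \<Rightarrow> (real^2 \<Rightarrow> real) \<Rightarrow> real^2 \<Rightarrow> real" where
  "Pi1 P k v = (THE p. p \<in> polys k \<and>
     (\<forall>q\<in>polys k. l2_inner (cell P) (grad p) (grad q) = l2_inner (cell P) (weak_grad (cell P) v) (grad q)) \<and>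
     P0 P k p = P0 P k v)"

definition Pi0 :: "polygon \<Rightarrow> nat \<Rightarrow> (real^2 \<Rightarrow> real) \<Rightarrow> real^2 \<Rightarrow> real" where
  "Pi0 P k v = (THE p. p \<in> polys k \<and>
     (\<forall>q\<in>polys k. l2_inner (cell P) p q = l2_inner (cell P) v q))"

text \<open>Set to zero on the skeleton of the mesh, a null set.\<close>

definition Pi0h :: "polygon set \<Rightarrow> nat \<Rightarrow> (real^2 \<Rightarrow> real) \<Rightarrow> real^2 \<Rightarrow> real" where
  "Pi0h \<T> k v x = (\<Sum>P\<in>\<T>. if x \<in> cell P then Pi0 P k v x else 0)"


section \<open>Virtual element space\<close>

definition bdry_polys :: "polygon \<Rightarrow> nat \<Rightarrow> (real^2 \<Rightarrow> real) set" where
  "bdry_polys P k = {g. continuous_on (boundary P) g \<and>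
     (\<forall>e\<in>set (edges P). \<exists>q :: real poly. degree q \<le> k \<and>
        (\<forall>t\<in>{0..1}. g (linepath (fst e) (snd e) t) = poly q t))}"

definition W_space :: "polygon \<Rightarrow> nat \<Rightarrow> (real^2 \<Rightarrow> real) set" where
  "W_space P k = {v \<in> sobolev (cell P) 1.
     (\<exists>p\<in>polys k. has_weak_laplacian (cell P) v p) \<and> (\<exists>g\<in>bdry_polys P k. has_trace P v g)}"

definition V_local :: "polygon \<Rightarrow> nat \<Rightarrow> (real^2 \<Rightarrow> real) set" where
  "V_local P k = {v \<in> W_space P k.
     \<forall>q \<in> scaled_monomials P (int k) - scaled_monomials P (int k - 2).
       l2_inner (cell P) v q = l2_inner (cell P) (Pi1 P k v) q}"

definition V_h :: "(real^2) set \<Rightarrow> polygon set \<Rightarrow> nat \<Rightarrow> (real^2 \<Rightarrow> real) set" where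
  "V_h \<Omega> \<T> k = {v \<in> sobolev_zero \<Omega>. \<forall>P\<in>\<T>. v \<in> V_local P k}"

text \<open>The moments are those of degree at most \<open>k - 2\<close>; there are none for \<open>k = 1\<close>.\<close>

definition dofs :: "polygon \<Rightarrow> nat \<Rightarrow> ((real^2 \<Rightarrow> real) \<Rightarrow> real) list" where
  "dofs P k =
     map (\<lambda>z v. bdry_val P v z) P @
     concat (map (\<lambda>e. map (\<lambda>j v. 1 / edge_length e *
         edge_integral e (\<lambda>x. bdry_val P v x * edge_monomial e j x)) [0..<k - 1]) (edges P)) @
     concat (map (\<lambda>a. map (\<lambda>b v. 1 / area P *
         l2_inner (cell P) v (scaled_monomial P a b)) [0..<k - 1 - a]) [0..<k - 1])"

definition a_h :: "polygon set \<Rightarrow> nat \<Rightarrow> (real^2 \<Rightarrow> real) \<Rightarrow> (real^2 \<Rightarrow> real) \<Rightarrow> real" where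
  "a_h \<T> k u v = (\<Sum>P\<in>\<T>.
     l2_inner (cell P) (grad (Pi1 P k u)) (grad (Pi1 P k v)) +
     (\<Sum>\<phi>\<leftarrow>dofs P k. \<phi> (\<lambda>x. u x - Pi1 P k u x) * \<phi> (\<lambda>x. v x - Pi1 P k v x)))"

definition m_h :: "polygon set \<Rightarrow> nat \<Rightarrow> (real^2 \<Rightarrow> real) \<Rightarrow> (real^2 \<Rightarrow> real) \<Rightarrow> real" where
  "m_h \<T> k u v = (\<Sum>P\<in>\<T>.
     l2_inner (cell P) (Pi0 P k u) (Pi0 P k v) +
     (cell_diam P)\<^sup>2 *
       (\<Sum>\<phi>\<leftarrow>dofs P k. \<phi> (\<lambda>x. u x - Pi0 P k u x) * \<phi> (\<lambda>x. v x - Pi0 P k v x)))"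

text \<open>The squared norms \<open>a_h w w\<close> and \<open>m_h w w\<close>.\<close>

abbreviation a_h_sq :: "polygon set \<Rightarrow> nat \<Rightarrow> (real^2 \<Rightarrow> real) \<Rightarrow> real" where
  "a_h_sq \<T> k w \<equiv> a_h \<T> k w w"

abbreviation m_h_sq :: "polygon set \<Rightarrow> nat \<Rightarrow> (real^2 \<Rightarrow> real) \<Rightarrow> real" where
  "m_h_sq \<T> k w \<equiv> m_h \<T> k w w"

text \<open>\<open>w = R\<^sub>h u\<close>, as a relation because functions are identified only up to null sets.\<close>

definition is_elliptic_projection ::
  "(real^2) set \<Rightarrow> polygon set \<Rightarrow> nat \<Rightarrow> (real^2 \<Rightarrow> real) \<Rightarrow> (real^2 \<Rightarrow> real) \<Rightarrow> bool" where
  "is_elliptic_projection \<Omega> \<T> k u w \<longleftrightarrow> w \<in> V_h \<Omega> \<T> k \<and>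
     (\<forall>\<phi>\<in>V_h \<Omega> \<T> k. a_h \<T> k w \<phi> = - l2_inner \<Omega> (weak_laplacian \<Omega> u) (Pi0h \<T> k \<phi>))"


section \<open>Time discretisation and energy\<close>

text \<open>The values at \<open>n = 0\<close> are irrelevant.\<close>

definition D_tau :: "real \<Rightarrow> (nat \<Rightarrow> real^2 \<Rightarrow> real) \<Rightarrow> nat \<Rightarrow> real^2 \<Rightarrow> real" where
  "D_tau \<tau> w n = (if n = 1 then (\<lambda>x. (w 1 x - w 0 x) / \<tau>)
                   else (\<lambda>x. (w n x - w (n - 2) x) / (2 * \<tau>)))"

definition hat :: "(nat \<Rightarrow> real^2 \<Rightarrow> real) \<Rightarrow> nat \<Rightarrow> real^2 \<Rightarrow> real" where
  "hat w n = (if n = 1 then (\<lambda>x. (w 1 x + w 0 x) / 2)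
              else (\<lambda>x. (w n x + w (n - 2) x) / 2))"

definition energy :: "(real^2) set \<Rightarrow> polygon set \<Rightarrow> nat \<Rightarrow> real \<Rightarrow>
    (nat \<Rightarrow> real^2 \<Rightarrow> real) \<Rightarrow> (nat \<Rightarrow> real^2 \<Rightarrow> real) \<Rightarrow> nat \<Rightarrow> real" where
  "energy \<Omega> \<T> k \<gamma> u v n = (if n = 0 then
       \<gamma> / 2 * m_h_sq \<T> k (v 0) + 1 / 2 * a_h_sq \<T> k (u 0)
       + 1 / 4 * (l2_norm \<Omega> (\<lambda>x. (Pi0h \<T> k (u 0) x)\<^sup>2))\<^sup>2 - 1 / 2 * m_h_sq \<T> k (u 0)
     else
       \<gamma> / 4 * (m_h_sq \<T> k (v n) + m_h_sq \<T> k (v (n - 1)))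
       + 1 / 4 * (a_h_sq \<T> k (u n) + a_h_sq \<T> k (u (n - 1)))
       + 1 / 4 * l2_inner \<Omega> (\<lambda>x. (Pi0h \<T> k (u n) x)\<^sup>2) (\<lambda>x. (Pi0h \<T> k (u (n - 1)) x)\<^sup>2)
       - 1 / 4 * (m_h_sq \<T> k (u n) + m_h_sq \<T> k (u (n - 1))))"

end

theory Submission
  imports Defs
begin

text \<open>Tested with the difference quotient of \<open>u\<close>, the scheme becomes a sum of differences of squares,
  namely of the energies, and of the nonnegative term \<open>m_h (D_tau u) (D_tau u)\<close>. This uses that
  \<open>V_h\<close> is a linear space on which \<open>a_h\<close> and \<open>m_h\<close> are bilinear, which is not immediate: weak
  gradients, boundary values and the two projections are values of choice operators, so their
  linearity amounts to existence and uniqueness. Weak gradients are unique almost everywhere by the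
  fundamental lemma of the calculus of variations. Traces are unique because near an interior point
  of an edge, by the Jordan-Brouwer theorem, one side of the edge lies in the cell, where a smooth
  function is controlled on the edge by its \<open>H\<^sup>1\<close> norm on the cell. The projections are Riesz
  representers for definite forms on the finite-dimensional space of polynomials.\<close>

section \<open>Square-integrable functions\<close>

text \<open>The two-level energy is dictated by the leapfrog step. Testing with
  \<open>D_tau \<tau> u n\<close> compares the levels \<open>n\<close> and \<open>n - 2\<close>;
  each quadratic quantity is therefore averaged over two neighbouring levels, and the common level
  \<open>n - 1\<close> cancels between consecutive energies. The quartic term pairs the squares of
  neighbouring levels: the lagged weight is common to the two levels compared, and by symmetry of
  the inner product the older pairing is the one in the previous energy. In the first step the old
  level also serves as lagged iterate. Linearity is needed in two strengths. Weak gradients combine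
  only almost everywhere, which suffices because they enter under integrals. Boundary values enter
  pointwise, at the vertices, so traces must be unique as continuous functions on all of the
  boundary. Topology comes in because a cell is the inside of a closed polygonal curve: the vertex
  list does not say on which side of an edge the cell lies, nor that it touches the edge at
  all.\<close>

lemma set_borel_measurable_inner:
  fixes f g :: "'a \<Rightarrow> 'b::euclidean_space"
  assumes "set_borel_measurable M A f" "set_borel_measurable M A g"
  shows "set_borel_measurable M A (\<lambda>x. f x \<bullet> g x)"
proof -
  have "(\<lambda>x. indicator A x *\<^sub>R (f x \<bullet> g x)) = (\<lambda>x. (indicator A x *\<^sub>R f x) \<bullet> (indicator A x *\<^sub>R g x))"
    by (auto simp: indicator_def)
  with assms show ?thesis
    unfolding set_borel_measurable_def by (simp only: borel_measurable_inner)
qed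

lemma set_borel_measurable_linear_combination:
  fixes f g :: "'a \<Rightarrow> 'b::euclidean_space"
  assumes "set_borel_measurable M A f" "set_borel_measurable M A g"
  shows "set_borel_measurable M A (\<lambda>x. a *\<^sub>R f x + b *\<^sub>R g x)"
proof -
  have "(\<lambda>x. indicator A x *\<^sub>R (a *\<^sub>R f x + b *\<^sub>R g x)) =
        (\<lambda>x. a *\<^sub>R (indicator A x *\<^sub>R f x) + b *\<^sub>R (indicator A x *\<^sub>R g x))"
    by (auto simp: indicator_def)
  with assms show ?thesis
    unfolding set_borel_measurable_def
    by (simp only: borel_measurable_add borel_measurable_scaleR borel_measurable_const)
qed

lemma set_integrable_dominated:
  fixes f :: "'a \<Rightarrow> 'b::{banach, second_countable_topology}" and g :: "'a \<Rightarrow> 'c::{banach, second_countable_topology}"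
  assumes "set_integrable M A f" "set_borel_measurable M A g" "\<And>x. x \<in> A \<Longrightarrow> norm (g x) \<le> norm (f x)"
  shows "set_integrable M A g"
  using assms(3) by (intro set_integrable_bound[OF assms(1,2)] AE_I2) blast

text \<open>Cauchy-Schwarz, and the bound of a product by the sum of squares, give an integrable
  majorant.\<close>

lemma L2_inner_integrable:
  fixes f g :: "real^2 \<Rightarrow> 'a::euclidean_space"
  assumes "f \<in> L2 D" "g \<in> L2 D"
  shows "set_integrable lebesgue D (\<lambda>x. f x \<bullet> g x)"
proof -
  have "set_integrable lebesgue D (\<lambda>x. (norm (f x))\<^sup>2 + (norm (g x))\<^sup>2)"
    using assms by (intro set_integral_add) (auto simp: L2_def)
  moreover have "set_borel_measurable lebesgue D (\<lambda>x. f x \<bullet> g x)"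
    using assms by (intro set_borel_measurable_inner) (auto simp: L2_def)
  moreover have "norm (f x \<bullet> g x) \<le> norm ((norm (f x))\<^sup>2 + (norm (g x))\<^sup>2)" for x
  proof -
    have "\<bar>f x \<bullet> g x\<bar> \<le> norm (f x) * norm (g x)"
      by (rule Cauchy_Schwarz_ineq2)
    also have "\<dots> \<le> (norm (f x))\<^sup>2 + (norm (g x))\<^sup>2"
      using sum_squares_bound[of "norm (f x)" "norm (g x)"] mult_nonneg_nonneg[OF norm_ge_zero[of "f x"] norm_ge_zero[of "g x"]] by linarith
    finally show ?thesis by simp
  qed
  ultimately show ?thesis
    by - (rule set_integrable_dominated)
qed

lemma L2_linear_combination:
  fixes f g :: "real^2 \<Rightarrow> 'a::euclidean_space"
  assumes "f \<in> L2 D" "g \<in> L2 D"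
  shows "(\<lambda>x. a *\<^sub>R f x + b *\<^sub>R g x) \<in> L2 D"
proof -
  have "(\<lambda>x. (norm (a *\<^sub>R f x + b *\<^sub>R g x))\<^sup>2) =
        (\<lambda>x. a\<^sup>2 * (norm (f x))\<^sup>2 + ((2 * a * b) * (f x \<bullet> g x) + b\<^sup>2 * (norm (g x))\<^sup>2))"
    by (rule ext, simp only: power2_norm_eq_inner inner_add_left inner_add_right inner_scaleR_left
        inner_scaleR_right) (simp add: inner_commute algebra_simps power2_eq_square)
  moreover have "set_integrable lebesgue D
      (\<lambda>x. a\<^sup>2 * (norm (f x))\<^sup>2 + ((2 * a * b) * (f x \<bullet> g x) + b\<^sup>2 * (norm (g x))\<^sup>2))"
    using assms L2_inner_integrable[OF assms]
    by (intro set_integral_add set_integrable_mult_right) (auto simp: L2_def)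
  ultimately show ?thesis
    using assms set_borel_measurable_linear_combination[of lebesgue D f g a b] by (auto simp: L2_def)
qed

lemma L2_zero [simp]: "(\<lambda>x. 0) \<in> L2 D"
  by (auto simp: L2_def set_borel_measurable_def set_integrable_def)

lemma L2_add:
  fixes f g :: "real^2 \<Rightarrow> 'a::euclidean_space"
  shows "f \<in> L2 D \<Longrightarrow> g \<in> L2 D \<Longrightarrow> (\<lambda>x. f x + g x) \<in> L2 D"
  using L2_linear_combination[of f D g 1 1] by simp

lemma L2_diff:
  fixes f g :: "real^2 \<Rightarrow> 'a::euclidean_space"
  shows "f \<in> L2 D \<Longrightarrow> g \<in> L2 D \<Longrightarrow> (\<lambda>x. f x - g x) \<in> L2 D"
  using L2_linear_combination[of f D g 1 "-1"] by simp

lemma L2_scaleR: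
  fixes f :: "real^2 \<Rightarrow> 'a::euclidean_space"
  shows "f \<in> L2 D \<Longrightarrow> (\<lambda>x. c *\<^sub>R f x) \<in> L2 D"
  using L2_linear_combination[of f D f c 0] by simp

lemma L2_combination:
  "f \<in> L2 D \<Longrightarrow> g \<in> L2 D \<Longrightarrow> (\<lambda>x. a * f x + b * g x :: real) \<in> L2 D"
  using L2_linear_combination[of f D g a b] by simp

text \<open>Fixing the origin lets \<open>g\<close> commute with multiplication by the indicator of
  \<open>D\<close>, so measurability of the zero extension carries over; the growth bound supplies
  the majorant. Meant for passing between a vector field and its components.\<close>

lemma L2_image:
  assumes "f \<in> L2 D" "g \<in> borel_measurable borel" "g 0 = 0" "\<And>y. norm (g y) \<le> norm y"
  shows "(\<lambda>x. g (f x)) \<in> L2 D"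
proof -
  have eq: "(\<lambda>x. indicator D x *\<^sub>R g (f x)) = (\<lambda>x. g (indicator D x *\<^sub>R f x))"
    using assms(3) by (auto simp: indicator_def)
  have meas: "set_borel_measurable lebesgue D (\<lambda>x. g (f x))"
    unfolding set_borel_measurable_def eq
    using assms(1,2) by (auto simp: L2_def set_borel_measurable_def intro: measurable_compose)
  then have "set_borel_measurable lebesgue D (\<lambda>x. (norm (g (f x)))\<^sup>2)"
    unfolding power2_norm_eq_inner by (intro set_borel_measurable_inner)
  moreover have "norm ((norm (g (f x)))\<^sup>2) \<le> norm ((norm (f x))\<^sup>2)" for x
    by (simp add: power_mono assms(4))
  moreover have "set_integrable lebesgue D (\<lambda>x. (norm (f x))\<^sup>2)"
    using assms(1) by (simp add: L2_def)
  ultimately have "set_integrable lebesgue D (\<lambda>x. (norm (g (f x)))\<^sup>2)"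
    by - (rule set_integrable_dominated)
  with meas show ?thesis by (simp add: L2_def)
qed

lemma L2_component:
  fixes G :: "real^2 \<Rightarrow> real^2"
  assumes "G \<in> L2 D"
  shows "(\<lambda>x. G x $ i) \<in> L2 D"
  using L2_image[OF assms, of "\<lambda>y. y $ i"] by (auto simp: component_le_norm_cart)

lemma L2_axis:
  assumes "w \<in> L2 D"
  shows "(\<lambda>x. axis i (w x) :: real^2) \<in> L2 D"
proof -
  have "(\<lambda>x. axis i (w x) :: real^2) = (\<lambda>x. w x *\<^sub>R axis i 1)"
    by (simp add: axis_def vec_eq_iff fun_eq_iff)
  then show ?thesis
    using L2_image[OF assms, of "\<lambda>y. y *\<^sub>R axis i 1 :: real^2"] by auto
qed

lemma l2_inner_commute: "l2_inner D f g = l2_inner D g f"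
  by (simp add: l2_inner_def inner_commute)

lemma l2_inner_add_left:
  assumes "f \<in> L2 D" "g \<in> L2 D" "h \<in> L2 D"
  shows "l2_inner D (\<lambda>x. f x + g x) h = l2_inner D f h + l2_inner D g h"
  unfolding l2_inner_def inner_add_left
  using assms by (intro set_integral_add L2_inner_integrable)

lemma l2_inner_scaleR_left: "l2_inner D (\<lambda>x. c *\<^sub>R f x) g = c * l2_inner D f g"
  unfolding l2_inner_def by simp

lemma l2_inner_linear_left:
  fixes f g :: "real^2 \<Rightarrow> 'a::euclidean_space"
  assumes "f \<in> L2 D" "g \<in> L2 D" "h \<in> L2 D"
  shows "l2_inner D (\<lambda>x. a *\<^sub>R f x + b *\<^sub>R g x) h = a * l2_inner D f h + b * l2_inner D g h"
  using assms by (simp add: l2_inner_add_left L2_scaleR l2_inner_scaleR_left)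

lemma l2_inner_combination_left:
  assumes "f \<in> L2 D" "g \<in> L2 D" "h \<in> L2 D"
  shows "l2_inner D (\<lambda>x. a * f x + b * g x :: real) h = a * l2_inner D f h + b * l2_inner D g h"
  using l2_inner_linear_left[OF assms, of a b] by simp

lemma l2_inner_diff_left:
  assumes "f \<in> L2 D" "g \<in> L2 D" "h \<in> L2 D"
  shows "l2_inner D (\<lambda>x. f x - g x) h = l2_inner D f h - l2_inner D g h"
  using l2_inner_linear_left[OF assms, of 1 "-1"] by simp

lemma l2_inner_add_right:
  assumes "f \<in> L2 D" "g \<in> L2 D" "h \<in> L2 D"
  shows "l2_inner D h (\<lambda>x. f x + g x) = l2_inner D h f + l2_inner D h g"
  unfolding l2_inner_commute[of D h] by (rule l2_inner_add_left[OF assms])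

lemma l2_inner_diff_right:
  assumes "f \<in> L2 D" "g \<in> L2 D" "h \<in> L2 D"
  shows "l2_inner D h (\<lambda>x. f x - g x) = l2_inner D h f - l2_inner D h g"
  unfolding l2_inner_commute[of D h] by (rule l2_inner_diff_left[OF assms])

lemma l2_inner_combination_right:
  assumes "f \<in> L2 D" "g \<in> L2 D" "h \<in> L2 D"
  shows "l2_inner D h (\<lambda>x. a * f x + b * g x :: real) = a * l2_inner D h f + b * l2_inner D h g"
  unfolding l2_inner_commute[of D h] by (rule l2_inner_combination_left[OF assms])

text \<open>Membership in \<open>L2\<close> supplies the measurability that an almost-everywhere
  congruence of integrals asks for.\<close>

lemma l2_inner_cong_AE:
  assumes "AE x in lebesgue. x \<in> D \<longrightarrow> f x = f' x" "f \<in> L2 D" "f' \<in> L2 D" "g \<in> L2 D"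
  shows "l2_inner D f g = l2_inner D f' g"
  unfolding l2_inner_def set_lebesgue_integral_def
  using assms set_borel_measurable_inner[of lebesgue D f g] set_borel_measurable_inner[of lebesgue D f' g]
  by (intro integral_cong_AE) (auto simp: L2_def set_borel_measurable_def elim!: eventually_mono)

lemma l2_inner_self_nonneg: "0 \<le> l2_inner D f f"
  unfolding l2_inner_def set_lebesgue_integral_def by (intro integral_nonneg_AE) (auto simp: indicator_def)

text \<open>The parallelogram law with one nonnegative square dropped. It does the work of the
  triangle inequality where only convergence to zero matters, and stays with squared norms.\<close>

lemma l2_inner_self_add_le:
  fixes f g :: "real^2 \<Rightarrow> 'a::euclidean_space"
  assumes "f \<in> L2 D" "g \<in> L2 D"
  shows "l2_inner D (\<lambda>x. f x + g x) (\<lambda>x. f x + g x) \<le> 2 * l2_inner D f f + 2 * l2_inner D g g"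
proof -
  have "l2_inner D (\<lambda>x. f x + g x) (\<lambda>x. f x + g x) + l2_inner D (\<lambda>x. f x - g x) (\<lambda>x. f x - g x)
     = 2 * l2_inner D f f + 2 * l2_inner D g g"
    using assms by (simp add: l2_inner_add_left l2_inner_add_right l2_inner_diff_left l2_inner_diff_right L2_add L2_diff)
  then show ?thesis using l2_inner_self_nonneg[of D "\<lambda>x. f x - g x"] by linarith
qed

section \<open>Smooth functions\<close>

lemma partial_eqI: "(f has_derivative f') (at x) \<Longrightarrow> partial i f x = f' (axis i 1)"
  by (metis frechet_derivative_at partial_def)

text \<open>All iterated derivatives of \<open>f\<close> stay in \<open>S\<close>, so a class closed
  under \<open>partial\<close> replaces any formula for a general iterated derivative.\<close>

lemma smooth_coinduct:
  assumes "f \<in> S" "\<And>g. g \<in> S \<Longrightarrow> g differentiable_on UNIV" "\<And>g i. g \<in> S \<Longrightarrow> partial i g \<in> S"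
  shows "smooth f"
proof -
  have "foldr partial is f \<in> S" for "is"
    by (induction "is") (auto simp: assms)
  then show ?thesis
    using assms(2) by (auto simp: smooth_def)
qed

lemma smooth_partial: "smooth f \<Longrightarrow> smooth (partial i f)"
  unfolding smooth_def
proof
  fix js
  assume "\<forall>is. foldr partial is f differentiable_on UNIV"
  \<comment> \<open>\<open>foldr\<close> applies the last entry of the list first, hence
    \<open>i\<close> goes at the end.\<close>
  from this[rule_format, of "js @ [i]"] show "foldr partial js (partial i f) differentiable_on UNIV"
    by simp
qed

lemma smooth_differentiable: "smooth f \<Longrightarrow> f differentiable (at x)"
  unfolding smooth_def by (metis differentiable_on_def foldr_Nil id_apply UNIV_I)

lemma smooth_has_derivative: "smooth f \<Longrightarrow> (f has_derivative frechet_derivative f (at x)) (at x)"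
  using smooth_differentiable frechet_derivative_works by blast

lemma smooth_continuous_on: "smooth f \<Longrightarrow> continuous_on S f"
  by (meson differentiable_imp_continuous_within smooth_differentiable continuous_at_imp_continuous_on)

lemma partial_linear:
  assumes "f differentiable (at x)" "g differentiable (at x)"
  shows "partial i (\<lambda>x. a * f x + b * g x) x = a * partial i f x + b * partial i g x"
proof -
  have "((\<lambda>x. a * f x + b * g x) has_derivative
     (\<lambda>h. a * frechet_derivative f (at x) h + b * frechet_derivative g (at x) h)) (at x)"
    using assms frechet_derivative_works by (auto intro!: derivative_eq_intros)
  from partial_eqI[OF this] show ?thesis by (simp add: partial_def)
qed

lemma partial_mult:
  assumes "f differentiable (at x)" "g differentiable (at x)"
  shows "partial i (\<lambda>x. f x * g x) x = f x * partial i g x + partial i f x * g x"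
proof -
  have "((\<lambda>x. f x * g x) has_derivative
     (\<lambda>h. f x * frechet_derivative g (at x) h + frechet_derivative f (at x) h * g x)) (at x)"
    using assms frechet_derivative_works by (intro has_derivative_mult) auto
  from partial_eqI[OF this] show ?thesis by (simp add: partial_def)
qed

lemma smooth_combination:
  assumes "smooth f" "smooth g"
  shows "smooth (\<lambda>x. a * f x + b * g x)"
proof (rule smooth_coinduct)
  let ?S = "{\<lambda>x. a * f x + b * g x | f g. smooth f \<and> smooth g}"
  show "(\<lambda>x. a * f x + b * g x) \<in> ?S" using assms by blast
  fix h i assume "h \<in> ?S"
  then obtain p q where h: "h = (\<lambda>x. a * p x + b * q x)" "smooth p" "smooth q" by blast
  show "h differentiable_on UNIV"
    using h smooth_differentiable by (auto simp: differentiable_on_def intro!: derivative_intros)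
  have "partial i h = (\<lambda>x. a * partial i p x + b * partial i q x)"
    using h by (auto simp: partial_linear smooth_differentiable)
  then show "partial i h \<in> ?S" using h smooth_partial by blast
qed

lemma smooth_add: "smooth f \<Longrightarrow> smooth g \<Longrightarrow> smooth (\<lambda>x. f x + g x)"
  using smooth_combination[of f g 1 1] by simp

lemma partial_const [simp]: "partial i (\<lambda>x. c) = (\<lambda>x. 0)"
  by (auto simp: partial_eqI[OF has_derivative_const])

lemma smooth_const [simp]: "smooth (\<lambda>x. c)"
  by (rule smooth_coinduct[where S = "{\<lambda>x. d |d. True}"]) auto

lemma partial_coord: "partial i (\<lambda>x. x $ j) = (\<lambda>x. if i = j then 1 else 0)"
proof
  fix x :: "real^2"
  have "((\<lambda>x. x $ j) has_derivative (\<lambda>h. h $ j)) (at x)"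
    by (intro bounded_linear_imp_has_derivative bounded_linear_vec_nth)
  from partial_eqI[OF this] show "partial i (\<lambda>x. x $ j) x = (if i = j then 1 else 0)"
    by (simp add: axis_def)
qed

lemma smooth_coord [simp]: "smooth (\<lambda>x. x $ j)"
proof (rule smooth_coinduct[where S = "insert (\<lambda>x. x $ j) {\<lambda>x. d |d. True}"])
  fix g :: "real^2 \<Rightarrow> real"
  assume g: "g \<in> insert (\<lambda>x. x $ j) {\<lambda>x. d |d. True}"
  then show "g differentiable_on UNIV"
    by (auto intro: bounded_linear_imp_differentiable_on bounded_linear_vec_nth)
  show "partial i g \<in> insert (\<lambda>x. x $ j) {\<lambda>x. d |d. True}" for i
    using g by (auto simp: partial_coord)
qed auto

text \<open>The product rule turns a product into a sum of two products, so sums have to be allowed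
  for the class to be closed under \<open>partial\<close>. It is the invariant fed to
  \<open>smooth_coinduct\<close>.\<close>

inductive_set product_sums :: "(real^2 \<Rightarrow> real) set" where
  base: "smooth f \<Longrightarrow> smooth g \<Longrightarrow> (\<lambda>x. f x * g x) \<in> product_sums"
| add: "f \<in> product_sums \<Longrightarrow> g \<in> product_sums \<Longrightarrow> (\<lambda>x. f x + g x) \<in> product_sums"

lemma product_sums_partial:
  "h \<in> product_sums \<Longrightarrow> h differentiable_on UNIV \<and> partial i h \<in> product_sums"
proof (induction rule: product_sums.induct)
  case (base f g)
  have "partial i (\<lambda>x. f x * g x) = (\<lambda>x. f x * partial i g x + partial i f x * g x)"
    using base by (auto simp: partial_mult smooth_differentiable)
  moreover have "(\<lambda>x. f x * g x) differentiable_on UNIV"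
    using base smooth_differentiable by (auto simp: differentiable_on_def)
  ultimately show ?case
    using base by (auto intro!: product_sums.intros smooth_partial)
next
  case (add f g)
  then have "partial i (\<lambda>x. f x + g x) = (\<lambda>x. partial i f x + partial i g x)"
    using partial_linear[of f _ g i 1 1] by (auto simp: differentiable_on_def)
  with add show ?case by (auto intro!: product_sums.intros differentiable_on_add)
qed

lemma smooth_mult: "smooth f \<Longrightarrow> smooth g \<Longrightarrow> smooth (\<lambda>x. f x * g x)"
  using product_sums_partial by (intro smooth_coinduct[of _ product_sums]) (auto intro: product_sums.base)

lemma smooth_power: "smooth f \<Longrightarrow> smooth (\<lambda>x. f x ^ n)"
  by (induction n) (auto intro: smooth_mult)

lemma smooth_sum: "(\<And>i. i \<in> I \<Longrightarrow> smooth (f i)) \<Longrightarrow> smooth (\<lambda>x. \<Sum>i\<in>I. f i x)"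
  by (induction I rule: infinite_finite_induct) (auto intro: smooth_add)

lemma grad_combination:
  assumes "smooth f" "smooth g"
  shows "grad (\<lambda>x. a * f x + b * g x) x = a *\<^sub>R grad f x + b *\<^sub>R grad g x"
  using assms by (auto simp: grad_def vec_eq_iff partial_linear smooth_differentiable)

lemma smooth_grad_continuous_on: "smooth f \<Longrightarrow> continuous_on S (grad f)"
  unfolding grad_def by (intro continuous_intros smooth_continuous_on smooth_partial)

section \<open>Test functions\<close>

lemma test_function_smooth: "\<phi> \<in> test_functions D \<Longrightarrow> smooth \<phi>"
  by (simp add: test_functions_def)

text \<open>Any compact set outside which \<open>\<phi>\<close> vanishes will do, so the closure of
  the support never has to be computed.\<close>

lemma test_functionI:
  assumes "smooth \<phi>" "compact K" "K \<subseteq> D" "\<And>x. x \<notin> K \<Longrightarrow> \<phi> x = 0"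
  shows "\<phi> \<in> test_functions D"
proof -
  have "{x. \<phi> x \<noteq> 0} \<subseteq> K" using assms(4) by blast
  then have "closure {x. \<phi> x \<noteq> 0} \<subseteq> K"
    by (simp add: assms(2) closure_minimal compact_imp_closed)
  then have "compact (closure {x. \<phi> x \<noteq> 0}) \<and> closure {x. \<phi> x \<noteq> 0} \<subseteq> D"
    using assms(2,3) by (meson closed_closure compact_closure compact_imp_bounded bounded_subset closure_subset subset_trans)
  with assms(1) show ?thesis by (simp add: test_functions_def)
qed

lemma test_functionE:
  assumes "\<phi> \<in> test_functions D"
  obtains K where "compact K" "K \<subseteq> D" "\<And>x. x \<notin> K \<Longrightarrow> \<phi> x = 0"
proof
  show "compact (closure {x. \<phi> x \<noteq> 0})" "closure {x. \<phi> x \<noteq> 0} \<subseteq> D"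
    using assms by (auto simp: test_functions_def)
  show "x \<notin> closure {x. \<phi> x \<noteq> 0} \<Longrightarrow> \<phi> x = 0" for x
    using closure_subset[of "{x. \<phi> x \<noteq> 0}"] by blast
qed

lemma test_function_combination:
  assumes "\<phi> \<in> test_functions D" "\<psi> \<in> test_functions D"
  shows "(\<lambda>x. a * \<phi> x + b * \<psi> x) \<in> test_functions D"
proof -
  obtain K where K: "compact K" "K \<subseteq> D" "\<And>x. x \<notin> K \<Longrightarrow> \<phi> x = 0"
    using test_functionE[OF assms(1)] by blast
  obtain L where L: "compact L" "L \<subseteq> D" "\<And>x. x \<notin> L \<Longrightarrow> \<psi> x = 0"
    using test_functionE[OF assms(2)] by blast
  show ?thesis
    by (rule test_functionI[of _ "K \<union> L"])
      (use K L assms in \<open>auto intro: smooth_combination test_function_smooth\<close>)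
qed

lemma test_function_mult:
  assumes "\<phi> \<in> test_functions D" "smooth p"
  shows "(\<lambda>x. p x * \<phi> x) \<in> test_functions D"
proof -
  obtain K where K: "compact K" "K \<subseteq> D" "\<And>x. x \<notin> K \<Longrightarrow> \<phi> x = 0"
    using test_functionE[OF assms(1)] by blast
  show ?thesis
    by (rule test_functionI[of _ K]) (use K assms in \<open>auto intro: smooth_mult test_function_smooth\<close>)
qed

lemma test_function_partial:
  assumes "\<phi> \<in> test_functions D"
  shows "partial i \<phi> \<in> test_functions D"
proof -
  obtain K where K: "compact K" "K \<subseteq> D" "\<And>x. x \<notin> K \<Longrightarrow> \<phi> x = 0"
    using test_functionE[OF assms(1)] by blast
  have "partial i \<phi> x = 0" if "x \<notin> K" for x
  proof -
    have "(\<phi> has_derivative (\<lambda>h. 0)) (at x)"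
      by (rule has_derivative_transform_within_open[where f = "\<lambda>x. 0" and s="- K"])
        (use K that in \<open>auto simp: compact_imp_closed open_Compl\<close>)
    from partial_eqI[OF this] show ?thesis .
  qed
  then show ?thesis
    by (intro test_functionI[of _ K]) (use K assms in \<open>auto intro: smooth_partial test_function_smooth\<close>)
qed

lemma test_function_iterated_partial:
  "\<phi> \<in> test_functions D \<Longrightarrow> (partial i ^^ a) \<phi> \<in> test_functions D"
  by (induction a) (auto intro: test_function_partial)

text \<open>The mesh cells and the domain itself are both instances. Openness serves the fundamental
  lemma; boundedness makes functions that are continuous on the plane square integrable.\<close>

locale bounded_open =
  fixes D :: "(real^2) set"
  assumes open_D: "open D" and bounded_D: "bounded D"
begin

lemma sets_D [measurable, simp]: "D \<in> sets lebesgue" "D \<in> sets borel"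
  using open_D by auto

lemma emeasure_D_finite: "emeasure lebesgue D < \<infinity>"
  using bounded_set_imp_lmeasurable[OF bounded_D] by (simp add: fmeasurable_def)

lemma bounded_measurable_integrable:
  fixes f :: "real^2 \<Rightarrow> 'a::euclidean_space"
  assumes "set_borel_measurable lebesgue D f" "\<And>x. x \<in> D \<Longrightarrow> norm (f x) \<le> B"
  shows "set_integrable lebesgue D f"
proof -
  have "set_integrable lebesgue D (\<lambda>x. B)"
    unfolding set_integrable_def using emeasure_D_finite by auto
  moreover have "norm (f x) \<le> norm B" if "x \<in> D" for x
    using assms(2)[OF that] by simp
  ultimately show ?thesis
    using assms(1) by - (rule set_integrable_dominated)
qed

lemma bounded_measurable_L2:
  fixes f :: "real^2 \<Rightarrow> 'a::euclidean_space"
  assumes "set_borel_measurable lebesgue D f" "\<And>x. x \<in> D \<Longrightarrow> norm (f x) \<le> B"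
  shows "f \<in> L2 D"
proof -
  have "set_borel_measurable lebesgue D (\<lambda>x. (norm (f x))\<^sup>2)"
    unfolding power2_norm_eq_inner using assms by (intro set_borel_measurable_inner)
  moreover have "norm ((norm (f x))\<^sup>2) \<le> B\<^sup>2" if "x \<in> D" for x
    using assms(2)[OF that] by (simp add: power_mono)
  ultimately show ?thesis
    using bounded_measurable_integrable[of "\<lambda>x. (norm (f x))\<^sup>2"] assms(1) by (auto simp: L2_def)
qed

lemma continuous_measurable:
  fixes f :: "real^2 \<Rightarrow> 'a::euclidean_space"
  assumes "continuous_on D f"
  shows "set_borel_measurable lebesgue D f"
proof -
  have "(\<lambda>x. indicator D x *\<^sub>R f x) \<in> borel_measurable borel"
    using open_D assms by (intro borel_measurable_continuous_on_indicator) auto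
  then show ?thesis
    unfolding set_borel_measurable_def by (simp add: measurable_completion)
qed

lemma continuous_L2:
  fixes f :: "real^2 \<Rightarrow> 'a::euclidean_space"
  assumes "continuous_on UNIV f"
  shows "f \<in> L2 D"
proof -
  have "compact (f ` closure D)"
    using assms bounded_D by (intro compact_continuous_image) (auto intro: continuous_on_subset)
  then have "bounded (f ` D)"
    by (meson bounded_subset closure_subset compact_imp_bounded image_mono)
  then obtain B where "\<And>x. x \<in> D \<Longrightarrow> norm (f x) \<le> B"
    by (auto simp: bounded_iff)
  then show ?thesis
    by (intro bounded_measurable_L2 continuous_measurable continuous_on_subset[OF assms]) auto
qed

lemma smooth_L2: "smooth f \<Longrightarrow> f \<in> L2 D"
  by (simp add: continuous_L2 smooth_continuous_on)

lemma grad_L2: "smooth f \<Longrightarrow> grad f \<in> L2 D"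
  by (simp add: continuous_L2 smooth_grad_continuous_on)

lemma test_function_L2: "\<phi> \<in> test_functions D' \<Longrightarrow> \<phi> \<in> L2 D"
  by (simp add: smooth_L2 test_function_smooth)

end

section \<open>The fundamental lemma of the calculus of variations\<close>

text \<open>Derivatives of \<open>exp (- 1 / t)\<close> are of the form \<open>p (1 / t) * exp (- 1 / t)\<close> for a polynomial \<open>p\<close>.\<close>

definition flat :: "real poly \<Rightarrow> real \<Rightarrow> real" where
  "flat p t = (if t > 0 then poly p (1 / t) * exp (- (1 / t)) else 0)"

lemma poly_times_exp_minus_tendsto_0:
  fixes p :: "real poly"
  shows "((\<lambda>t. poly p t * exp (- t)) \<longlongrightarrow> 0) at_top"
proof -
  have "((\<lambda>t. \<Sum>i\<le>degree p. coeff p i * (t ^ i / exp t)) \<longlongrightarrow> (\<Sum>i\<le>degree p. coeff p i * 0)) at_top"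
    by (intro tendsto_intros tendsto_power_div_exp_0)
  moreover have "(\<lambda>t. \<Sum>i\<le>degree p. coeff p i * (t ^ i / exp t)) = (\<lambda>t. poly p t * exp (- t))"
    by (simp add: poly_altdef sum_divide_distrib exp_minus divide_inverse mult.assoc sum_distrib_right)
  ultimately show ?thesis by simp
qed

text \<open>With \<open>x = 1 / t\<close>, the derivative of \<open>p x * exp (- x)\<close> in
  \<open>x\<close> is \<open>(p' x - p x) * exp (- x)\<close>, and that of \<open>x\<close> in
  \<open>t\<close> is \<open>- x\<^sup>2\<close>; hence the polynomial
  \<open>monom 1 2 * (p - pderiv p)\<close>. The functions \<open>flat p\<close> are thus closed
  under differentiation.\<close>

lemma flat_has_real_derivative:
  "(flat p has_real_derivative flat (monom 1 2 * (p - pderiv p)) t) (at t)"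
proof -
  consider "t > 0" | "t < 0" | "t = 0" by linarith
  then show ?thesis
  proof cases
    case 1
    have "((\<lambda>t. poly p (1 / t) * exp (- (1 / t))) has_real_derivative
        flat (monom 1 2 * (p - pderiv p)) t) (at t)"
      using 1 by (auto intro!: derivative_eq_intros DERIV_chain'[where g = "poly p"] simp: flat_def poly_monom field_simps power2_eq_square)
    then show ?thesis
      by (rule has_field_derivative_transform_within_open[of _ _ _ "{0<..}"]) (use 1 in \<open>auto simp: flat_def\<close>)
  next
    case 2
    have "((\<lambda>t. 0) has_real_derivative flat (monom 1 2 * (p - pderiv p)) t) (at t)"
      using 2 by (simp add: flat_def)
    then show ?thesis
      by (rule has_field_derivative_transform_within_open[of _ _ _ "{..<0}"]) (use 2 in \<open>auto simp: flat_def\<close>)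
  next
    case 3
    \<comment> \<open>The difference quotient at \<open>0\<close> is again of the flat form:
      dividing by \<open>h\<close> multiplies the polynomial by its variable.\<close>
    have "((\<lambda>h. poly (monom 1 1 * p) (1 / h) * exp (- (1 / h))) \<longlongrightarrow> 0) (at_right 0)"
      using filterlim_compose[OF poly_times_exp_minus_tendsto_0 filterlim_inverse_at_top_right, of "monom 1 1 * p"]
      by (simp add: inverse_eq_divide)
    then have "((\<lambda>h. flat p h / h) \<longlongrightarrow> 0) (at_right 0)"
      by (rule Lim_transform_eventually) (auto simp: eventually_at_filter flat_def poly_monom)
    moreover have "((\<lambda>h. flat p h / h) \<longlongrightarrow> 0) (at_left 0)"
      by (rule Lim_transform_eventually[OF tendsto_const]) (auto simp: eventually_at_filter flat_def)
    ultimately have "((\<lambda>h. flat p h / h) \<longlongrightarrow> 0) (at 0)"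
      by (simp add: filterlim_split_at_real)
    then show ?thesis
      using 3 by (simp add: DERIV_def flat_def)
  qed
qed

text \<open>The factor \<open>c\<close> absorbs the inner derivative \<open>\<alpha>\<close> as well
  as the vanishing for \<open>i \<noteq> j\<close>, so the scaled family is closed under
  \<open>partial\<close>, as \<open>smooth_coinduct\<close> requires.\<close>

lemma partial_flat:
  "partial i (\<lambda>x. c * flat p (\<alpha> * x $ j + \<beta>)) =
   (\<lambda>x. (if i = j then c * \<alpha> else 0) * flat (monom 1 2 * (p - pderiv p)) (\<alpha> * x $ j + \<beta>))"
  (is "_ = (\<lambda>x. _ * flat ?q _)")
  and differentiable_flat: "(\<lambda>x. c * flat p (\<alpha> * x $ j + \<beta>)) differentiable_on UNIV"
proof -
  have *: "((\<lambda>x. c * flat p (\<alpha> * x $ j + \<beta>)) has_derivative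
      (\<lambda>h. c * ((\<alpha> * h $ j) * flat ?q (\<alpha> * x $ j + \<beta>)))) (at x)" for x :: "real^2"
  proof -
    have "((\<lambda>x. \<alpha> * x $ j + \<beta>) has_derivative (\<lambda>h. \<alpha> * h $ j)) (at x)"
      by (auto intro!: derivative_eq_intros bounded_linear_imp_has_derivative)
    moreover have "(flat p has_derivative (*) (flat ?q (\<alpha> * x $ j + \<beta>))) (at (\<alpha> * x $ j + \<beta>))"
      using flat_has_real_derivative by (simp add: has_field_derivative_def)
    ultimately show ?thesis
      by (auto dest: has_derivative_compose intro!: derivative_eq_intros simp: mult.commute)
  qed
  show "partial i (\<lambda>x. c * flat p (\<alpha> * x $ j + \<beta>)) =
    (\<lambda>x. (if i = j then c * \<alpha> else 0) * flat ?q (\<alpha> * x $ j + \<beta>))"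
    by (rule ext) (subst partial_eqI[OF *], simp add: axis_def)
  show "(\<lambda>x. c * flat p (\<alpha> * x $ j + \<beta>)) differentiable_on UNIV"
    using * by (meson differentiable_on_def differentiable_def has_derivative_at_withinI)
qed

lemma smooth_flat: "smooth (\<lambda>x. flat p (\<alpha> * x $ j + \<beta>))"
proof (rule smooth_coinduct)
  let ?S = "{\<lambda>x :: real^2. c * flat p (\<alpha> * x $ j + \<beta>) |c p. True}"
  show "(\<lambda>x. flat p (\<alpha> * x $ j + \<beta>)) \<in> ?S"
    by (intro CollectI exI[of _ 1] exI[of _ p]) auto
  fix g i assume "g \<in> ?S"
  then obtain c p where g: "g = (\<lambda>x. c * flat p (\<alpha> * x $ j + \<beta>))" by blast
  show "g differentiable_on UNIV" using g differentiable_flat by blast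
  show "partial i g \<in> ?S" using g partial_flat by blast
qed

lemma flat_1_bounds: "0 \<le> flat 1 t" "flat 1 t \<le> 1"
  by (auto simp: flat_def)

text \<open>For \<open>t > 0\<close> the exponent \<open>1 / (n * t)\<close> tends to zero. The
  limit is the indicator of the open half-line, with value \<open>0\<close> at
  \<open>t = 0\<close>.\<close>

lemma flat_1_tendsto: "(\<lambda>n. flat 1 (real n * t)) \<longlonglongrightarrow> (if t > 0 then 1 else 0)"
proof (cases "t > 0")
  case True
  have "(\<lambda>n. exp (- ((1 / t) * inverse (real n)))) \<longlonglongrightarrow> exp (- ((1 / t) * 0))"
    by (intro tendsto_intros lim_inverse_n)
  then have "(\<lambda>n. exp (- (1 / (real n * t)))) \<longlonglongrightarrow> 1"
    by (simp add: field_simps)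
  then have "(\<lambda>n. flat 1 (real n * t)) \<longlonglongrightarrow> 1"
    by (rule Lim_transform_eventually)
      (use True in \<open>auto simp: flat_def intro!: eventually_mono[OF eventually_gt_at_top[of 0]]\<close>)
  with True show ?thesis by simp
next
  case False
  then have "flat 1 (real n * t) = 0" for n
    using mult_nonneg_nonpos[of "real n" t] by (simp add: flat_def)
  with False show ?thesis by simp
qed

text \<open>An explicit smooth approximation of the indicator of an open box, with one rising and
  one falling factor per coordinate. It takes the place of mollifiers in the fundamental
  lemma.\<close>

definition box_bump :: "real^2 \<Rightarrow> real^2 \<Rightarrow> nat \<Rightarrow> real^2 \<Rightarrow> real" where
  "box_bump a b n x = (\<Prod>i\<in>UNIV. flat 1 (real n * (x $ i - a $ i)) * flat 1 (real n * (b $ i - x $ i)))"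

lemma smooth_prod: "(\<And>i. i \<in> I \<Longrightarrow> smooth (f i)) \<Longrightarrow> smooth (\<lambda>x. \<Prod>i\<in>I. f i x)"
  by (induction I rule: infinite_finite_induct) (auto intro: smooth_mult)

lemma box_bump_test_function:
  assumes "cbox a b \<subseteq> D"
  shows "box_bump a b n \<in> test_functions D"
proof (rule test_functionI)
  show "smooth (box_bump a b n)"
    using smooth_flat[of 1 "real n" _ "- real n * a $ _"] smooth_flat[of 1 "- real n" _ "real n * b $ _"]
    unfolding box_bump_def by (intro smooth_prod smooth_mult) (simp_all add: algebra_simps)
  show "box_bump a b n x = 0" if "x \<notin> cbox a b" for x
  proof -
    obtain i where "\<not> (a $ i \<le> x $ i \<and> x $ i \<le> b $ i)"
      using \<open>x \<notin> cbox a b\<close> by (auto simp: mem_box_cart)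
    then have "flat 1 (real n * (x $ i - a $ i)) * flat 1 (real n * (b $ i - x $ i)) = 0"
      by (auto simp: flat_def zero_less_mult_iff)
    then show ?thesis
      unfolding box_bump_def by (intro prod_zero) auto
  qed
qed (use assms in auto)

lemma box_bump_bound: "\<bar>box_bump a b n x\<bar> \<le> 1"
  unfolding box_bump_def
  by (auto simp: abs_prod abs_mult flat_1_bounds intro!: prod_le_1 mult_nonneg_nonneg mult_le_one)

lemma box_bump_tendsto: "(\<lambda>n. box_bump a b n x) \<longlonglongrightarrow> indicator (box a b) x"
proof -
  have "(\<lambda>n. box_bump a b n x) \<longlonglongrightarrow>
    (\<Prod>i\<in>UNIV. (if x $ i - a $ i > 0 then 1 else 0) * (if b $ i - x $ i > 0 then 1 else 0))"
    unfolding box_bump_def by (intro tendsto_intros flat_1_tendsto)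
  moreover have "(\<Prod>i\<in>UNIV. (if x $ i - a $ i > 0 then 1 else 0) * (if b $ i - x $ i > 0 then 1 else 0))
      = (indicator (box a b) x :: real)"
    by (auto simp: indicator_def mem_box_cart prod_zero_iff intro!: prod.neutral)
  ultimately show ?thesis by simp
qed

text \<open>The Borel sets over which the integral vanishes form a Dynkin system, and open boxes are
  an intersection-stable generator. The whole space is not a box, so its integral is assumed
  separately; complements use it.\<close>

lemma AE_zero_if_box_integrals_zero:
  fixes f :: "'a::euclidean_space \<Rightarrow> real"
  assumes f: "integrable lebesgue f" and zero: "\<And>a b. (LINT x:box a b|lebesgue. f x) = 0"
    and total: "integral\<^sup>L lebesgue f = 0"
  shows "AE x in lebesgue. f x = 0"
proof -
  \<comment> \<open>The generator argument reaches Borel sets only, while \<open>f\<close> is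
    Lebesgue measurable; a Borel representative closes the gap.\<close>
  obtain g where g: "g \<in> borel_measurable lborel" "AE x in lborel. f x = g x"
    using completion_ex_borel_measurable_real[of f lborel] f by auto
  have AE: "AE x in lebesgue. f x = g x"
    using g(2) by (rule AE_completion)
  have gi: "integrable lebesgue g"
    using integrable_cong_AE_imp[OF f _ AE] g(1) by (simp add: measurable_completion)
  have eq: "(LINT x:A|lebesgue. f x) = (LINT x:A|lborel. g x)" if "A \<in> sets borel" for A
  proof -
    have "A \<in> sets lebesgue" using that by simp
    then have "(LINT x:A|lebesgue. f x) = (LINT x:A|lebesgue. g x)"
      using f gi AE by (intro set_lebesgue_integral_cong_AE) auto
    also have "\<dots> = (LINT x:A|lborel. g x)"
      unfolding set_lebesgue_integral_def using g(1) that by (intro integral_completion) auto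
    finally show ?thesis .
  qed
  have gl: "integrable lborel g"
    using gi g(1) by (simp add: integrable_completion)
  have gA: "set_integrable lborel A g" if "A \<in> sets borel" for A
    unfolding set_integrable_def using gl that by (intro integrable_mult_indicator) auto
  have all: "(LINT x:A|lborel. g x) = 0" if "A \<in> sets borel" for A
  proof -
    have A: "A \<in> sigma_sets UNIV (range (\<lambda>(a, b). box a b :: 'a set))"
      using that by (subst (asm) borel_eq_box) simp
    have sets: "B \<in> sets borel" if "B \<in> sigma_sets UNIV (range (\<lambda>(a, b). box a b :: 'a set))" for B
      using that by (subst borel_eq_box) simp
    have "Int_stable (range (\<lambda>(a, b). box a b :: 'a set))"
      by (auto simp: Int_stable_def box_Int_box)
    moreover have "range (\<lambda>(a, b). box a b :: 'a set) \<subseteq> Pow UNIV" by simp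
    ultimately show ?thesis using A
    proof (induction rule: sigma_sets_induct_disjoint)
      case (basic A)
      then show ?case using zero eq[of A] by auto
    next
      case (compl A)
      have "(LINT x:UNIV - A|lborel. g x) + (LINT x:A|lborel. g x) = (LINT x:(UNIV - A) \<union> A|lborel. g x)"
        using sets[OF compl(1)] by (intro set_integral_Un[symmetric] gA) auto
      then show ?case
        using compl(2) total eq[of UNIV] by (simp add: set_lebesgue_integral_def)
    next
      case (union A)
      have A_borel: "A i \<in> sets borel" for i
        using union(2) by (intro sets) blast
      have "(LINT x:(\<Union>i. A i)|lborel. g x) = (\<Sum>i. (LINT x:(A i)|lborel. g x))"
        using union(1) A_borel by (intro lebesgue_integral_countable_add gA) (auto simp: disjoint_family_on_def)
      with union(3) show ?case by simp
    qed (auto simp: set_lebesgue_integral_def)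
  qed
  \<comment> \<open>A real density is determined almost everywhere by its integrals over measurable
    sets; here it is compared with the zero density.\<close>
  have "AE x in lborel. g x = 0"
    by (rule density_unique_real[OF gl, of "\<lambda>x. 0"]) (auto simp: all)
  then have "AE x in lebesgue. g x = 0"
    by (rule AE_completion)
  with AE show ?thesis by eventually_elim simp
qed

context bounded_open
begin

lemma L2_integrable:
  assumes "w \<in> L2 D"
  shows "set_integrable lebesgue D (w :: _ \<Rightarrow> real)"
  using L2_inner_integrable[OF assms smooth_L2[OF smooth_const[of 1]]] by simp

text \<open>Dominated convergence along \<open>box_bump a b n\<close>, with the absolute value of
  \<open>w\<close> on \<open>D\<close> as majorant. The closed box has to lie in \<open>D\<close>
  because the bumps must be test functions there.\<close>

lemma box_integral_zero:
  assumes w: "w \<in> L2 D" and orth: "\<And>\<phi>. \<phi> \<in> test_functions D \<Longrightarrow> l2_inner D w \<phi> = 0"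
    and sub: "cbox a b \<subseteq> D"
  shows "(LINT x:box a b|lebesgue. w x) = 0"
proof -
  have int: "integrable lebesgue (\<lambda>x. indicator D x * w x)"
    using L2_integrable[OF w] by (simp add: set_integrable_def)
  have "(\<lambda>n. LINT x|lebesgue. indicator D x * w x * box_bump a b n x) \<longlonglongrightarrow>
        (LINT x|lebesgue. indicator D x * w x * indicator (box a b) x)"
  proof (rule integral_dominated_convergence)
    show "integrable lebesgue (\<lambda>x. norm (indicator D x * w x))"
      using int by (rule integrable_norm)
    show "(\<lambda>x. indicator D x * w x * box_bump a b n x) \<in> borel_measurable lebesgue" for n
      using smooth_continuous_on[OF test_function_smooth[OF box_bump_test_function[OF sub]], of UNIV n]
      by (intro borel_measurable_times borel_measurable_integrable[OF int] measurable_completion)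
        (simp add: borel_measurable_continuous_onI)
    show "AE x in lebesgue. norm (indicator D x * w x * box_bump a b n x) \<le> norm (indicator D x * w x)" for n
      using box_bump_bound by (auto simp: abs_mult intro!: mult_left_le)
    show "AE x in lebesgue. (\<lambda>n. indicator D x * w x * box_bump a b n x)
       \<longlonglongrightarrow> indicator D x * w x * indicator (box a b) x"
      by (intro AE_I2 tendsto_intros box_bump_tendsto)
    show "(\<lambda>x. indicator D x * w x * indicator (box a b) x) \<in> borel_measurable lebesgue"
      by (intro borel_measurable_times borel_measurable_integrable[OF int] borel_measurable_indicator) simp
  qed
  moreover have "(LINT x|lebesgue. indicator D x * w x * box_bump a b n x) = 0" for n
    using orth[OF box_bump_test_function[OF sub, of n]]
    by (simp add: l2_inner_def set_lebesgue_integral_def mult.assoc)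
  ultimately have "(LINT x|lebesgue. indicator D x * w x * indicator (box a b) x) = 0"
    by (simp add: LIMSEQ_const_iff)
  moreover have "indicator D x * w x * indicator (box a b) x = indicator (box a b) x *\<^sub>R w x" for x
    using sub box_subset_cbox[of a b] by (auto simp: indicator_def)
  ultimately show ?thesis
    by (simp add: set_lebesgue_integral_def)
qed

text \<open>The zero extension of \<open>w\<close> from the box is integrable on the whole plane, so
  the criterion for all boxes applies to it although \<open>w\<close> is controlled on
  \<open>D\<close> only.\<close>

lemma AE_zero_on_box:
  assumes w: "w \<in> L2 D" and orth: "\<And>\<phi>. \<phi> \<in> test_functions D \<Longrightarrow> l2_inner D w \<phi> = 0"
    and sub: "cbox c d \<subseteq> D"
  shows "AE x in lebesgue. x \<in> cbox c d \<longrightarrow> w x = 0"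
proof -
  have zero: "(LINT x:box a b|lebesgue. indicator (box c d) x * w x) = 0" for a b
  proof -
    \<comment> \<open>Corners of the intersection with the given box, which keeps
      \<open>cbox p q\<close> inside \<open>D\<close>.\<close>
    define p q where "p = (\<Sum>i\<in>Basis. max (a\<bullet>i) (c\<bullet>i) *\<^sub>R i)" "q = (\<Sum>i\<in>Basis. min (b\<bullet>i) (d\<bullet>i) *\<^sub>R i)"
    have "cbox p q \<subseteq> D"
      using sub Int_interval[of a b c d] by (auto simp: p_q_def)
    from box_integral_zero[OF w orth this]
    show ?thesis
      by (simp add: set_lebesgue_integral_def p_q_def box_Int_box[symmetric] indicator_inter_arith mult.assoc)
  qed
  have "AE x in lebesgue. indicator (box c d) x * w x = 0"
  proof (rule AE_zero_if_box_integrals_zero)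
    have "set_integrable lebesgue (box c d) w"
      using L2_integrable[OF w] sub box_subset_cbox[of c d] by (intro set_integrable_subset[OF L2_integrable[OF w]]) auto
    then show "integrable lebesgue (\<lambda>x. indicator (box c d) x * w x)"
      by (simp add: set_integrable_def)
    have "cbox c d \<subseteq> D" by fact
    from box_integral_zero[OF w orth this]
    show "(LINT x|lebesgue. indicator (box c d) x * w x) = 0"
      by (simp add: set_lebesgue_integral_def)
  qed (rule zero)
  \<comment> \<open>The criterion was applied on the open box; the faces form a null set.\<close>
  moreover have "AE x in lebesgue. x \<notin> cbox c d - box c d"
    using null_sets_cbox_Diff_box[of c d] by (intro AE_not_in null_sets_completionI)
  ultimately show ?thesis
    by eventually_elim (auto simp: indicator_def split: if_splits)
qed

text \<open>An open set is a countable union of closed boxes, so the exceptional sets of the single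
  boxes still form a null set.\<close>

lemma fundamental_lemma:
  assumes w: "w \<in> L2 D" and orth: "\<And>\<phi>. \<phi> \<in> test_functions D \<Longrightarrow> l2_inner D w \<phi> = 0"
  shows "AE x in lebesgue. x \<in> D \<longrightarrow> w x = 0"
proof -
  obtain \<D> where \<D>: "countable \<D>" "\<D> \<subseteq> Pow D" "\<And>X. X \<in> \<D> \<Longrightarrow> \<exists>a b. X = cbox a b" "\<Union>\<D> = D"
    using open_countable_Union_open_cbox[OF open_D] by metis
  have "AE x in lebesgue. x \<in> X \<longrightarrow> w x = 0" if "X \<in> \<D>" for X
    using \<D>(2,3) that AE_zero_on_box[OF w orth] by blast
  then have "AE x in lebesgue. \<forall>X\<in>\<D>. x \<in> X \<longrightarrow> w x = 0"
    by (intro AE_ball_countable[OF \<D>(1), THEN iffD2] ballI)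
  then show ?thesis
    by eventually_elim (use \<D>(4) in blast)
qed

end

section \<open>Weak derivatives\<close>

text \<open>Translation invariance of Lebesgue measure makes the integral of every difference
  quotient vanish, and dominated convergence passes to the derivative.\<close>

lemma test_function_integral_partial:
  assumes "\<psi> \<in> test_functions D"
  shows "(LINT x|lborel. partial i \<psi> x) = 0"
proof -
  obtain K where K: "compact K" "K \<subseteq> D" "\<And>x. x \<notin> K \<Longrightarrow> \<psi> x = 0"
    using test_functionE[OF assms] by blast
  have smooth: "smooth \<psi>" "smooth (partial i \<psi>)"
    using assms by (auto simp: test_function_smooth smooth_partial)
  obtain L where L: "compact L" "\<And>x. x \<notin> L \<Longrightarrow> partial i \<psi> x = 0"
    by (rule test_functionE[OF test_function_partial[OF assms]]) (rule that)
  have "compact (partial i \<psi> ` L)"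
    using smooth L by (intro compact_continuous_image smooth_continuous_on)
  then have "bounded (partial i \<psi> ` L)" by (rule compact_imp_bounded)
  then obtain B0 where B0: "\<And>x. x \<in> L \<Longrightarrow> \<bar>partial i \<psi> x\<bar> \<le> B0"
     by (auto simp: bounded_iff)
  define B where "B = max B0 0"
  have B: "\<bar>partial i \<psi> x\<bar> \<le> B" "0 \<le> B" for x
    using B0[of x] L(2)[of x] unfolding B_def by (cases "x \<in> L") auto
  obtain R where R: "K \<subseteq> cball 0 R"
    using compact_imp_bounded[OF K(1)] by (auto simp: bounded_iff subset_iff)
  define e :: "real^2" where "e = axis i 1"
  define h where "h n = inverse (real (Suc n))" for n
  have h: "0 < h n" "h n \<le> 1" for n
    by (auto simp: h_def field_simps)
  have line: "((\<lambda>s. \<psi> (x + s *\<^sub>R e)) has_real_derivative partial i \<psi> (x + s *\<^sub>R e)) (at s)" for x s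
  proof -
    have "((\<lambda>s. x + s *\<^sub>R e) has_derivative (\<lambda>s. s *\<^sub>R e)) (at s)"
      by (auto intro!: derivative_eq_intros)
    from has_derivative_compose[OF this smooth_has_derivative[OF smooth(1)]]
    have "((\<lambda>s. \<psi> (x + s *\<^sub>R e)) has_derivative (\<lambda>r. frechet_derivative \<psi> (at (x + s *\<^sub>R e)) (r *\<^sub>R e))) (at s)" .
    moreover have "frechet_derivative \<psi> (at y) (r *\<^sub>R e) = partial i \<psi> y * r" for y r
      using linear_scale[OF linear_frechet_derivative[OF smooth_differentiable[OF smooth(1)]]]
      by (simp add: partial_def e_def)
    ultimately show ?thesis
      by (simp add: has_field_derivative_def)
  qed
  have bound: "\<bar>(\<psi> (x + h n *\<^sub>R e) - \<psi> x) / h n\<bar> \<le> B" for x n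
  proof -
    obtain z where "\<psi> (x + h n *\<^sub>R e) - \<psi> (x + 0 *\<^sub>R e) = (h n - 0) * partial i \<psi> (x + z *\<^sub>R e)"
      using MVT2[OF h(1)[of n] line] by blast
    then show ?thesis
      using B h(1)[of n] by (simp add: field_simps)
  qed
  have meas: "\<psi> \<in> borel_measurable borel"
    using smooth by (intro borel_measurable_continuous_onI smooth_continuous_on)
  have int: "integrable lborel \<psi>"
  proof -
    have "integrable lborel (\<lambda>x. indicator K x *\<^sub>R \<psi> x)"
      using K smooth smooth_continuous_on borel_integrable_compact by blast
    moreover have "(\<lambda>x. indicator K x *\<^sub>R \<psi> x) = \<psi>"
      by (rule ext) (use K(3) in \<open>auto simp: indicator_def\<close>)
    ultimately show ?thesis by simp
  qed
  have translate: "integrable lborel (\<lambda>x. \<psi> (x + c))" "(LINT x|lborel. \<psi> (x + c)) = (LINT x|lborel. \<psi> x)" for c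
  proof -
    have eq: "lborel = distr lborel borel ((+) c)" by (simp add: lborel_distr_plus)
    show "(LINT x|lborel. \<psi> (x + c)) = (LINT x|lborel. \<psi> x)"
      by (subst (2) eq) (subst integral_distr, use meas in \<open>auto simp: add.commute\<close>)
    have "integrable (distr lborel borel ((+) c)) \<psi>" using int eq by simp
    then show "integrable lborel (\<lambda>x. \<psi> (x + c))"
      using meas by (subst (asm) integrable_distr_eq) (auto simp: add.commute)
  qed
  have "(\<lambda>n. LINT x|lborel. (\<psi> (x + h n *\<^sub>R e) - \<psi> x) / h n) \<longlonglongrightarrow> (LINT x|lborel. partial i \<psi> x)"
  proof (rule integral_dominated_convergence)
    \<comment> \<open>Shifts have length at most \<open>1\<close>, so the quotients vanish outside
      the ball of radius \<open>R + 1\<close>; inside it the mean value theorem bounds them by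
      \<open>B\<close>.\<close>
    show "integrable lborel (\<lambda>x. indicator (cball 0 (R + 1)) x *\<^sub>R B)"
      by (intro borel_integrable_compact) auto
    show "AE x in lborel. (\<lambda>n. (\<psi> (x + h n *\<^sub>R e) - \<psi> x) / h n) \<longlonglongrightarrow> partial i \<psi> x"
    proof (rule AE_I2)
      fix x :: "real^2"
      have "((\<lambda>s. (\<psi> (x + s *\<^sub>R e) - \<psi> x) / s) \<longlongrightarrow> partial i \<psi> x) (at 0)"
        using line[of x 0] by (simp add: DERIV_def)
      moreover have "filterlim h (at 0) sequentially"
        unfolding filterlim_at h_def
        using LIMSEQ_inverse_real_of_nat by (auto intro: always_eventually)
      ultimately show "(\<lambda>n. (\<psi> (x + h n *\<^sub>R e) - \<psi> x) / h n) \<longlonglongrightarrow> partial i \<psi> x"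
        by (rule filterlim_compose)
    qed
    show "AE x in lborel. norm ((\<psi> (x + h n *\<^sub>R e) - \<psi> x) / h n) \<le> indicator (cball 0 (R + 1)) x *\<^sub>R B" for n
    proof (rule AE_I2)
      fix x :: "real^2"
      show "norm ((\<psi> (x + h n *\<^sub>R e) - \<psi> x) / h n) \<le> indicator (cball 0 (R + 1)) x *\<^sub>R B"
      proof (cases "x \<in> cball 0 (R + 1)")
        case True
        then show ?thesis using bound[of x n] by simp
      next
        case False
        have "norm (h n *\<^sub>R e) \<le> 1" using h[of n] by (simp add: e_def)
        with False have "R < norm (x + h n *\<^sub>R e)" "R < norm x"
          using norm_triangle_ineq2[of x "- (h n *\<^sub>R e)"] by auto
        then have "x + h n *\<^sub>R e \<notin> K" "x \<notin> K" using R by auto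
        then show ?thesis using K(3) False by simp
      qed
    qed
    show "partial i \<psi> \<in> borel_measurable lborel"
      using smooth by (simp add: borel_measurable_continuous_onI smooth_continuous_on)
    show "(\<lambda>x. (\<psi> (x + h n *\<^sub>R e) - \<psi> x) / h n) \<in> borel_measurable lborel" for n
      using meas by measurable
  qed
  moreover have "(LINT x|lborel. (\<psi> (x + h n *\<^sub>R e) - \<psi> x) / h n) = 0" for n
    using translate[of "h n *\<^sub>R e"] int by simp
  ultimately have "(\<lambda>n. 0) \<longlonglongrightarrow> (LINT x|lborel. partial i \<psi> x)"
    by (simp only:)
  then show ?thesis
    by (simp add: LIMSEQ_const_iff)
qed

lemma l2_inner_tendsto_0_iff:
  "(\<lambda>j. l2_norm D (f j)) \<longlonglongrightarrow> 0 \<longleftrightarrow> (\<lambda>j. l2_inner D (f j) (f j)) \<longlonglongrightarrow> 0"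
proof
  assume "(\<lambda>j. l2_norm D (f j)) \<longlonglongrightarrow> 0"
  from tendsto_power[OF this, of 2] show "(\<lambda>j. l2_inner D (f j) (f j)) \<longlonglongrightarrow> 0"
    by (simp add: l2_norm_def l2_inner_self_nonneg)
next
  assume "(\<lambda>j. l2_inner D (f j) (f j)) \<longlonglongrightarrow> 0"
  from tendsto_real_sqrt[OF this] show "(\<lambda>j. l2_norm D (f j)) \<longlonglongrightarrow> 0"
    by (simp add: l2_norm_def)
qed

lemma l2_inner_self_scaleR: "l2_inner D (\<lambda>x. c *\<^sub>R f x) (\<lambda>x. c *\<^sub>R f x) = c\<^sup>2 * l2_inner D f f"
  by (simp add: l2_inner_def power2_eq_square mult.assoc)

lemma l2_norm_tendsto_combination:
  fixes f g :: "nat \<Rightarrow> real^2 \<Rightarrow> 'a::euclidean_space"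
  assumes "\<And>j. f j \<in> L2 D" "\<And>j. g j \<in> L2 D"
    and "(\<lambda>j. l2_norm D (f j)) \<longlonglongrightarrow> 0" "(\<lambda>j. l2_norm D (g j)) \<longlonglongrightarrow> 0"
  shows "(\<lambda>j. l2_norm D (\<lambda>x. a *\<^sub>R f j x + b *\<^sub>R g j x)) \<longlonglongrightarrow> 0"
  unfolding l2_inner_tendsto_0_iff
proof (rule tendsto_sandwich[of "\<lambda>_. 0"])
  show "(\<lambda>j. 2 * (a\<^sup>2 * l2_inner D (f j) (f j)) + 2 * (b\<^sup>2 * l2_inner D (g j) (g j))) \<longlonglongrightarrow> 0"
    using assms(3,4) unfolding l2_inner_tendsto_0_iff by (auto intro!: tendsto_eq_intros)
  show "\<forall>\<^sub>F j in sequentially. l2_inner D (\<lambda>x. a *\<^sub>R f j x + b *\<^sub>R g j x) (\<lambda>x. a *\<^sub>R f j x + b *\<^sub>R g j x)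
      \<le> 2 * (a\<^sup>2 * l2_inner D (f j) (f j)) + 2 * (b\<^sup>2 * l2_inner D (g j) (g j))"
    using l2_inner_self_add_le[OF L2_scaleR[OF assms(1)] L2_scaleR[OF assms(2)]]
    unfolding l2_inner_self_scaleR by (intro always_eventually allI)
  show "\<forall>\<^sub>F j in sequentially. 0 \<le> l2_inner D (\<lambda>x. a *\<^sub>R f j x + b *\<^sub>R g j x) (\<lambda>x. a *\<^sub>R f j x + b *\<^sub>R g j x)"
    by (intro always_eventually allI l2_inner_self_nonneg)
qed simp

lemma l2_norm_cong_AE:
  assumes "AE x in lebesgue. x \<in> D \<longrightarrow> f x = f' x" "f \<in> L2 D" "f' \<in> L2 D"
  shows "l2_norm D f = l2_norm D f'"
  using l2_inner_cong_AE[OF assms assms(2)] l2_inner_cong_AE[OF assms assms(3)] l2_inner_commute[of D f f']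
  by (simp add: l2_norm_def)

text \<open>The predicate under the choice operator of \<open>weak_grad\<close>, named so that
  linearity and uniqueness can be stated for arbitrary representatives.\<close>

definition is_weak_grad :: "(real^2) set \<Rightarrow> (real^2 \<Rightarrow> real) \<Rightarrow> (real^2 \<Rightarrow> real^2) \<Rightarrow> bool" where
  "is_weak_grad D v G \<longleftrightarrow> G \<in> L2 D \<and> has_weak_deriv D 1 0 v (\<lambda>x. G x $ 1)
                                   \<and> has_weak_deriv D 0 1 v (\<lambda>x. G x $ 2)"

lemma sobolev_L2: "v \<in> sobolev D m \<Longrightarrow> v \<in> L2 D"
  by (simp add: sobolev_def)

text \<open>\<open>sobolev\<close> provides the two first derivatives separately, whereas
  \<open>weak_grad\<close> chooses one vector field; \<open>axis\<close> glues the components.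
  Conversely, the derivative of order zero is \<open>v\<close> itself.\<close>

lemma sobolev_1_iff: "v \<in> sobolev D 1 \<longleftrightarrow> v \<in> L2 D \<and> (\<exists>G. is_weak_grad D v G)"
proof
  assume v: "v \<in> sobolev D 1"
  then obtain w1 where w1: "w1 \<in> L2 D" "has_weak_deriv D 1 0 v w1"
    unfolding sobolev_def by force
  from v obtain w2 where w2: "w2 \<in> L2 D" "has_weak_deriv D 0 1 v w2"
    unfolding sobolev_def by force
  let ?G = "\<lambda>x. axis 1 (w1 x) + axis 2 (w2 x) :: real^2"
  have "(\<lambda>x. ?G x $ 1) = w1" "(\<lambda>x. ?G x $ 2) = w2"
    by (auto simp: axis_def)
  then have "is_weak_grad D v ?G"
    unfolding is_weak_grad_def using w1 w2 by (auto intro: L2_add L2_axis)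
  with v show "v \<in> L2 D \<and> (\<exists>G. is_weak_grad D v G)"
    using sobolev_L2 by blast
next
  assume "v \<in> L2 D \<and> (\<exists>G. is_weak_grad D v G)"
  then obtain G where G: "v \<in> L2 D" "is_weak_grad D v G" by blast
  have "\<exists>w\<in>L2 D. has_weak_deriv D a b v w" if "a + b \<le> 1" for a b
  proof -
    have "a = 0 \<and> b = 0 \<or> a = 1 \<and> b = 0 \<or> a = 0 \<and> b = 1"
      using that by presburger
    then consider "a = 0" "b = 0" | "a = 1" "b = 0" | "a = 0" "b = 1"
      by blast
    then show ?thesis
    proof cases
      case 1
      then show ?thesis using G(1) by (auto simp: has_weak_deriv_def)
    qed (use G(2) L2_component in \<open>auto simp: is_weak_grad_def\<close>)
  qed
  with G show "v \<in> sobolev D 1" by (simp add: sobolev_def)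
qed

lemma weak_grad_is_weak_grad: "v \<in> sobolev D 1 \<Longrightarrow> is_weak_grad D v (weak_grad D v)"
proof -
  assume "v \<in> sobolev D 1"
  then have "\<exists>G. is_weak_grad D v G"
    using sobolev_1_iff by blast
  then have "is_weak_grad D v (SOME G. is_weak_grad D v G)"
    by (rule someI_ex)
  moreover have "weak_grad D v = (SOME G. is_weak_grad D v G)"
    unfolding weak_grad_def is_weak_grad_def ..
  ultimately show ?thesis by simp
qed

lemma weak_grad_L2: "v \<in> sobolev D 1 \<Longrightarrow> weak_grad D v \<in> L2 D"
  using weak_grad_is_weak_grad by (auto simp: is_weak_grad_def)

lemma laplacian_test_function:
  assumes "\<phi> \<in> test_functions D"
  shows "laplacian \<phi> \<in> test_functions D"
proof -
  have "laplacian \<phi> = (\<lambda>x. 1 * partial 1 (partial 1 \<phi>) x + 1 * partial 2 (partial 2 \<phi>) x)"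
    by (simp add: laplacian_def fun_eq_iff sum_2)
  with test_function_combination[of "partial 1 (partial 1 \<phi>)" D "partial 2 (partial 2 \<phi>)" 1 1]
  show ?thesis using assms by (simp only: test_function_partial)
qed

context bounded_open
begin

lemma has_weak_deriv_combination:
  assumes "v \<in> L2 D" "v' \<in> L2 D" "w \<in> L2 D" "w' \<in> L2 D"
    and "has_weak_deriv D a b v w" "has_weak_deriv D a b v' w'"
  shows "has_weak_deriv D a b (\<lambda>x. \<alpha> * v x + \<beta> * v' x) (\<lambda>x. \<alpha> * w x + \<beta> * w' x)"
  unfolding has_weak_deriv_def
proof
  fix \<phi> assume \<phi>: "\<phi> \<in> test_functions D"
  then have "(partial 1 ^^ a) ((partial 2 ^^ b) \<phi>) \<in> L2 D" "\<phi> \<in> L2 D"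
    by (blast intro: test_function_L2 test_function_iterated_partial)+
  with assms \<phi> show "l2_inner D (\<lambda>x. \<alpha> * v x + \<beta> * v' x) ((partial 1 ^^ a) ((partial 2 ^^ b) \<phi>)) =
      (- 1) ^ (a + b) * l2_inner D (\<lambda>x. \<alpha> * w x + \<beta> * w' x) \<phi>"
    unfolding has_weak_deriv_def by (simp add: l2_inner_combination_left distrib_left)
qed

lemma has_weak_deriv_unique:
  assumes "w \<in> L2 D" "w' \<in> L2 D" "has_weak_deriv D a b v w" "has_weak_deriv D a b v w'"
  shows "AE x in lebesgue. x \<in> D \<longrightarrow> w x = w' x"
proof -
  have "AE x in lebesgue. x \<in> D \<longrightarrow> w x - w' x = 0"
  proof (rule fundamental_lemma)
    fix \<phi> assume "\<phi> \<in> test_functions D"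
    then show "l2_inner D (\<lambda>x. w x - w' x) \<phi> = 0"
      using assms by (simp add: l2_inner_diff_left test_function_L2 has_weak_deriv_def)
  qed (use assms L2_diff in auto)
  then show ?thesis by eventually_elim simp
qed

lemma is_weak_grad_combination:
  assumes "v \<in> L2 D" "v' \<in> L2 D" "is_weak_grad D v G" "is_weak_grad D v' G'"
  shows "is_weak_grad D (\<lambda>x. a * v x + b * v' x) (\<lambda>x. a *\<^sub>R G x + b *\<^sub>R G' x)"
  using assms unfolding is_weak_grad_def
  by (simp add: L2_linear_combination has_weak_deriv_combination L2_component)

lemma is_weak_grad_unique:
  assumes "is_weak_grad D v G" "is_weak_grad D v G'"
  shows "AE x in lebesgue. x \<in> D \<longrightarrow> G x = G' x"
proof -
  have "AE x in lebesgue. x \<in> D \<longrightarrow> G x $ 1 = G' x $ 1"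
    using assms unfolding is_weak_grad_def
    by (intro has_weak_deriv_unique[where a = 1 and b = 0 and v = v] L2_component) blast+
  moreover have "AE x in lebesgue. x \<in> D \<longrightarrow> G x $ 2 = G' x $ 2"
    using assms unfolding is_weak_grad_def
    by (intro has_weak_deriv_unique[where a = 0 and b = 1 and v = v] L2_component) blast+
  ultimately show ?thesis
    by eventually_elim (simp add: vec_eq_iff forall_2)
qed

lemma sobolev_combination:
  assumes "v \<in> sobolev D m" "v' \<in> sobolev D m"
  shows "(\<lambda>x. a * v x + b * v' x) \<in> sobolev D m"
proof -
  have "\<exists>w\<in>L2 D. has_weak_deriv D i j (\<lambda>x. a * v x + b * v' x) w" if ij: "i + j \<le> m" for i j
  proof -
    obtain w where w: "w \<in> L2 D" "has_weak_deriv D i j v w"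
      using assms(1) ij unfolding sobolev_def by blast
    obtain w' where w': "w' \<in> L2 D" "has_weak_deriv D i j v' w'"
      using assms(2) ij unfolding sobolev_def by blast
    show ?thesis
      using has_weak_deriv_combination[OF sobolev_L2[OF assms(1)] sobolev_L2[OF assms(2)] w(1) w'(1) w(2) w'(2)]
        L2_combination[OF w(1) w'(1)] by blast
  qed
  with assms show ?thesis by (auto simp: sobolev_def intro: L2_combination)
qed

text \<open>Only an almost-everywhere statement is possible, since the three representatives are
  chosen independently of each other.\<close>

lemma weak_grad_combination:
  assumes "v \<in> sobolev D 1" "v' \<in> sobolev D 1"
  shows "AE x in lebesgue. x \<in> D \<longrightarrow>
    weak_grad D (\<lambda>x. a * v x + b * v' x) x = a *\<^sub>R weak_grad D v x + b *\<^sub>R weak_grad D v' x"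
  by (rule is_weak_grad_unique[OF weak_grad_is_weak_grad[OF sobolev_combination[OF assms]]
        is_weak_grad_combination[OF sobolev_L2[OF assms(1)] sobolev_L2[OF assms(2)]
          weak_grad_is_weak_grad[OF assms(1)] weak_grad_is_weak_grad[OF assms(2)]]])

text \<open>The product of \<open>p\<close> with a test function is a test function, so the integral
  of its derivative vanishes and there is no boundary term.\<close>

lemma integration_by_parts:
  assumes p: "smooth p" and \<phi>: "\<phi> \<in> test_functions D"
  shows "l2_inner D p (partial i \<phi>) = - l2_inner D (partial i p) \<phi>"
proof -
  let ?\<psi> = "\<lambda>x. p x * \<phi> x"
  have \<psi>: "?\<psi> \<in> test_functions D" by (rule test_function_mult[OF \<phi> p])
  obtain L where L: "L \<subseteq> D" "\<And>x. x \<notin> L \<Longrightarrow> partial i ?\<psi> x = 0"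
    by (rule test_functionE[OF test_function_partial[OF \<psi>]]) (rule that)
  have L2: "p \<in> L2 D" "\<phi> \<in> L2 D" "partial i p \<in> L2 D" "partial i \<phi> \<in> L2 D"
    using p test_function_smooth[OF \<phi>] by (simp_all add: smooth_L2 smooth_partial)
  have "l2_inner D p (partial i \<phi>) + l2_inner D (partial i p) \<phi>
      = (LINT x:D|lebesgue. p x * partial i \<phi> x + partial i p x * \<phi> x)"
    unfolding l2_inner_def
    using L2_inner_integrable[OF L2(1,4)] L2_inner_integrable[OF L2(3,2)] by simp
  also have "\<dots> = (LINT x:D|lebesgue. partial i ?\<psi> x)"
    using p \<phi> by (simp add: partial_mult smooth_differentiable test_function_smooth)
  \<comment> \<open>The derivative is zero outside \<open>D\<close>, so the integral extends to the
    whole plane, where translation invariance was used.\<close>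
  also have "\<dots> = (LINT x|lebesgue. partial i ?\<psi> x)"
    unfolding set_lebesgue_integral_def
    by (rule Bochner_Integration.integral_cong) (use L in \<open>auto simp: indicator_def\<close>)
  also have "\<dots> = (LINT x|lborel. partial i ?\<psi> x)"
    using smooth_continuous_on[OF smooth_partial[OF test_function_smooth[OF \<psi>]]]
    by (intro integral_completion) (simp add: borel_measurable_continuous_onI)
  also have "\<dots> = 0" by (rule test_function_integral_partial[OF \<psi>])
  finally show ?thesis by simp
qed

lemma is_weak_grad_smooth:
  assumes "smooth p"
  shows "is_weak_grad D p (grad p)"
  using integration_by_parts[OF assms] grad_L2[OF assms]
  by (auto simp: is_weak_grad_def has_weak_deriv_def grad_def)

lemma smooth_sobolev_1: "smooth p \<Longrightarrow> p \<in> sobolev D 1"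
  unfolding sobolev_1_iff using is_weak_grad_smooth smooth_L2 by blast

lemma weak_grad_smooth: "smooth p \<Longrightarrow> AE x in lebesgue. x \<in> D \<longrightarrow> weak_grad D p x = grad p x"
  by (intro is_weak_grad_unique[of p] is_weak_grad_smooth weak_grad_is_weak_grad smooth_sobolev_1)

lemma smooth_tends_H1_combination:
  assumes "v \<in> sobolev D 1" "v' \<in> sobolev D 1" "smooth_tends_H1 D \<phi> v" "smooth_tends_H1 D \<phi>' v'"
  shows "smooth_tends_H1 D (\<lambda>j x. a * \<phi> j x + b * \<phi>' j x) (\<lambda>x. a * v x + b * v' x)"
proof -
  have sm: "smooth (\<phi> j)" "smooth (\<phi>' j)" for j
    using assms by (auto simp: smooth_tends_H1_def)
  have comb: "(\<lambda>x. a * v x + b * v' x) \<in> sobolev D 1"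
    using assms by (intro sobolev_combination)
  have "(\<lambda>j. l2_norm D (\<lambda>x. a *\<^sub>R (\<phi> j x - v x) + b *\<^sub>R (\<phi>' j x - v' x))) \<longlonglongrightarrow> 0"
    using assms sm
    by (intro l2_norm_tendsto_combination L2_diff smooth_L2 sobolev_L2) (auto simp: smooth_tends_H1_def)
  then have 1: "(\<lambda>j. l2_norm D (\<lambda>x. a * \<phi> j x + b * \<phi>' j x - (a * v x + b * v' x))) \<longlonglongrightarrow> 0"
    by (simp add: algebra_simps)
  have "(\<lambda>j. l2_norm D (\<lambda>x. a *\<^sub>R (grad (\<phi> j) x - weak_grad D v x) + b *\<^sub>R (grad (\<phi>' j) x - weak_grad D v' x))) \<longlonglongrightarrow> 0"
    using assms sm
    by (intro l2_norm_tendsto_combination L2_diff grad_L2 weak_grad_L2) (auto simp: smooth_tends_H1_def)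
  \<comment> \<open>The gradient chosen for the combination need not be the combination of the
    chosen gradients; they differ on a null set, which the norm does not see.\<close>
  moreover have "l2_norm D (\<lambda>x. grad (\<lambda>x. a * \<phi> j x + b * \<phi>' j x) x - weak_grad D (\<lambda>x. a * v x + b * v' x) x)
    = l2_norm D (\<lambda>x. a *\<^sub>R (grad (\<phi> j) x - weak_grad D v x) + b *\<^sub>R (grad (\<phi>' j) x - weak_grad D v' x))" for j
  proof (rule l2_norm_cong_AE)
    show "AE x in lebesgue. x \<in> D \<longrightarrow>
      grad (\<lambda>x. a * \<phi> j x + b * \<phi>' j x) x - weak_grad D (\<lambda>x. a * v x + b * v' x) x =
      a *\<^sub>R (grad (\<phi> j) x - weak_grad D v x) + b *\<^sub>R (grad (\<phi>' j) x - weak_grad D v' x)"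
      using weak_grad_combination[OF assms(1,2), of a b]
      by eventually_elim (simp add: grad_combination sm algebra_simps)
  qed (use assms sm comb in \<open>auto intro!: L2_diff L2_linear_combination grad_L2 weak_grad_L2 smooth_combination\<close>)
  ultimately have 2: "(\<lambda>j. l2_norm D (\<lambda>x. grad (\<lambda>x. a * \<phi> j x + b * \<phi>' j x) x
      - weak_grad D (\<lambda>x. a * v x + b * v' x) x)) \<longlonglongrightarrow> 0"
    by simp
  show ?thesis
    unfolding smooth_tends_H1_def using 1 2 sm smooth_combination by blast
qed

lemma smooth_tends_H1_const:
  assumes "smooth p"
  shows "smooth_tends_H1 D (\<lambda>j. p) p"
proof -
  have "l2_norm D (\<lambda>x. grad p x - weak_grad D p x) = l2_norm D (\<lambda>x. 0 :: real^2)"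
  proof (rule l2_norm_cong_AE)
    show "AE x in lebesgue. x \<in> D \<longrightarrow> grad p x - weak_grad D p x = 0"
      using weak_grad_smooth[OF assms] by eventually_elim simp
  qed (use assms in \<open>auto intro!: L2_diff grad_L2 weak_grad_L2 smooth_sobolev_1\<close>)
  then show ?thesis
    using assms by (simp add: smooth_tends_H1_def l2_norm_def l2_inner_def)
qed

lemma sobolev_zero_combination:
  assumes "v \<in> sobolev_zero D" "v' \<in> sobolev_zero D"
  shows "(\<lambda>x. a * v x + b * v' x) \<in> sobolev_zero D"
proof -
  obtain \<phi> \<phi>' where \<phi>: "\<And>j. \<phi> j \<in> test_functions D" "smooth_tends_H1 D \<phi> v"
      "\<And>j. \<phi>' j \<in> test_functions D" "smooth_tends_H1 D \<phi>' v'" and v: "v \<in> sobolev D 1" "v' \<in> sobolev D 1"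
    using assms unfolding sobolev_zero_def by blast
  show ?thesis
    unfolding sobolev_zero_def
    by (intro CollectI conjI exI[of _ "\<lambda>j x. a * \<phi> j x + b * \<phi>' j x"] allI sobolev_combination
        smooth_tends_H1_combination test_function_combination) (use \<phi> v in auto)
qed

lemma has_weak_laplacian_combination:
  assumes "v \<in> L2 D" "v' \<in> L2 D" "w \<in> L2 D" "w' \<in> L2 D"
    and "has_weak_laplacian D v w" "has_weak_laplacian D v' w'"
  shows "has_weak_laplacian D (\<lambda>x. a * v x + b * v' x) (\<lambda>x. a * w x + b * w' x)"
  using assms
  by (auto simp: has_weak_laplacian_def l2_inner_combination_left test_function_L2[where D' = D] laplacian_test_function)

end

section \<open>Simple polygons\<close>

text \<open>Splits off the closing edge: the polygon becomes an open chain of segments and one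
  further segment back to its start.\<close>

lemma edges_eq:
  assumes "P \<noteq> []"
  shows "edges P = zip P (tl P) @ [(last P, hd P)]"
proof -
  have "rotate1 P = tl P @ [hd P]" "P = butlast P @ [last P]" "length (butlast P) = length (tl P)"
    using assms by (auto simp: rotate1_hd_tl)
  then have "edges P = zip (butlast P) (tl P) @ [(last P, hd P)]"
    unfolding edges_def by (metis zip_append zip_Cons_Cons zip_Nil)
  moreover have "zip P (tl P) = zip (butlast P) (tl P)"
  proof -
    have "zip (butlast P @ [last P]) (tl P) = zip (butlast P) (tl P)"
      by (simp add: zip_append1)
    then show ?thesis using assms by simp
  qed
  ultimately show ?thesis by simp
qed

lemma vertex_in_boundary: "z \<in> set P \<Longrightarrow> z \<in> boundary P"
proof -
  assume "z \<in> set P"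
  then obtain i where i: "i < length P" "P ! i = z" by (auto simp: in_set_conv_nth)
  then have "(z, rotate1 P ! i) \<in> set (edges P)"
    by (force simp: edges_def set_zip)
  then show ?thesis
    by (force simp: boundary_def edge_set_def)
qed

text \<open>The crossing condition of \<open>simple_polygon\<close> for an arbitrary set of edges, a
  form that passes to subsets and hence to shorter chains in an induction.\<close>

definition simple_chain :: "((real^2) \<times> (real^2)) set \<Rightarrow> bool" where
  "simple_chain S \<longleftrightarrow> (\<forall>e\<in>S. \<forall>f\<in>S. e \<noteq> f \<longrightarrow> edge_set e \<inter> edge_set f = {fst e, snd e} \<inter> {fst f, snd f})"

lemma set_zip_tl: "f \<in> set (zip xs (tl xs)) \<Longrightarrow> fst f \<in> set xs \<and> snd f \<in> set (tl xs)"
  by (metis in_set_zipE prod.collapse)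

text \<open>Induction on the vertices, prepending a segment. Its first vertex does not occur again,
  so by the crossing condition it can meet the rest of the chain only in the vertex where the two
  are joined.\<close>

lemma chain_arc:
  assumes "2 \<le> length xs" "distinct xs" "simple_chain (set (zip xs (tl xs)))"
  shows "\<exists>g. arc g \<and> pathstart g = hd xs \<and> pathfinish g = last xs \<and>
    path_image g = (\<Union>e\<in>set (zip xs (tl xs)). edge_set e)"
  using assms
proof (induction xs rule: induct_list012)
  case (3 x y zs)
  show ?case
  proof (cases "zs = []")
    case True
    then show ?thesis
      using 3 by (intro exI[of _ "linepath x y"]) (auto simp: edge_set_def intro: arc_linepath)
  next
    case False
    have "simple_chain (set (zip (y # zs) (tl (y # zs))))"
      using 3(5) by (auto simp: simple_chain_def)
    then obtain g where g: "arc g" "pathstart g = y" "pathfinish g = last (y # zs)"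
        "path_image g = (\<Union>e\<in>set (zip (y # zs) zs). edge_set e)"
      using 3(2,4) False by (auto simp: Suc_le_eq)
    have "path_image (linepath x y) \<inter> path_image g \<subseteq> {pathstart g}"
    proof
      fix z assume z: "z \<in> path_image (linepath x y) \<inter> path_image g"
      then obtain f where f: "f \<in> set (zip (y # zs) zs)" "z \<in> edge_set f" using g by auto
      then have "fst f \<in> set (y # zs)" "snd f \<in> set zs"
        using set_zip_tl[of f "y # zs"] by auto
      then have x: "x \<noteq> fst f" "x \<noteq> snd f" using 3(4) by auto
      then have "edge_set (x, y) \<inter> edge_set f = {x, y} \<inter> {fst f, snd f}"
        using 3(5) f(1) unfolding simple_chain_def by (metis fst_conv list.sel(3) list.set_intros(1) snd_conv zip_Cons_Cons list.set_intros(2))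
      with z f x g show "z \<in> {pathstart g}" by (auto simp: edge_set_def)
    qed
    moreover have "arc (linepath x y)" using 3(4) by (auto intro: arc_linepath)
    ultimately have "arc (linepath x y +++ g)"
      using g by (intro arc_join) auto
    with g False show ?thesis
      by (intro exI[of _ "linepath x y +++ g"]) (auto simp: path_image_join edge_set_def)
  qed
qed auto

text \<open>The passage from vertex lists to Jordan curves. The closing edge may meet the arc of the
  other edges only in its two ends, by the crossing condition.\<close>

lemma boundary_simple_path:
  assumes "simple_polygon P"
  obtains g where "simple_path g" "pathfinish g = pathstart g" "path_image g = boundary P"
proof -
  have len: "3 \<le> length P" and dist: "distinct P" and chain: "simple_chain (set (edges P))"
    using assms by (auto simp: simple_polygon_def simple_chain_def)
  then have ne: "P \<noteq> []" by auto
  note ed = edges_eq[OF ne]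
  have "simple_chain (set (zip P (tl P)))"
    using chain by (auto simp: simple_chain_def ed)
  then obtain g where g: "arc g" "pathstart g = hd P" "pathfinish g = last P"
      "path_image g = (\<Union>e\<in>set (zip P (tl P)). edge_set e)"
    using chain_arc[of P] len dist by auto
  let ?l = "linepath (last P) (hd P)"
  have hd: "hd P \<notin> set (tl P)" using dist ne by (metis distinct.simps(2) list.exhaust_sel)
  have "last P \<in> set (tl P)"
    using len by (cases P) (auto simp: last_in_set split: if_splits)
  with hd have "arc ?l" by (intro arc_linepath) auto
  moreover have "path_image g \<inter> path_image ?l \<subseteq> {pathstart g, pathstart ?l}"
  proof
    fix z assume z: "z \<in> path_image g \<inter> path_image ?l"
    then obtain f where f: "f \<in> set (zip P (tl P))" "z \<in> edge_set f" using g by auto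
    then have "snd f \<noteq> hd P" using set_zip_tl[of f P] hd by auto
    then have "f \<noteq> (last P, hd P)" by auto
    then have "edge_set f \<inter> edge_set (last P, hd P) = {fst f, snd f} \<inter> {last P, hd P}"
      using chain f unfolding simple_chain_def ed by auto
    with z f g show "z \<in> {pathstart g, pathstart ?l}" by (auto simp: edge_set_def)
  qed
  ultimately have "simple_path (g +++ ?l)"
    using g by (intro simple_path_join_loop) auto
  moreover have "path_image (g +++ ?l) = boundary P"
    using g by (subst path_image_join) (auto simp: boundary_def ed edge_set_def)
  ultimately show ?thesis
    using that[of "g +++ ?l"] g by auto
qed

locale polygon =
  fixes P :: polygon
  assumes simple: "simple_polygon P"
begin

lemma compact_boundary: "compact (boundary P)"
  using boundary_simple_path[OF simple] compact_simple_path_image by metis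

lemma open_cell: "open (cell P)"
  unfolding cell_def by (simp add: compact_boundary compact_imp_closed open_inside)

lemma bounded_cell: "bounded (cell P)"
  unfolding cell_def by (simp add: bounded_inside compact_boundary compact_imp_bounded)

lemma frontier_cell_subset: "frontier (cell P) \<subseteq> boundary P"
  unfolding cell_def by (simp add: compact_boundary compact_imp_closed frontier_inside_subset)

lemma cell_boundary_disjoint: "cell P \<inter> boundary P = {}"
  unfolding cell_def by (simp add: inside_no_overlap)

text \<open>The complement of a Jordan curve is disconnected, while the outside of a bounded set in
  the plane is connected; so the inside cannot be empty. A component of the complement lies inside,
  and its frontier is the whole curve.\<close>

lemma
  cell_nonempty: "cell P \<noteq> {}" and boundary_subset_closure: "boundary P \<subseteq> closure (cell P)"
proof -
  obtain g where g: "simple_path g" "pathfinish g = pathstart g" "path_image g = boundary P"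
    using boundary_simple_path[OF simple] .
  have "boundary P homeomorphic sphere (0::complex) 1"
    using homeomorphic_simple_path_image_circle[OF g(1,2), of 1 0] g(3) by simp
  moreover have "sphere (0::complex) 1 homeomorphic sphere (0::real^2) 1"
    by (intro homeomorphic_spheres_gen) auto
  ultimately have hom: "boundary P homeomorphic sphere (0::real^2) 1"
    by (rule homeomorphic_trans)
  have "\<not> connected (- boundary P)"
    by (rule Jordan_Brouwer_separation[OF hom]) simp
  moreover have "connected (outside (boundary P))"
    using compact_boundary by (intro connected_outside) (auto simp: compact_imp_bounded)
  moreover have "inside (boundary P) \<union> outside (boundary P) = - boundary P"
    by (rule inside_Un_outside)
  ultimately show ne: "cell P \<noteq> {}"
    unfolding cell_def by (metis sup_bot_left)
  then obtain x where x: "x \<in> inside (boundary P)" unfolding cell_def by blast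
  let ?C = "connected_component_set (- boundary P) x"
  have "x \<in> - boundary P" using x by (simp add: inside_def)
  then have comp: "?C \<in> components (- boundary P)"
    by (auto simp: components_def)
  have "?C \<subseteq> inside (boundary P)"
    using x inside_same_component[of "boundary P" x] by blast
  moreover have "frontier ?C = boundary P"
    by (rule Jordan_Brouwer_frontier[OF hom comp]) simp
  ultimately show "boundary P \<subseteq> closure (cell P)"
    unfolding cell_def using closure_mono[of ?C "inside (boundary P)"] by (auto simp: frontier_def)
qed

text \<open>A connected set meeting both the cell and its complement would meet the frontier, which
  is part of the boundary curve.\<close>

lemma connected_subset_cell:
  assumes "connected S" "S \<inter> boundary P = {}" "S \<inter> cell P \<noteq> {}"
  shows "S \<subseteq> cell P"
  using connected_Int_frontier[of S "cell P"] assms frontier_cell_subset by blast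

lemma edge_subset_boundary: "e \<in> set (edges P) \<Longrightarrow> edge_set e \<subseteq> boundary P"
  by (auto simp: boundary_def)

lemma edge_nondegenerate: "e \<in> set (edges P) \<Longrightarrow> fst e \<noteq> snd e"
proof -
  assume e: "e \<in> set (edges P)"
  have "3 \<le> length P" "distinct P" using simple by (auto simp: simple_polygon_def)
  moreover obtain i where i: "i < length P" "e = (P ! i, P ! (Suc i mod length P))"
    using e by (auto simp: edges_def set_zip nth_rotate1)
  moreover have "Suc i mod length P \<noteq> i" "Suc i mod length P < length P"
    using calculation by (auto simp: mod_Suc)
  ultimately show ?thesis
    by (simp add: nth_eq_iff_index_eq)
qed

end

section \<open>The side of an edge that lies in the cell, in coordinates along and across the
  edge\<close>

definition rot :: "real^2 \<Rightarrow> real^2" where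
  "rot d = vector [- d $ 2, d $ 1]"

lemma rot_nth [simp]: "rot d $ 1 = - d $ 2" "rot d $ 2 = d $ 1"
  by (auto simp: rot_def)

lemma inner_real2: "(x::real^2) \<bullet> y = x $ 1 * y $ 1 + x $ 2 * y $ 2"
  by (simp add: inner_vec_def sum_2)

lemma inner_rot [simp]: "d \<bullet> rot d = 0" "rot d \<bullet> d = 0" "rot d \<bullet> rot d = d \<bullet> d"
  by (auto simp: inner_real2 algebra_simps)

lemma norm_rot [simp]: "norm (rot d) = norm d"
  by (simp add: norm_eq_sqrt_inner)

lemma rot_decomposition: "(d \<bullet> d) *\<^sub>R y = (y \<bullet> d) *\<^sub>R d + (y \<bullet> rot d) *\<^sub>R rot d"
  by (auto simp: vec_eq_iff forall_2 inner_real2 algebra_simps)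

text \<open>An open rectangle resting on the line of the edge, with \<open>\<sigma> = 1\<close> or
  \<open>\<sigma> = -1\<close> selecting the side. Both coordinates are measured in units of the
  length of \<open>d\<close>.\<close>

definition half_box :: "real^2 \<Rightarrow> real^2 \<Rightarrow> real \<Rightarrow> real \<Rightarrow> real \<Rightarrow> (real^2) set" where
  "half_box p d \<sigma> s0 \<delta> = {p + s *\<^sub>R d + (\<sigma> * t) *\<^sub>R rot d |s t. \<bar>s - s0\<bar> < \<delta> \<and> 0 < t \<and> t < \<delta>}"

context polygon
begin

text \<open>A point of an edge other than its two ends lies on no other edge, by simplicity, and the
  other edges form a closed set. Close to the point the boundary is therefore contained in the line
  of the edge, where \<open>t = 0\<close>.\<close>

lemma edge_local:
  assumes e: "(p, q) \<in> set (edges P)" and s0: "0 < s0" "s0 < 1"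
  obtains \<delta> where "0 < \<delta>" "\<delta> \<le> s0" "\<delta> \<le> 1 - s0"
    "\<And>s t. \<bar>s - s0\<bar> < \<delta> \<Longrightarrow> \<bar>t\<bar> < \<delta> \<Longrightarrow> t \<noteq> 0 \<Longrightarrow> p + s *\<^sub>R (q - p) + t *\<^sub>R rot (q - p) \<notin> boundary P"
proof -
  define d where "d = q - p"
  define x where "x = p + s0 *\<^sub>R d"
  have d: "d \<noteq> 0" using edge_nondegenerate[OF e] by (auto simp: d_def)
  define C where "C = (\<Union>f\<in>set (edges P) - {(p, q)}. edge_set f)"
  have "closed C"
    unfolding C_def by (intro closed_UN) (auto simp: edge_set_def)
  moreover have "x \<notin> C"
  proof
    assume "x \<in> C"
    then obtain f where f: "f \<in> set (edges P)" "f \<noteq> (p, q)" "x \<in> edge_set f" by (auto simp: C_def)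
    have "x \<in> edge_set (p, q)"
      using s0 by (auto simp: edge_set_def x_def d_def closed_segment_def algebra_simps intro!: exI[of _ s0])
    then have "x \<in> {p, q}"
      using f e simple unfolding simple_polygon_def by (metis IntD1 IntI fst_conv snd_conv)
    then show False
      using d s0 by (auto simp: x_def d_def algebra_simps scaleR_left_diff_distrib[symmetric])
  qed
  ultimately obtain \<epsilon> where \<epsilon>: "0 < \<epsilon>" "ball x \<epsilon> \<inter> C = {}"
    by (metis ComplI disjoint_eq_subset_Compl open_Compl open_contains_ball)
  \<comment> \<open>The first bound keeps \<open>s\<close> in the unit interval. The second puts the
    points considered into \<open>ball x \<epsilon>\<close>, as their distance to \<open>x\<close>
    is less than \<open>2 * \<delta> * norm d\<close>.\<close>
  define \<delta> where "\<delta> = min (min s0 (1 - s0)) (\<epsilon> / (2 * norm d))"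
  have \<delta>: "0 < \<delta>" "\<delta> \<le> s0" "\<delta> \<le> 1 - s0" "\<delta> * (2 * norm d) \<le> \<epsilon>"
  proof -
    have "\<delta> \<le> \<epsilon> / (2 * norm d)" by (simp add: \<delta>_def)
    then show "\<delta> * (2 * norm d) \<le> \<epsilon>" using d by (simp add: pos_le_divide_eq)
  qed (use s0 d \<epsilon> in \<open>auto simp: \<delta>_def\<close>)
  have "p + s *\<^sub>R d + t *\<^sub>R rot d \<notin> boundary P" if st: "\<bar>s - s0\<bar> < \<delta>" "\<bar>t\<bar> < \<delta>" "t \<noteq> 0" for s t
  proof
    let ?y = "p + s *\<^sub>R d + t *\<^sub>R rot d"
    assume y: "?y \<in> boundary P"
    have "?y - x = (s - s0) *\<^sub>R d + t *\<^sub>R rot d"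
      by (simp add: x_def algebra_simps)
    then have "norm (?y - x) \<le> norm ((s - s0) *\<^sub>R d) + norm (t *\<^sub>R rot d)"
      by (simp only: norm_triangle_ineq)
    also have "\<dots> = (\<bar>s - s0\<bar> + \<bar>t\<bar>) * norm d" by (simp add: distrib_right)
    also have "\<dots> < (\<delta> + \<delta>) * norm d" using st d by (intro mult_strict_right_mono) auto
    also have "\<dots> \<le> \<epsilon>" using \<delta> by (simp add: algebra_simps)
    finally have "?y \<in> ball x \<epsilon>" by (simp add: dist_norm norm_minus_commute)
    then have "?y \<notin> C" using \<epsilon> by blast
    with y have "?y \<in> edge_set (p, q)" by (auto simp: boundary_def C_def)
    then obtain r where "?y = p + r *\<^sub>R d"
      by (auto simp: edge_set_def closed_segment_def d_def algebra_simps)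
    then have "s *\<^sub>R d + t *\<^sub>R rot d = r *\<^sub>R d" by simp
    then have "(s *\<^sub>R d + t *\<^sub>R rot d) \<bullet> rot d = (r *\<^sub>R d) \<bullet> rot d" by (simp only:)
    then have "t * (d \<bullet> d) = 0" by (simp add: inner_add_left)
    with st d show False by simp
  qed
  with \<delta> show ?thesis using that[of \<delta>] by (simp add: d_def)
qed

text \<open>The boundary lies in the closure of the cell, so there is a cell point \<open>y\<close>
  close to the given edge point. It is off the edge, hence on one side; the half box on that side is
  connected and avoids the boundary, so it lies in the cell with \<open>y\<close>.\<close>

lemma edge_side:
  assumes e: "(p, q) \<in> set (edges P)" and s0: "0 < s0" "s0 < 1"
  obtains \<delta> \<sigma> where "0 < \<delta>" "\<delta> \<le> s0" "\<delta> \<le> 1 - s0" "\<sigma> = 1 \<or> \<sigma> = -1"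
    "half_box p (q - p) \<sigma> s0 \<delta> \<subseteq> cell P"
proof -
  define d where "d = q - p"
  have d: "d \<noteq> 0" using edge_nondegenerate[OF e] by (auto simp: d_def)
  then have dd: "d \<bullet> d > 0" by simp
  obtain \<delta> where \<delta>: "0 < \<delta>" "\<delta> \<le> s0" "\<delta> \<le> 1 - s0"
    "\<And>s t. \<bar>s - s0\<bar> < \<delta> \<Longrightarrow> \<bar>t\<bar> < \<delta> \<Longrightarrow> t \<noteq> 0 \<Longrightarrow> p + s *\<^sub>R d + t *\<^sub>R rot d \<notin> boundary P"
    using edge_local[OF e s0] unfolding d_def by metis
  define x where "x = p + s0 *\<^sub>R d"
  define U where "U = {y. \<bar>(y - p) \<bullet> d / (d \<bullet> d) - s0\<bar> < \<delta> \<and> \<bar>(y - p) \<bullet> rot d / (d \<bullet> d)\<bar> < \<delta>}"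
  have "open U"
    unfolding U_def by (intro open_Collect_conj open_Collect_less continuous_intros) (use dd in auto)
  moreover have "x \<in> U"
    using \<delta> dd by (simp add: U_def x_def)
  moreover have "x \<in> closure (cell P)"
  proof -
    have "x \<in> edge_set (p, q)"
      using s0 by (auto simp: edge_set_def x_def d_def closed_segment_def algebra_simps intro!: exI[of _ s0])
    then show ?thesis using boundary_subset_closure edge_subset_boundary[OF e] by blast
  qed
  ultimately obtain y where y: "y \<in> U" "y \<in> cell P"
    by (metis closure_iff_nhds_not_empty disjoint_iff subset_refl)
  \<comment> \<open>Coordinates of \<open>y\<close> in the orthogonal basis \<open>d\<close>,
    \<open>rot d\<close>; the sign of \<open>t\<close> will select the side.\<close>
  define s t where "s = (y - p) \<bullet> d / (d \<bullet> d)" "t = (y - p) \<bullet> rot d / (d \<bullet> d)"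
  have "(d \<bullet> d) *\<^sub>R (y - p) = (d \<bullet> d) *\<^sub>R (s *\<^sub>R d + t *\<^sub>R rot d)"
    using rot_decomposition[of d "y - p"] dd by (simp add: s_t_def scaleR_add_right)
  then have "y - p = s *\<^sub>R d + t *\<^sub>R rot d" using dd by (simp only: scaleR_cancel_left) auto
  then have y_eq: "y = p + s *\<^sub>R d + t *\<^sub>R rot d" by (simp add: algebra_simps)
  have st: "\<bar>s - s0\<bar> < \<delta>" "\<bar>t\<bar> < \<delta>" using y(1) by (auto simp: U_def s_t_def)
  have "t \<noteq> 0"
  proof
    assume "t = 0"
    then have "y = p + s *\<^sub>R d" using y_eq by simp
    moreover have "0 \<le> s" "s \<le> 1" using st \<delta> by auto
    ultimately have "y \<in> edge_set (p, q)"
      by (auto simp: edge_set_def d_def closed_segment_def algebra_simps intro!: exI[of _ s])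
    then show False using y(2) edge_subset_boundary[OF e] cell_boundary_disjoint by blast
  qed
  define \<sigma> :: real where "\<sigma> = sgn t"
  have \<sigma>: "\<sigma> = 1 \<or> \<sigma> = -1" "\<sigma> * \<bar>t\<bar> = t" using \<open>t \<noteq> 0\<close> by (auto simp: \<sigma>_def sgn_if)
  have "half_box p d \<sigma> s0 \<delta> \<subseteq> cell P"
  proof (rule connected_subset_cell)
    have "half_box p d \<sigma> s0 \<delta> = (\<lambda>(s, t). p + s *\<^sub>R d + (\<sigma> * t) *\<^sub>R rot d) ` ({s0 - \<delta><..<s0 + \<delta>} \<times> {0<..<\<delta>})"
      unfolding half_box_def by (auto simp: image_iff abs_less_iff) (metis abs_less_iff add.commute diff_less_eq less_diff_eq)+
    also have "connected \<dots>"
      by (intro connected_continuous_image connected_Times continuous_intros) (auto simp: case_prod_unfold intro!: continuous_intros)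
    finally show "connected (half_box p d \<sigma> s0 \<delta>)" .
    show "half_box p d \<sigma> s0 \<delta> \<inter> boundary P = {}"
    proof -
      have "p + s *\<^sub>R d + (\<sigma> * t) *\<^sub>R rot d \<notin> boundary P" if "\<bar>s - s0\<bar> < \<delta>" "0 < t" "t < \<delta>" for s t
        using that \<sigma>(1) by (intro \<delta>(4)) auto
      then show ?thesis unfolding half_box_def by blast
    qed
    have "y \<in> half_box p d \<sigma> s0 \<delta>"
      unfolding half_box_def using st \<sigma>(2) \<open>t \<noteq> 0\<close> y_eq by (intro CollectI exI[of _ s] exI[of _ "\<bar>t\<bar>"]) auto
    with y(2) show "half_box p d \<sigma> s0 \<delta> \<inter> cell P \<noteq> {}" by blast
  qed
  with \<delta> \<sigma> show ?thesis using that[of \<delta> \<sigma>] by (simp add: d_def)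
qed

end

sublocale polygon \<subseteq> bounded_open "cell P"
  by unfold_locales (rule open_cell, rule bounded_cell)

section \<open>Traces\<close>

lemma integral_affine_image_real2:
  fixes F :: "real^2 \<Rightarrow> real" and p d e :: "real^2"
  assumes F: "continuous_on UNIV F" and ne: "d $ 1 * e $ 2 - e $ 1 * d $ 2 \<noteq> 0"
  defines "T \<equiv> \<lambda>x :: real^2. p + x $ 1 *\<^sub>R d + x $ 2 *\<^sub>R e"
  shows "F absolutely_integrable_on T ` box a b"
    and "integral (T ` box a b) F
      = \<bar>d $ 1 * e $ 2 - e $ 1 * d $ 2\<bar> * integral (box a b) (\<lambda>x. F (T x))"
proof -
  define L where "L = (\<lambda>x :: real^2. x $ 1 *\<^sub>R d + x $ 2 *\<^sub>R e)"
  let ?D = "d $ 1 * e $ 2 - e $ 1 * d $ 2"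
  have der: "(T has_derivative L) (at x within box a b)" for x
    unfolding T_def L_def
    by (auto intro!: derivative_eq_intros bounded_linear_imp_has_derivative bounded_linear_vec_nth)
  have det: "det (matrix L) = ?D"
    by (simp add: det_2 matrix_def L_def axis_def)
  have inj: "inj_on T (box a b)"
  proof (rule inj_onI)
    fix x y assume "T x = T y"
    then have *: "(x $ 1 - y $ 1) * d $ i + (x $ 2 - y $ 2) * e $ i = 0" for i
      by (auto simp: T_def vec_eq_iff algebra_simps)
    have "(x $ 1 - y $ 1) * ?D = 0" "(x $ 2 - y $ 2) * ?D = 0"
      using *[of 1] *[of 2] by algebra+
    with ne show "x = y" by (simp add: vec_eq_iff forall_2)
  qed
  have contT: "continuous_on UNIV T"
    unfolding T_def by (intro continuous_intros)
  have "(\<lambda>x. F (T x)) absolutely_integrable_on cbox a b"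
    by (intro absolutely_integrable_continuous continuous_on_subset[OF continuous_on_compose2[OF F contT]]) auto
  then have "(\<lambda>x. F (T x)) absolutely_integrable_on box a b"
    by (rule set_integrable_subset) (auto simp: box_subset_cbox)
  then have int: "(\<lambda>x. \<bar>?D\<bar> * F (T x)) absolutely_integrable_on box a b"
    by (rule set_integrable_mult_right)
  \<comment> \<open>The change of variables theorem speaks of vector-valued integrands;
    \<open>vec\<close> turns the scalar integrand into one with values in
    \<open>real^1\<close>.\<close>
  have "(\<lambda>x. \<bar>det (matrix L)\<bar> *\<^sub>R (vec (F (T x)) :: real^1)) absolutely_integrable_on box a b \<and>
     integral (box a b) (\<lambda>x. \<bar>det (matrix L)\<bar> *\<^sub>R (vec (F (T x)) :: real^1))
       = vec (integral (box a b) (\<lambda>x. \<bar>?D\<bar> * F (T x)))"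
    using int by (simp add: det absolutely_integrable_on_1_iff integral_on_1_eq vec_eq_iff)
  then have "(\<lambda>x. vec (F x) :: real^1) absolutely_integrable_on (T ` box a b) \<and>
      integral (T ` box a b) (\<lambda>x. vec (F x) :: real^1) = vec (integral (box a b) (\<lambda>x. \<bar>?D\<bar> * F (T x)))"
    by (subst (asm) has_absolute_integral_change_of_variables[OF _ der inj]) auto
  then show "F absolutely_integrable_on T ` box a b"
    "integral (T ` box a b) F = \<bar>?D\<bar> * integral (box a b) (\<lambda>x. F (T x))"
    by (auto simp: absolutely_integrable_on_1_iff integral_on_1_eq vec_eq_iff)
qed

text \<open>Iterated integration is carried over from the product type along \<open>g\<close>, which
  maps boxes to boxes and preserves their measure; hence the factor \<open>1\<close> in
  \<open>has_integral_twiddle\<close>.\<close>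

lemma integral_real2_iterated:
  fixes f :: "real^2 \<Rightarrow> real"
  assumes f: "continuous_on UNIV f"
  shows "integral (cbox a b) f
    = integral {a $ 1..b $ 1} (\<lambda>s. integral {a $ 2..b $ 2} (\<lambda>t. f (vector [s, t])))"
proof -
  define g where "g = (\<lambda>z :: real \<times> real. vector [fst z, snd z] :: real^2)"
  define h where "h = (\<lambda>x :: real^2. (x $ 1, x $ 2))"
  have hg: "h (g z) = z" "g (h x) = x" for z x
    by (auto simp: g_def h_def vec_eq_iff forall_2)
  have contg: "continuous_on UNIV g"
  proof -
    have "g = (\<lambda>z. fst z *\<^sub>R axis 1 1 + snd z *\<^sub>R axis 2 1)"
      by (auto simp: g_def vec_eq_iff forall_2 axis_def)
    then show ?thesis by (auto intro!: continuous_intros)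
  qed
  have g_box: "g ` cbox u v = cbox (g u) (g v)" for u v
  proof -
    have "x \<in> cbox (g u) (g v) \<longleftrightarrow> h x \<in> cbox u v" for x
      by (cases u; cases v) (auto simp: g_def h_def mem_box_cart forall_2 cbox_Pair_eq)
    moreover have "x \<in> g ` cbox u v \<longleftrightarrow> h x \<in> cbox u v" for x
      using hg by (metis imageE image_eqI)
    ultimately show ?thesis by blast
  qed
  have h_box: "h ` cbox u v = cbox (h u) (h v)" for u v
    using g_box[of "h u" "h v"] hg by (metis (no_types, lifting) image_cong image_ident image_image)
  have "((\<lambda>z. f (g z)) has_integral (1 / 1) *\<^sub>R integral (cbox a b) f) (h ` cbox a b)"
  proof (rule has_integral_twiddle)
    show "continuous (at z) g" for z
      using contg by (cases z) (simp add: continuous_on_eq_continuous_at)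
    show "measure lborel (g ` cbox u v) = 1 * measure lborel (cbox u v)" for u v
    proof -
      have "cbox (g u) (g v) = {} \<longleftrightarrow> \<not> (fst u \<le> fst v \<and> snd u \<le> snd v)"
        using interval_ne_empty_cart(1)[of "g u" "g v"] by (auto simp: forall_2 g_def)
      then show ?thesis
        unfolding g_box by (cases u; cases v) (auto simp: content_Pair content_cbox_if_cart UNIV_2 content_real_if g_def)
    qed
    show "(f has_integral integral (cbox a b) f) (cbox a b)"
      using integrable_continuous[OF continuous_on_subset[OF f]] by (simp add: integrable_integral)
  qed (use hg g_box h_box in \<open>blast+ | simp\<close>)+
  then have "integral (cbox a b) f = integral (cbox (h a) (h b)) (\<lambda>z. f (g z))"
    by (simp add: h_box has_integral_integrable_integral)
  also have "\<dots> = integral (cbox (a $ 1) (b $ 1)) (\<lambda>s. integral (cbox (a $ 2) (b $ 2)) (\<lambda>t. f (g (s, t))))"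
    unfolding h_def
    by (intro integral_prod_continuous continuous_on_compose2[OF f contg]
        continuous_on_subset[OF continuous_on_compose2[OF f contg]]) auto
  finally show ?thesis by (simp add: g_def)
qed

lemma smooth_line_derivative:
  assumes "smooth \<phi>"
  shows "((\<lambda>t. \<phi> (c + t *\<^sub>R m)) has_real_derivative grad \<phi> (c + t *\<^sub>R m) \<bullet> m) (at t within S)"
proof -
  have "((\<lambda>t. c + t *\<^sub>R m) has_derivative (\<lambda>t. t *\<^sub>R m)) (at t within S)"
    by (auto intro!: derivative_eq_intros)
  from has_derivative_compose[OF this smooth_has_derivative[OF assms]]
  have "((\<lambda>t. \<phi> (c + t *\<^sub>R m)) has_derivative (\<lambda>r. frechet_derivative \<phi> (at (c + t *\<^sub>R m)) (r *\<^sub>R m))) (at t within S)" .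
  moreover have "frechet_derivative \<phi> (at y) (r *\<^sub>R m) = (grad \<phi> y \<bullet> m) * r" for y r
  proof -
    interpret linear "frechet_derivative \<phi> (at y)"
      by (rule linear_frechet_derivative[OF smooth_differentiable[OF assms]])
    have "m = (m $ 1) *\<^sub>R axis 1 1 + (m $ 2) *\<^sub>R axis 2 1"
      by (auto simp: vec_eq_iff forall_2 axis_def)
    then have "frechet_derivative \<phi> (at y) m
        = m $ 1 * frechet_derivative \<phi> (at y) (axis 1 1) + m $ 2 * frechet_derivative \<phi> (at y) (axis 2 1)"
      by (metis add scaleR real_scaleR_def)
    then show ?thesis
      by (simp add: scaleR grad_def partial_def inner_real2 mult.commute)
  qed
  ultimately show ?thesis
    by (simp add: has_field_derivative_def)
qed

text \<open>Integrate the derivative of \<open>(t - a) * (\<phi> (c + t m))\<^sup>2\<close> from \<open>0\<close> to \<open>a\<close>.\<close>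

lemma trace_inequality_line:
  assumes \<phi>: "smooth \<phi>" and a: "0 \<le> a"
  shows "a * (\<phi> c)\<^sup>2
    \<le> (1 + a) * integral {0..a} (\<lambda>t. (\<phi> (c + t *\<^sub>R m))\<^sup>2 + (norm m)\<^sup>2 * (norm (grad \<phi> (c + t *\<^sub>R m)))\<^sup>2)"
proof -
  define f where "f t = \<phi> (c + t *\<^sub>R m)" for t
  define f' where "f' t = grad \<phi> (c + t *\<^sub>R m) \<bullet> m" for t
  define G where "G t = norm (grad \<phi> (c + t *\<^sub>R m))" for t
  have f: "(f has_real_derivative f' t) (at t within S)" for t S
    unfolding f_def f'_def by (rule smooth_line_derivative[OF \<phi>])
  have cont: "continuous_on {0..a} f" "continuous_on {0..a} f'" "continuous_on {0..a} G"
    unfolding f_def f'_def G_def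
    by (intro continuous_intros continuous_on_compose2[OF smooth_continuous_on[OF \<phi>, of UNIV]]
        continuous_on_compose2[OF smooth_grad_continuous_on[OF \<phi>, of UNIV]]; simp)+
  have "((\<lambda>t. (f t)\<^sup>2 + (t - a) * (2 * f t * f' t)) has_integral (a - a) * (f a)\<^sup>2 - (0 - a) * (f 0)\<^sup>2) {0..a}"
    using a
    by (intro fundamental_theorem_of_calculus)
      (auto intro!: derivative_eq_intros f simp: has_real_derivative_iff_has_vector_derivative[symmetric] power2_eq_square algebra_simps)
  then have "a * (f 0)\<^sup>2 = integral {0..a} (\<lambda>t. (f t)\<^sup>2 + (t - a) * (2 * f t * f' t))"
    by (simp add: integral_unique)
  also have "\<dots> \<le> integral {0..a} (\<lambda>t. (1 + a) * ((f t)\<^sup>2 + (norm m)\<^sup>2 * (G t)\<^sup>2))"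
  proof (rule integral_le)
    show "(\<lambda>t. (f t)\<^sup>2 + (t - a) * (2 * f t * f' t)) integrable_on {0..a}"
      "(\<lambda>t. (1 + a) * ((f t)\<^sup>2 + (norm m)\<^sup>2 * (G t)\<^sup>2)) integrable_on {0..a}"
      by (intro integrable_continuous_real continuous_intros cont)+
    fix t assume t: "t \<in> {0..a}"
    have "\<bar>f' t\<bar> \<le> G t * norm m"
      unfolding f'_def G_def by (rule Cauchy_Schwarz_ineq2)
    then have f'2: "(f' t)\<^sup>2 \<le> (norm m)\<^sup>2 * (G t)\<^sup>2"
      by (metis abs_ge_zero mult.commute power2_abs power_mono power_mult_distrib)
    \<comment> \<open>Since \<open>t - a\<close> is nonpositive, \<open>2 * f t * f' t\<close> has
      to be bounded from below, namely by \<open>- ((f t)\<^sup>2 + (f' t)\<^sup>2)\<close>.\<close>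
    have "(t - a) * (2 * f t * f' t) \<le> (a - t) * ((f t)\<^sup>2 + (f' t)\<^sup>2)"
    proof -
      have "0 \<le> (a - t) * (f t + f' t)\<^sup>2" using t by simp
      then show ?thesis by (simp add: power2_eq_square algebra_simps)
    qed
    also have "\<dots> \<le> a * ((f t)\<^sup>2 + (norm m)\<^sup>2 * (G t)\<^sup>2)"
      using t f'2 by (intro mult_mono) auto
    finally have "(t - a) * (2 * f t * f' t) \<le> a * ((f t)\<^sup>2 + (norm m)\<^sup>2 * (G t)\<^sup>2)" .
    moreover have "0 \<le> (norm m)\<^sup>2 * (G t)\<^sup>2" by simp
    ultimately show "(f t)\<^sup>2 + (t - a) * (2 * f t * f' t) \<le> (1 + a) * ((f t)\<^sup>2 + (norm m)\<^sup>2 * (G t)\<^sup>2)"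
      unfolding distrib_right mult_1 by linarith
  qed
  also have "\<dots> = (1 + a) * integral {0..a} (\<lambda>t. (f t)\<^sup>2 + (norm m)\<^sup>2 * (G t)\<^sup>2)"
    by simp
  finally show ?thesis
    by (simp add: f_def G_def)
qed

context polygon
begin

text \<open>Integrating the line inequality along the edge turns its right-hand side into an
  integral over a half box, which lies in the cell. The constant is independent of
  \<open>\<phi>\<close>, so the bound can be applied along a sequence.\<close>

lemma trace_inequality_local:
  assumes e: "(p, q) \<in> set (edges P)" and s0: "0 < s0" "s0 < 1"
  obtains \<eta> C where "0 < \<eta>" "\<eta> < s0" "\<eta> < 1 - s0"
    "\<And>\<phi>. smooth \<phi> \<Longrightarrow> integral {s0 - \<eta>..s0 + \<eta>} (\<lambda>s. (\<phi> (p + s *\<^sub>R (q - p)))\<^sup>2)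
       \<le> C * (l2_inner (cell P) \<phi> \<phi> + (norm (q - p))\<^sup>2 * l2_inner (cell P) (grad \<phi>) (grad \<phi>))"
proof -
  define d where "d = q - p"
  have d: "d \<noteq> 0" using edge_nondegenerate[OF e] by (auto simp: d_def)
  then have dd: "d \<bullet> d > 0" by simp
  obtain \<delta> \<sigma> where \<delta>: "0 < \<delta>" "\<delta> \<le> s0" "\<delta> \<le> 1 - s0" and \<sigma>: "\<sigma> = 1 \<or> \<sigma> = -1"
    and sub: "half_box p d \<sigma> s0 \<delta> \<subseteq> cell P"
    using edge_side[OF e s0] unfolding d_def by metis
  \<comment> \<open>Half of \<open>\<delta>\<close>, so that \<open>\<eta>\<close> is strictly below
    \<open>s0\<close> and \<open>1 - s0\<close>.\<close>
  define \<eta> where "\<eta> = \<delta> / 2"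
  have \<eta>: "0 < \<eta>" "\<eta> < \<delta>" using \<delta> by (auto simp: \<eta>_def)
  define n where "n = \<sigma> *\<^sub>R rot d"
  define T where "T = (\<lambda>x :: real^2. p + x $ 1 *\<^sub>R d + x $ 2 *\<^sub>R n)"
  define a b :: "real^2" where "a = vector [s0 - \<eta>, 0]" and "b = vector [s0 + \<eta>, \<eta>]"
  have norm_n: "norm n = norm d" using \<sigma> by (auto simp: n_def)
  have Tsub: "T ` box a b \<subseteq> cell P"
  proof -
    have "T x \<in> half_box p d \<sigma> s0 \<delta>" if "x \<in> box a b" for x
    proof -
      have "T x = p + x $ 1 *\<^sub>R d + (\<sigma> * x $ 2) *\<^sub>R rot d"
        by (simp add: T_def n_def mult.commute)
      moreover have "\<bar>x $ 1 - s0\<bar> < \<delta>" "0 < x $ 2" "x $ 2 < \<delta>"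
        using that \<eta> by (auto simp: mem_box_cart forall_2 a_def b_def)
      ultimately show ?thesis unfolding half_box_def by blast
    qed
    with sub show ?thesis by blast
  qed
  \<comment> \<open>Up to sign, \<open>n\<close> is \<open>d\<close> turned by a right angle, so the
    Jacobian of \<open>T\<close> is the squared edge length.\<close>
  have det: "\<bar>d $ 1 * n $ 2 - n $ 1 * d $ 2\<bar> = d \<bullet> d"
    using \<sigma> dd by (auto simp: n_def inner_real2)
  have ne: "d $ 1 * n $ 2 - n $ 1 * d $ 2 \<noteq> 0" using det dd by auto
  \<comment> \<open>The factor \<open>(1 + \<eta>) / \<eta>\<close> comes from the line inequality
    on an interval of length \<open>\<eta>\<close>, the factor \<open>1 / (d \<bullet> d)\<close>
    from the Jacobian of \<open>T\<close>.\<close>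
  have bound: "integral {s0 - \<eta>..s0 + \<eta>} (\<lambda>s. (\<phi> (p + s *\<^sub>R d))\<^sup>2)
       \<le> ((1 + \<eta>) / (\<eta> * (d \<bullet> d))) * (l2_inner (cell P) \<phi> \<phi> + (norm d)\<^sup>2 * l2_inner (cell P) (grad \<phi>) (grad \<phi>))"
    if \<phi>: "smooth \<phi>" for \<phi>
  proof -
    define F where "F x = (\<phi> x)\<^sup>2 + (norm d)\<^sup>2 * (norm (grad \<phi> x))\<^sup>2" for x
    have contF: "continuous_on S F" for S
      unfolding F_def by (intro continuous_intros smooth_continuous_on smooth_grad_continuous_on \<phi>)
    have contT: "continuous_on S T" for S
      unfolding T_def by (intro continuous_intros)
    have cont\<phi>: "continuous_on S (\<lambda>s. (\<phi> (p + s *\<^sub>R d))\<^sup>2)" for S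
      by (intro continuous_intros continuous_on_compose2[OF smooth_continuous_on[OF \<phi>, of UNIV]]) auto
    have contFT: "continuous_on S (\<lambda>x. F (T x))" for S
      by (rule continuous_on_compose2[OF contF[of UNIV] contT]) simp
    have Fint: "set_integrable lebesgue (cell P) F"
      and Feq: "(LINT x:cell P|lebesgue. F x) = l2_inner (cell P) \<phi> \<phi> + (norm d)\<^sup>2 * l2_inner (cell P) (grad \<phi>) (grad \<phi>)"
      using L2_inner_integrable[OF smooth_L2[OF \<phi>] smooth_L2[OF \<phi>]] L2_inner_integrable[OF grad_L2[OF \<phi>] grad_L2[OF \<phi>]]
      by (auto simp: F_def[abs_def] l2_inner_def power2_eq_square dot_square_norm)
    have contFv: "continuous_on UNIV (\<lambda>z :: real \<times> real. F (T (vector [fst z, snd z])))"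
      unfolding T_def by (auto intro!: continuous_on_compose2[OF contF[of UNIV]] continuous_intros)
    have "\<eta> * integral {s0 - \<eta>..s0 + \<eta>} (\<lambda>s. (\<phi> (p + s *\<^sub>R d))\<^sup>2)
        = integral {s0 - \<eta>..s0 + \<eta>} (\<lambda>s. \<eta> * (\<phi> (p + s *\<^sub>R d))\<^sup>2)" by simp
    also have "\<dots> \<le> integral {s0 - \<eta>..s0 + \<eta>} (\<lambda>s. (1 + \<eta>) * integral {0..\<eta>} (\<lambda>t. F (T (vector [s, t]))))"
    proof (rule integral_le)
      show "(\<lambda>s. \<eta> * (\<phi> (p + s *\<^sub>R d))\<^sup>2) integrable_on {s0 - \<eta>..s0 + \<eta>}"
        by (intro integrable_continuous_real continuous_on_mult_left cont\<phi>)
      have "(\<lambda>s. integral (cbox 0 \<eta>) (\<lambda>t. (\<lambda>z. F (T (vector [fst z, snd z]))) (s, t))) integrable_on cbox (s0 - \<eta>) (s0 + \<eta>)"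
        by (rule integral_integrable_2dim) (rule continuous_on_subset[OF contFv subset_UNIV])
      then show "(\<lambda>s. (1 + \<eta>) * integral {0..\<eta>} (\<lambda>t. F (T (vector [s, t])))) integrable_on {s0 - \<eta>..s0 + \<eta>}"
        by (intro integrable_on_mult_right) simp
      show "\<eta> * (\<phi> (p + s *\<^sub>R d))\<^sup>2 \<le> (1 + \<eta>) * integral {0..\<eta>} (\<lambda>t. F (T (vector [s, t])))" for s
        using trace_inequality_line[OF \<phi>, of \<eta> "p + s *\<^sub>R d" n] \<eta> by (simp add: F_def T_def norm_n)
    qed
    also have "\<dots> = (1 + \<eta>) * integral (cbox a b) (\<lambda>x. F (T x))"
      by (subst integral_real2_iterated[OF contFT]) (simp add: a_def b_def)
    also have "integral (cbox a b) (\<lambda>x. F (T x)) = integral (box a b) (\<lambda>x. F (T x))"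
      by (rule integral_open_interval[symmetric])
    also have "\<dots> = integral (T ` box a b) F / (d \<bullet> d)"
      using integral_affine_image_real2(2)[OF contF ne, of p a b] det dd by (simp add: T_def)
    also have "\<dots> \<le> integral (cell P) F / (d \<bullet> d)"
    proof -
      have "integral (T ` box a b) F \<le> integral (cell P) F"
        using integral_affine_image_real2(1)[OF contF ne, of p a b] Tsub Fint
        by (intro integral_subset_le) (auto simp: T_def F_def set_lebesgue_integral_eq_integral(1))
      then show ?thesis using dd by (simp add: divide_right_mono)
    qed
    finally have "\<eta> * integral {s0 - \<eta>..s0 + \<eta>} (\<lambda>s. (\<phi> (p + s *\<^sub>R d))\<^sup>2)
        \<le> (1 + \<eta>) * (integral (cell P) F / (d \<bullet> d))" using \<eta> by simp
    then show ?thesis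
      using \<eta> dd Feq set_lebesgue_integral_eq_integral(2)[OF Fint] by (simp add: field_simps)
  qed
  have "\<eta> < s0" "\<eta> < 1 - s0" using \<eta> \<delta> by auto
  from that[OF \<eta>(1) this bound[unfolded d_def]] show ?thesis .
qed


section \<open>Integrals along edges and uniqueness of traces\<close>

lemma edge_parametrization:
  assumes "(p, q) \<in> set (edges P)"
  shows "continuous_on {0..1} (linepath p q)" "linepath p q ` {0..1} \<subseteq> boundary P"
    "linepath p q s = p + s *\<^sub>R (q - p)"
proof -
  show "linepath p q ` {0..1} \<subseteq> boundary P"
    using edge_subset_boundary[OF assms] by (simp add: edge_set_def linepath_image_01)
qed (auto simp: linepath_def algebra_simps intro!: continuous_intros)

lemma continuous_on_edge:
  assumes "(p, q) \<in> set (edges P)" "continuous_on (boundary P) g"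
  shows "continuous_on {0..1} (\<lambda>t. g (linepath p q t))"
  by (rule continuous_on_compose2[OF assms(2) edge_parametrization(1,2)[OF assms(1)]])

lemma edge_integral_eq:
  assumes "(p, q) \<in> set (edges P)" "continuous_on (boundary P) g"
  shows "edge_integral (p, q) g = dist p q * integral {0..1} (\<lambda>t. g (linepath p q t))"
  unfolding edge_integral_def edge_length_def
  using set_lebesgue_integral_eq_integral(2)[OF absolutely_integrable_continuous_real[OF continuous_on_edge[OF assms]]]
  by simp

lemma continuous_edge_L2:
  assumes "e \<in> set (edges P)" "continuous_on (boundary P) g"
  shows "g \<in> edge_L2 e"
proof -
  have e: "(fst e, snd e) \<in> set (edges P)" using assms by simp
  have "set_borel_measurable lebesgue {0..1} (\<lambda>t. g (linepath (fst e) (snd e) t))"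
    using absolutely_integrable_continuous_real[OF continuous_on_edge[OF e assms(2)]]
    unfolding set_integrable_def set_borel_measurable_def by (rule borel_measurable_integrable)
  moreover have "set_integrable lebesgue {0..1} (\<lambda>t. (g (linepath (fst e) (snd e) t))\<^sup>2)"
    by (intro absolutely_integrable_continuous_real continuous_intros continuous_on_edge[OF e assms(2)])
  ultimately show ?thesis by (simp add: edge_L2_def)
qed

lemma edge_integral_nonneg: "0 \<le> edge_integral e (\<lambda>x. (f x)\<^sup>2)"
  unfolding edge_integral_def edge_length_def set_lebesgue_integral_def
  by (intro mult_nonneg_nonneg integral_nonneg_AE) auto

lemma edge_integral_combination:
  assumes e: "e \<in> set (edges P)" and f: "continuous_on (boundary P) f" "continuous_on (boundary P) g"
  shows "edge_integral e (\<lambda>x. a * f x + b * g x) = a * edge_integral e f + b * edge_integral e g"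
proof -
  obtain p q where pq: "e = (p, q)" by fastforce
  have "integral {0..1} (\<lambda>t. a * f (linepath p q t) + b * g (linepath p q t)) =
      integral {0..1} (\<lambda>t. a * f (linepath p q t)) + integral {0..1} (\<lambda>t. b * g (linepath p q t))"
    using e f unfolding pq
    by (intro integral_add integrable_continuous_real continuous_on_mult_left continuous_on_edge)
  then show ?thesis
    using e f unfolding pq
    by (simp add: edge_integral_eq continuous_intros algebra_simps)
qed

text \<open>The parallelogram law again, on an edge; continuity on the boundary ensures that all
  integrals split.\<close>

lemma edge_integral_square_combination_le:
  assumes e: "e \<in> set (edges P)" and f: "continuous_on (boundary P) f" "continuous_on (boundary P) g"
  shows "edge_integral e (\<lambda>x. (a * f x + b * g x)\<^sup>2)
    \<le> 2 * a\<^sup>2 * edge_integral e (\<lambda>x. (f x)\<^sup>2) + 2 * b\<^sup>2 * edge_integral e (\<lambda>x. (g x)\<^sup>2)"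
proof -
  have "(\<lambda>x. (2 * a\<^sup>2) * (f x)\<^sup>2 + (2 * b\<^sup>2) * (g x)\<^sup>2)
      = (\<lambda>x. 1 * (a * f x + b * g x)\<^sup>2 + 1 * (a * f x - b * g x)\<^sup>2)"
    by (auto simp: power2_eq_square algebra_simps)
  then have "2 * a\<^sup>2 * edge_integral e (\<lambda>x. (f x)\<^sup>2) + 2 * b\<^sup>2 * edge_integral e (\<lambda>x. (g x)\<^sup>2)
      = 1 * edge_integral e (\<lambda>x. (a * f x + b * g x)\<^sup>2) + 1 * edge_integral e (\<lambda>x. (a * f x - b * g x)\<^sup>2)"
    using e f
    by (subst (1 2) edge_integral_combination[symmetric]) (auto intro!: continuous_intros)
  then show ?thesis
    using edge_integral_nonneg[of e "\<lambda>x. a * f x - b * g x"] by linarith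
qed

lemma edge_integral_tendsto_combination:
  assumes e: "e \<in> set (edges P)"
    and f: "\<And>j. continuous_on (boundary P) (f j)" "\<And>j. continuous_on (boundary P) (g j)"
    and lim: "(\<lambda>j. edge_integral e (\<lambda>x. (f j x)\<^sup>2)) \<longlonglongrightarrow> 0" "(\<lambda>j. edge_integral e (\<lambda>x. (g j x)\<^sup>2)) \<longlonglongrightarrow> 0"
  shows "(\<lambda>j. edge_integral e (\<lambda>x. (a * f j x + b * g j x)\<^sup>2)) \<longlonglongrightarrow> 0"
proof (rule tendsto_sandwich[of "\<lambda>_. 0"])
  show "(\<lambda>j. 2 * a\<^sup>2 * edge_integral e (\<lambda>x. (f j x)\<^sup>2) + 2 * b\<^sup>2 * edge_integral e (\<lambda>x. (g j x)\<^sup>2)) \<longlonglongrightarrow> 0"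
    using lim by (auto intro!: tendsto_eq_intros)
qed (use edge_integral_square_combination_le[OF e f] edge_integral_nonneg in \<open>auto intro!: always_eventually\<close>)

text \<open>Near an interior point of an edge, the local trace inequality makes
  \<open>\<phi> j\<close> tend to zero in mean square, but it also tends to \<open>g\<close>; so the
  continuous function \<open>g\<close> vanishes there. The ends of the edge follow by continuity,
  which is why the constant may depend on the point.\<close>

lemma trace_of_null_sequence:
  assumes \<phi>: "\<And>j. smooth (\<phi> j)" "(\<lambda>j. l2_norm (cell P) (\<phi> j)) \<longlonglongrightarrow> 0"
      "(\<lambda>j. l2_norm (cell P) (grad (\<phi> j))) \<longlonglongrightarrow> 0"
    and g: "continuous_on (boundary P) g"
    and e: "e \<in> set (edges P)" and lim: "(\<lambda>j. edge_integral e (\<lambda>x. (\<phi> j x - g x)\<^sup>2)) \<longlonglongrightarrow> 0"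
    and z: "z \<in> edge_set e"
  shows "g z = 0"
proof -
  obtain p q where pq: "e = (p, q)" by fastforce
  note e' = e[unfolded pq]
  have pos: "0 < dist p q" using edge_nondegenerate[OF e] by (simp add: pq)
  define l where "l = linepath p q"
  have contg: "continuous_on {0..1} (\<lambda>t. g (l t))"
    unfolding l_def by (rule continuous_on_edge[OF e' g])
  have cont\<phi>: "continuous_on S (\<lambda>t. \<phi> j (l t))" for j S
    unfolding l_def linepath_def
    by (intro continuous_on_compose2[OF smooth_continuous_on[OF \<phi>(1), of UNIV]] continuous_intros) auto
  have interior: "g (l s0) = 0" if s0: "s0 \<in> {0<..<1}" for s0
  proof -
    obtain \<eta> C where \<eta>: "0 < \<eta>" "\<eta> < s0" "\<eta> < 1 - s0"
      and C: "\<And>\<phi>. smooth \<phi> \<Longrightarrow> integral {s0 - \<eta>..s0 + \<eta>} (\<lambda>s. (\<phi> (p + s *\<^sub>R (q - p)))\<^sup>2)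
       \<le> C * (l2_inner (cell P) \<phi> \<phi> + (norm (q - p))\<^sup>2 * l2_inner (cell P) (grad \<phi>) (grad \<phi>))"
      using trace_inequality_local[OF e', of s0] s0 by auto
    let ?I = "{s0 - \<eta>..s0 + \<eta>}"
    have I: "?I \<subseteq> {0..1}" using \<eta> by auto
    have contgI: "continuous_on ?I (\<lambda>t. g (l t))"
      by (rule continuous_on_subset[OF contg I])
    define A where "A j = C * (l2_inner (cell P) (\<phi> j) (\<phi> j) + (norm (q - p))\<^sup>2 * l2_inner (cell P) (grad (\<phi> j)) (grad (\<phi> j)))" for j
    define B where "B j = edge_integral e (\<lambda>x. (\<phi> j x - g x)\<^sup>2)" for j
    have "A \<longlonglongrightarrow> C * (0 + (norm (q - p))\<^sup>2 * 0)"
      unfolding A_def using \<phi>(2,3) unfolding l2_inner_tendsto_0_iff by (intro tendsto_intros)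
    moreover have "B \<longlonglongrightarrow> 0" using lim unfolding B_def .
    ultimately have lim0: "(\<lambda>j. 2 * A j + 2 * (B j / dist p q)) \<longlonglongrightarrow> 2 * (C * (0 + (norm (q - p))\<^sup>2 * 0)) + 2 * (0 / dist p q)"
      using pos by (intro tendsto_intros) auto
    have "integral ?I (\<lambda>s. (g (l s))\<^sup>2) \<le> 2 * A j + 2 * (B j / dist p q)" for j
    proof -
      have int: "(\<lambda>s. (\<phi> j (l s))\<^sup>2) integrable_on ?I" "(\<lambda>s. (\<phi> j (l s) - g (l s))\<^sup>2) integrable_on ?I"
        "(\<lambda>s. (\<phi> j (l s) - g (l s))\<^sup>2) integrable_on {0..1}" "(\<lambda>s. (g (l s))\<^sup>2) integrable_on ?I"
        by (intro integrable_continuous_real continuous_intros cont\<phi> contgI contg)+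
      have "integral ?I (\<lambda>s. (g (l s))\<^sup>2) \<le> integral ?I (\<lambda>s. 2 * (\<phi> j (l s))\<^sup>2 + 2 * (\<phi> j (l s) - g (l s))\<^sup>2)"
      proof (intro integral_le integrable_add integrable_on_mult_right int)
        fix s
        \<comment> \<open>This square is the right-hand side minus the left-hand side of the
          claim.\<close>
        have "0 \<le> (2 * \<phi> j (l s) - g (l s))\<^sup>2" by simp
        then show "(g (l s))\<^sup>2 \<le> 2 * (\<phi> j (l s))\<^sup>2 + 2 * (\<phi> j (l s) - g (l s))\<^sup>2"
          by (simp add: power2_eq_square algebra_simps)
      qed
      also have "\<dots> = 2 * integral ?I (\<lambda>s. (\<phi> j (l s))\<^sup>2) + 2 * integral ?I (\<lambda>s. (\<phi> j (l s) - g (l s))\<^sup>2)"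
        using int by (subst integral_add) auto
      also have "integral ?I (\<lambda>s. (\<phi> j (l s))\<^sup>2) \<le> A j"
        using C[OF \<phi>(1), of j] by (simp add: A_def l_def edge_parametrization(3)[OF e'])
      also have "integral ?I (\<lambda>s. (\<phi> j (l s) - g (l s))\<^sup>2) \<le> integral {0..1} (\<lambda>s. (\<phi> j (l s) - g (l s))\<^sup>2)"
        using I int by (intro integral_subset_le) auto
      also have "\<dots> = B j / dist p q"
        unfolding B_def pq l_def using pos
        by (subst edge_integral_eq[OF e'])
          (auto intro!: continuous_on_power continuous_on_diff g smooth_continuous_on[OF \<phi>(1)])
      finally show ?thesis by simp
    qed
    then have "integral ?I (\<lambda>s. (g (l s))\<^sup>2) \<le> 0"
      using LIMSEQ_le_const[OF lim0] by auto
    moreover have "0 \<le> integral ?I (\<lambda>s. (g (l s))\<^sup>2)"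
      by (intro integral_nonneg integrable_continuous_real continuous_intros contgI) auto
    ultimately have "integral ?I (\<lambda>s. (g (l s))\<^sup>2) = 0" by simp
    then show ?thesis
      using integral_eq_0_iff[of "s0 - \<eta>" "s0 + \<eta>" "\<lambda>s. (g (l s))\<^sup>2"] \<eta>
        continuous_on_power[OF contgI, of 2] by auto
  qed
  obtain s where s: "s \<in> {0..1}" "z = l s"
    using z by (auto simp: pq edge_set_def l_def linepath_image_01[symmetric])
  have "g (l s) = 0"
    by (rule continuous_constant_on_closure[of "{0<..<1}" "\<lambda>t. g (l t)"]) (use contg interior s in auto)
  with s show ?thesis by simp
qed

lemma has_trace_combination:
  assumes v: "has_trace P v g" "has_trace P v' g'"
    and g: "continuous_on (boundary P) g" "continuous_on (boundary P) g'"
  shows "has_trace P (\<lambda>x. a * v x + b * v' x) (\<lambda>x. a * g x + b * g' x)"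
proof -
  obtain \<phi> where \<phi>: "smooth_tends_H1 (cell P) \<phi> v"
    "\<And>e. e \<in> set (edges P) \<Longrightarrow> (\<lambda>j. edge_integral e (\<lambda>x. (\<phi> j x - g x)\<^sup>2)) \<longlonglongrightarrow> 0"
    using v(1) unfolding has_trace_def by blast
  obtain \<phi>' where \<phi>': "smooth_tends_H1 (cell P) \<phi>' v'"
    "\<And>e. e \<in> set (edges P) \<Longrightarrow> (\<lambda>j. edge_integral e (\<lambda>x. (\<phi>' j x - g' x)\<^sup>2)) \<longlonglongrightarrow> 0"
    using v(2) unfolding has_trace_def by blast
  have sob: "v \<in> sobolev (cell P) 1" "v' \<in> sobolev (cell P) 1"
    using v by (auto simp: has_trace_def)
  have sm: "smooth (\<phi> j)" "smooth (\<phi>' j)" for j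
    using \<phi>(1) \<phi>'(1) by (auto simp: smooth_tends_H1_def)
  have "(\<lambda>j. edge_integral e (\<lambda>x. (a * \<phi> j x + b * \<phi>' j x - (a * g x + b * g' x))\<^sup>2)) \<longlonglongrightarrow> 0"
    if e: "e \<in> set (edges P)" for e
  proof -
    have "(\<lambda>j. edge_integral e (\<lambda>x. (a * (\<phi> j x - g x) + b * (\<phi>' j x - g' x))\<^sup>2)) \<longlonglongrightarrow> 0"
      by (intro edge_integral_tendsto_combination continuous_on_diff smooth_continuous_on sm g e \<phi>(2)[OF e] \<phi>'(2)[OF e])
    then show ?thesis by (simp add: algebra_simps)
  qed
  moreover have "smooth_tends_H1 (cell P) (\<lambda>j x. a * \<phi> j x + b * \<phi>' j x) (\<lambda>x. a * v x + b * v' x)"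
    by (rule smooth_tends_H1_combination[OF sob \<phi>(1) \<phi>'(1)])
  moreover have "\<forall>e\<in>set (edges P). (\<lambda>x. a * g x + b * g' x) \<in> edge_L2 e"
    using g by (intro ballI continuous_edge_L2 continuous_intros)
  ultimately show ?thesis
    using sobolev_combination[OF sob] unfolding has_trace_def by blast
qed

text \<open>The weak gradient chosen for the zero function is zero only almost everywhere. Under the
  norm this makes no difference, so the approximating functions form a null sequence together with
  their gradients.\<close>

lemma has_trace_zero:
  assumes "has_trace P (\<lambda>x. 0) g" "continuous_on (boundary P) g" "z \<in> boundary P"
  shows "g z = 0"
proof -
  obtain \<phi> where \<phi>: "smooth_tends_H1 (cell P) \<phi> (\<lambda>x. 0)"
    "\<And>e. e \<in> set (edges P) \<Longrightarrow> (\<lambda>j. edge_integral e (\<lambda>x. (\<phi> j x - g x)\<^sup>2)) \<longlonglongrightarrow> 0"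
    using assms(1) unfolding has_trace_def by blast
  have sm: "smooth (\<phi> j)" for j
    using \<phi>(1) by (auto simp: smooth_tends_H1_def)
  have "grad (\<lambda>x. 0) x = 0" for x
    by (simp add: grad_def vec_eq_iff)
  then have AE: "AE x in lebesgue. x \<in> cell P \<longrightarrow> weak_grad (cell P) (\<lambda>x. 0) x = 0"
    using weak_grad_smooth[OF smooth_const[of 0]] by simp
  have "l2_norm (cell P) (\<lambda>x. grad (\<phi> j) x - weak_grad (cell P) (\<lambda>x. 0) x) = l2_norm (cell P) (grad (\<phi> j))" for j
  proof (rule l2_norm_cong_AE)
    show "AE x in lebesgue. x \<in> cell P \<longrightarrow> grad (\<phi> j) x - weak_grad (cell P) (\<lambda>x. 0) x = grad (\<phi> j) x"
      using AE by eventually_elim simp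
  qed (intro L2_diff grad_L2 sm weak_grad_L2 smooth_sobolev_1 smooth_const)+
  with \<phi>(1) have "(\<lambda>j. l2_norm (cell P) (\<phi> j)) \<longlonglongrightarrow> 0" "(\<lambda>j. l2_norm (cell P) (grad (\<phi> j))) \<longlonglongrightarrow> 0"
    by (auto simp: smooth_tends_H1_def)
  moreover obtain e where "e \<in> set (edges P)" "z \<in> edge_set e"
    using assms(3) by (auto simp: boundary_def)
  ultimately show ?thesis
    using trace_of_null_sequence[of \<phi> g e z] sm \<phi>(2) assms(2) by blast
qed

lemma has_trace_unique:
  assumes "has_trace P v g" "has_trace P v g'"
    and "continuous_on (boundary P) g" "continuous_on (boundary P) g'" and "z \<in> boundary P"
  shows "g z = g' z"
proof -
  have "has_trace P (\<lambda>x. 1 * v x + (-1) * v x) (\<lambda>x. 1 * g x + (-1) * g' x)"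
    by (rule has_trace_combination[OF assms(1-4)])
  then have "has_trace P (\<lambda>x. 0) (\<lambda>x. g x - g' x)" by simp
  from has_trace_zero[OF this _ assms(5)] assms(3,4) show ?thesis
    by (simp add: continuous_intros)
qed

lemma smooth_has_trace:
  assumes "smooth p"
  shows "has_trace P p p"
  unfolding has_trace_def
proof (intro conjI exI[of _ "\<lambda>j. p"] ballI)
  show "(\<lambda>j. edge_integral e (\<lambda>x. (p x - p x)\<^sup>2)) \<longlonglongrightarrow> 0" for e
    by (simp add: edge_integral_def)
  show "p \<in> sobolev (cell P) 1" "smooth_tends_H1 (cell P) (\<lambda>j. p) p"
    by (intro smooth_sobolev_1 smooth_tends_H1_const assms)+
  show "p \<in> edge_L2 e" if "e \<in> set (edges P)" for e
    by (intro continuous_edge_L2 that smooth_continuous_on assms)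
qed

end

text \<open>A linear domain for boundary values and degrees of freedom. It contains the local space
  and the polynomials, hence also the differences \<open>v - Pi1 P k v\<close> and
  \<open>v - Pi0 P k v\<close> at which the bilinear forms evaluate the degrees of freedom.\<close>

definition traceable :: "polygon \<Rightarrow> (real^2 \<Rightarrow> real) set" where
  "traceable P = {v. \<exists>g. continuous_on (boundary P) g \<and> has_trace P v g}"

lemma bdry_val:
  assumes "v \<in> traceable P"
  shows "continuous_on (boundary P) (bdry_val P v)" "has_trace P v (bdry_val P v)"
  using someI_ex[of "\<lambda>g. continuous_on (boundary P) g \<and> has_trace P v g"] assms
  by (auto simp: traceable_def bdry_val_def)

lemma traceable_sobolev: "v \<in> traceable P \<Longrightarrow> v \<in> sobolev (cell P) 1"
  by (auto simp: traceable_def has_trace_def)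

lemma traceable_L2: "v \<in> traceable P \<Longrightarrow> v \<in> L2 (cell P)"
  by (rule sobolev_L2[OF traceable_sobolev])

context polygon
begin

lemma traceable_combination:
  "v \<in> traceable P \<Longrightarrow> v' \<in> traceable P \<Longrightarrow> (\<lambda>x. a * v x + b * v' x) \<in> traceable P"
proof -
  assume "v \<in> traceable P" "v' \<in> traceable P"
  then obtain g g' where g: "continuous_on (boundary P) g" "has_trace P v g"
    "continuous_on (boundary P) g'" "has_trace P v' g'" unfolding traceable_def by blast
  have "continuous_on (boundary P) (\<lambda>x. a * g x + b * g' x)"
    by (intro continuous_intros g)
  with has_trace_combination[OF g(2,4,1,3), of a b] show ?thesis
    unfolding traceable_def by blast
qed

lemma smooth_traceable: "smooth p \<Longrightarrow> p \<in> traceable P"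
  unfolding traceable_def using smooth_has_trace smooth_continuous_on by blast

text \<open>Holds at every boundary point, as the vertex values require: both sides are continuous
  traces of the same function.\<close>

lemma bdry_val_combination:
  assumes "v \<in> traceable P" "v' \<in> traceable P" "z \<in> boundary P"
  shows "bdry_val P (\<lambda>x. a * v x + b * v' x) z = a * bdry_val P v z + b * bdry_val P v' z"
  using bdry_val[OF traceable_combination[OF assms(1,2)], of a b] bdry_val[OF assms(1)] bdry_val[OF assms(2)]
  by (intro has_trace_unique[OF _ has_trace_combination]) (auto intro!: continuous_intros assms)

lemma bdry_val_smooth: "smooth p \<Longrightarrow> z \<in> boundary P \<Longrightarrow> bdry_val P p z = p z"
  using bdry_val[OF smooth_traceable] smooth_has_trace smooth_continuous_on has_trace_unique by blast

end

section \<open>Polynomials\<close>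

definition powers :: "nat \<Rightarrow> nat \<Rightarrow> real^2 \<Rightarrow> real" where
  "powers a b x = x $ 1 ^ a * x $ 2 ^ b"

inductive_set fspan :: "('a \<Rightarrow> real) set \<Rightarrow> ('a \<Rightarrow> real) set" for S where
  zero: "(\<lambda>x. 0) \<in> fspan S"
| step: "f \<in> fspan S \<Longrightarrow> s \<in> S \<Longrightarrow> (\<lambda>x. f x + a * s x) \<in> fspan S"

lemma fspan_add: "g \<in> fspan S \<Longrightarrow> f \<in> fspan S \<Longrightarrow> (\<lambda>x. f x + g x) \<in> fspan S"
proof (induction rule: fspan.induct)
  case (step g s a)
  then have "(\<lambda>x. (f x + g x) + a * s x) \<in> fspan S" by (intro fspan.step)
  then show ?case by (simp add: add.assoc)
qed simp

lemma fspan_scale: "f \<in> fspan S \<Longrightarrow> (\<lambda>x. c * f x) \<in> fspan S"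
proof (induction rule: fspan.induct)
  case (step g s a)
  then have "(\<lambda>x. c * g x + (c * a) * s x) \<in> fspan S" by (intro fspan.step)
  then show ?case by (simp add: algebra_simps)
qed (simp add: fspan.zero)

lemma fspan_mono: "f \<in> fspan S \<Longrightarrow> S \<subseteq> S' \<Longrightarrow> f \<in> fspan S'"
  by (induction rule: fspan.induct) (auto intro: fspan.intros)

lemma fspan_generator: "s \<in> S \<Longrightarrow> s \<in> fspan S"
  using fspan.step[OF fspan.zero, of s S 1] by simp

lemma fspan_sum: "(\<And>i. i \<in> I \<Longrightarrow> f i \<in> fspan S) \<Longrightarrow> (\<lambda>x. \<Sum>i\<in>I. f i x) \<in> fspan S"
  by (induction I rule: infinite_finite_induct) (auto intro: fspan.zero fspan_add)

text \<open>Covers the forms behind both projections. Definiteness is asked in the form that there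
  are no isotropic vectors, which with symmetry is enough to orthogonalise.\<close>

locale definite_form =
  fixes V :: "('a \<Rightarrow> real) set" and B :: "('a \<Rightarrow> real) \<Rightarrow> ('a \<Rightarrow> real) \<Rightarrow> real"
  assumes zero: "(\<lambda>x. 0) \<in> V"
    and comb: "f \<in> V \<Longrightarrow> g \<in> V \<Longrightarrow> (\<lambda>x. a * f x + b * g x) \<in> V"
    and left: "f \<in> V \<Longrightarrow> g \<in> V \<Longrightarrow> h \<in> V \<Longrightarrow> B (\<lambda>x. a * f x + b * g x) h = a * B f h + b * B g h"
    and sym: "f \<in> V \<Longrightarrow> g \<in> V \<Longrightarrow> B f g = B g f"
    and definite: "f \<in> V \<Longrightarrow> B f f = 0 \<Longrightarrow> f = (\<lambda>x. 0)"
begin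

definition linear_functional :: "(('a \<Rightarrow> real) \<Rightarrow> real) \<Rightarrow> bool" where
  "linear_functional L \<longleftrightarrow> (\<forall>f\<in>V. \<forall>g\<in>V. \<forall>a b. L (\<lambda>x. a * f x + b * g x) = a * L f + b * L g)"

lemma linear_functionalD:
  "linear_functional L \<Longrightarrow> f \<in> V \<Longrightarrow> g \<in> V \<Longrightarrow> L (\<lambda>x. a * f x + b * g x) = a * L f + b * L g"
  by (simp add: linear_functional_def)

lemma right:
  assumes "f \<in> V" "g \<in> V" "h \<in> V"
  shows "B h (\<lambda>x. a * f x + b * g x) = a * B h f + b * B h g"
  using left[OF assms] sym comb assms by metis

lemma linear_functional_B: "h \<in> V \<Longrightarrow> linear_functional (B h)"
  by (simp add: linear_functional_def right)

lemma fspan_subset: "f \<in> fspan S \<Longrightarrow> S \<subseteq> V \<Longrightarrow> f \<in> V"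
proof (induction rule: fspan.induct)
  case (step f s a)
  then show ?case using comb[of f s 1 a] by auto
qed (auto simp: zero)

lemma functional_zero: "linear_functional L \<Longrightarrow> L (\<lambda>x. 0) = 0"
  using linear_functionalD[of L "\<lambda>x. 0" "\<lambda>x. 0" 0 0] zero by simp

lemma functionals_agree_on_fspan:
  assumes "S \<subseteq> V" "linear_functional L" "linear_functional M" "\<And>s. s \<in> S \<Longrightarrow> L s = M s" and "f \<in> fspan S"
  shows "L f = M f"
  using assms(5)
proof (induction rule: fspan.induct)
  case zero
  then show ?case using assms by (simp add: functional_zero)
next
  case (step f s a)
  then have "f \<in> V" "s \<in> V" using assms(1) fspan_subset by auto
  with step.IH step.hyps assms(4) linear_functionalD[OF assms(2), of f s 1 a] linear_functionalD[OF assms(3), of f s 1 a]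
  show ?case by simp
qed

text \<open>Gram-Schmidt by induction on the generators: a new generator \<open>e\<close> splits
  into its projection \<open>r\<close> onto the old span and a remainder \<open>w\<close> orthogonal
  to it. Generators may be dependent; then \<open>w\<close> is zero and the old solution remains
  valid.\<close>

lemma riesz_fspan:
  assumes "finite S" "S \<subseteq> V" "linear_functional L"
  shows "\<exists>p\<in>fspan S. \<forall>q\<in>fspan S. B p q = L q"
proof -
  have "\<exists>p\<in>fspan S. \<forall>s\<in>S. B p s = L s"
    using assms
  proof (induction S arbitrary: L rule: finite_induct)
    case empty
    then show ?case using fspan.zero by blast
  next
    case (insert e S)
    then have SV: "S \<subseteq> V" "e \<in> V" by auto
    obtain p where p: "p \<in> fspan S" "\<forall>s\<in>S. B p s = L s"
      using insert.IH[OF SV(1) insert.prems(2)] by blast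
    \<comment> \<open>The induction hypothesis for another functional, \<open>B e\<close>, yields
      the orthogonal projection of \<open>e\<close>.\<close>
    obtain r where r: "r \<in> fspan S" "\<forall>s\<in>S. B r s = B e s"
      using insert.IH[OF SV(1) linear_functional_B[OF SV(2)]] by blast
    have pV: "p \<in> V" and rV: "r \<in> V" using p r SV fspan_subset by auto
    define w where "w = (\<lambda>x. 1 * e x + (-1) * r x)"
    have wV: "w \<in> V" unfolding w_def using SV rV by (intro comb)
    have wS: "B w s = 0" if "s \<in> S" for s
      using left[of e r s 1 "-1"] SV rV r that by (auto simp: w_def)
    have wr: "B w r = 0"
      using functionals_agree_on_fspan[OF SV(1) linear_functional_B[OF wV], of "\<lambda>_. 0" r] wS r
      by (auto simp: linear_functional_def)
    have we: "B w w = B w e"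
      using right[of e r w 1 "-1"] SV rV wV wr by (simp add: w_def)
    show ?case
    proof (cases "B w w = 0")
      case True
      then have "w = (\<lambda>x. 0)" using definite wV by blast
      then have "e = r" by (auto simp: w_def fun_eq_iff)
      then have "B p e = L e"
        using functionals_agree_on_fspan[OF SV(1) linear_functional_B[OF pV] insert.prems(2)] p(2) r(1) by auto
      with p show ?thesis using fspan_mono[of p S "insert e S"] by auto
    next
      case False
      \<comment> \<open>Adding a multiple of \<open>w\<close> changes only the equation for
        \<open>e\<close>, and \<open>\<alpha>\<close> makes that one hold. The denominator equals
        \<open>B w w\<close>, which is nonzero here.\<close>
      define \<alpha> where "\<alpha> = (L e - B p e) / B w e"
      have "w \<in> fspan (insert e S)"
        unfolding w_def
        by (intro fspan_add fspan_scale fspan_generator fspan_mono[OF r(1)]) auto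
      then have "(\<lambda>x. 1 * p x + \<alpha> * w x) \<in> fspan (insert e S)"
        by (intro fspan_add fspan_scale fspan_mono[OF p(1)]) auto
      moreover have "B (\<lambda>x. 1 * p x + \<alpha> * w x) s = L s" if "s \<in> insert e S" for s
        using left[of p w s 1 \<alpha>] pV wV SV that p(2) wS False we by (auto simp: \<alpha>_def)
      ultimately show ?thesis by blast
    qed
  qed
  then obtain p where p: "p \<in> fspan S" "\<forall>s\<in>S. B p s = L s" by blast
  then have "linear_functional (B p)" using linear_functional_B fspan_subset assms(2) by blast
  then show ?thesis
    using functionals_agree_on_fspan[OF assms(2) _ assms(3)] p by blast
qed

lemma riesz_unique:
  assumes "finite S" "V = fspan S" "linear_functional L"
  shows "\<exists>!p. p \<in> V \<and> (\<forall>q\<in>V. B p q = L q)"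
proof (rule ex_ex1I)
  have "S \<subseteq> V" using assms(2) fspan_generator by blast
  then show "\<exists>p. p \<in> V \<and> (\<forall>q\<in>V. B p q = L q)"
    using riesz_fspan[OF assms(1) _ assms(3)] assms(2) by blast
  fix p p' assume p: "p \<in> V \<and> (\<forall>q\<in>V. B p q = L q)" and p': "p' \<in> V \<and> (\<forall>q\<in>V. B p' q = L q)"
  let ?w = "\<lambda>x. 1 * p x + (-1) * p' x"
  have w: "?w \<in> V" using p p' by (intro comb) auto
  have "B ?w ?w = 1 * B p ?w + (-1) * B p' ?w" using p p' w by (intro left) auto
  also have "\<dots> = 0" using p p' w by simp
  finally have "?w = (\<lambda>x. 0)" by (intro definite w)
  then show "p = p'" by (simp add: fun_eq_iff)
qed

end

section \<open>Polynomials in two variables and their rigidity\<close>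

lemma polys_combination:
  assumes "p \<in> polys k" "q \<in> polys k"
  shows "(\<lambda>x. a * p x + b * q x) \<in> polys k"
proof -
  obtain c d where "\<forall>x. p x = (\<Sum>i\<le>k. \<Sum>j\<le>k - i. c i j * (x $ 1) ^ i * (x $ 2) ^ j)"
    "\<forall>x. q x = (\<Sum>i\<le>k. \<Sum>j\<le>k - i. d i j * (x $ 1) ^ i * (x $ 2) ^ j)"
    using assms unfolding polys_def by blast
  then show ?thesis
    unfolding polys_def
    by (intro CollectI exI[of _ "\<lambda>i j. a * c i j + b * d i j"])
      (simp add: sum_distrib_left distrib_right sum.distrib mult.assoc)
qed

lemma powers_in_polys:
  assumes "a + b \<le> k"
  shows "powers a b \<in> polys k"
proof -
  have "powers a b x = (\<Sum>i\<le>k. \<Sum>j\<le>k - i. (if i = a \<and> j = b then 1 else 0) * (x $ 1) ^ i * (x $ 2) ^ j)" for x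
  proof -
    have "(\<Sum>j\<le>k - i. (if i = a \<and> j = b then 1 else 0) * (x $ 1) ^ i * (x $ 2) ^ j) = (if i = a then powers a b x else 0)"
      if "i \<le> k" for i
    proof -
      have "(\<Sum>j\<le>k - i. (if i = a \<and> j = b then 1 else 0) * (x $ 1) ^ i * (x $ 2) ^ j)
          = (\<Sum>j\<le>k - i. if j = b then if i = a then powers a b x else 0 else 0)"
        by (intro sum.cong refl) (simp add: powers_def)
      moreover have "b \<le> k - a" using assms by simp
      ultimately show ?thesis by (cases "i = a") auto
    qed
    then show ?thesis using assms by simp
  qed
  then show ?thesis
    unfolding polys_def by (intro CollectI exI[of _ "\<lambda>i j. if i = a \<and> j = b then 1 else 0"] allI)
qed

lemma polys_const: "(\<lambda>x. r) \<in> polys k"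
  using polys_combination[OF powers_in_polys[of 0 0 k] powers_in_polys[of 0 0 k], of r 0] by (simp add: powers_def)

lemma polys_eq_fspan: "polys k = fspan {powers a b |a b. a + b \<le> k}" (is "_ = fspan ?S")
proof
  show "fspan ?S \<subseteq> polys k"
  proof
    fix f assume "f \<in> fspan ?S"
    then show "f \<in> polys k"
    proof (induction rule: fspan.induct)
      case (step f s a)
      then show ?case using polys_combination[of f k s 1 a] powers_in_polys by auto
    qed (rule polys_const)
  qed
  show "polys k \<subseteq> fspan ?S"
  proof
    fix p assume "p \<in> polys k"
    then obtain c where "\<forall>x. p x = (\<Sum>i\<le>k. \<Sum>j\<le>k - i. c i j * (x $ 1) ^ i * (x $ 2) ^ j)"
      unfolding polys_def by blast
    then have "p = (\<lambda>x. \<Sum>i\<le>k. \<Sum>j\<le>k - i. c i j * powers i j x)"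
      by (auto simp: powers_def mult.assoc)
    also have "\<dots> \<in> fspan ?S"
    proof (intro fspan_sum fspan_scale fspan_generator)
      fix i j assume "i \<in> {..k}" "j \<in> {..k - i}"
      then have "i + j \<le> k" by simp
      then show "powers i j \<in> ?S" by blast
    qed
    finally show "p \<in> fspan ?S" .
  qed
qed

lemma finite_powers: "finite {powers a b |a b. a + b \<le> k}"
proof -
  have "{powers a b |a b. a + b \<le> k} \<subseteq> (\<lambda>(a, b). powers a b) ` ({..k} \<times> {..k})" by auto
  then show ?thesis by (rule finite_subset) auto
qed

lemma polys_smooth: "p \<in> polys k \<Longrightarrow> smooth p"
proof -
  assume "p \<in> polys k"
  then obtain c where "\<forall>x. p x = (\<Sum>i\<le>k. \<Sum>j\<le>k - i. c i j * (x $ 1) ^ i * (x $ 2) ^ j)"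
    unfolding polys_def by blast
  then have "p = (\<lambda>x. \<Sum>i\<le>k. \<Sum>j\<le>k - i. c i j * (x $ 1) ^ i * (x $ 2) ^ j)" by auto
  then show ?thesis
    by (simp only:) (intro smooth_sum smooth_mult smooth_power smooth_const smooth_coord)
qed

lemma polys_on_line:
  assumes "p \<in> polys k"
  obtains q :: "real poly" where "\<And>t. p (x + t *\<^sub>R d) = poly q t"
proof -
  obtain c where c: "\<forall>x. p x = (\<Sum>i\<le>k. \<Sum>j\<le>k - i. c i j * (x $ 1) ^ i * (x $ 2) ^ j)"
    using assms unfolding polys_def by blast
  show ?thesis
    by (rule that[of "\<Sum>i\<le>k. \<Sum>j\<le>k - i. [:c i j:] * [:x $ 1, d $ 1:] ^ i * [:x $ 2, d $ 2:] ^ j"])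
      (simp add: c poly_sum mult.assoc)
qed

text \<open>The line from a point of \<open>D\<close> to an arbitrary point reduces the claim to a
  polynomial in one variable with infinitely many zeros. It turns uniqueness on a cell into equality
  of functions on the whole plane.\<close>

lemma polys_zero_on_open:
  assumes p: "p \<in> polys k" and D: "open D" "D \<noteq> {}" "\<And>x. x \<in> D \<Longrightarrow> p x = 0"
  shows "p = (\<lambda>x. 0)"
proof
  fix y
  obtain x where x: "x \<in> D" using D by blast
  obtain q :: "real poly" where q: "\<And>t. p (x + t *\<^sub>R (y - x)) = poly q t"
    using polys_on_line[OF p] by metis
  have "open ((\<lambda>t. x + t *\<^sub>R (y - x)) -` D)"
    by (intro open_vimage D continuous_intros)
  moreover have "0 \<in> (\<lambda>t. x + t *\<^sub>R (y - x)) -` D" using x by simp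
  ultimately have "infinite ((\<lambda>t. x + t *\<^sub>R (y - x)) -` D)"
    using finite_imp_not_open by blast
  moreover have "(\<lambda>t. x + t *\<^sub>R (y - x)) -` D \<subseteq> {t. poly q t = 0}"
    using D(3) by (auto simp flip: q)
  ultimately have "infinite {t. poly q t = 0}" using finite_subset by blast
  then have "q = 0" using poly_roots_finite by blast
  with q[of 1] show "p y = 0" by simp
qed

text \<open>A ball in \<open>D\<close> is convex, so \<open>p\<close> is constant on it; the
  identity principle \<open>polys_zero_on_open\<close> extends this to the plane.\<close>

lemma polys_constant_if_grad_zero:
  assumes p: "p \<in> polys k" and D: "open D" "D \<noteq> {}" "\<And>x. x \<in> D \<Longrightarrow> grad p x = 0"
  obtains c where "p = (\<lambda>x. c)"
proof -
  obtain x r where x: "0 < r" "ball x r \<subseteq> D" using D by (metis open_contains_ball ex_in_conv)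
  have "(p has_derivative (\<lambda>h. 0)) (at y within ball x r)" if y: "y \<in> ball x r" for y
  proof -
    interpret linear "frechet_derivative p (at y)"
      by (rule linear_frechet_derivative[OF smooth_differentiable[OF polys_smooth[OF p]]])
    have "frechet_derivative p (at y) h = 0" for h
    proof -
      have "h = (h $ 1) *\<^sub>R axis 1 1 + (h $ 2) *\<^sub>R axis 2 1"
        by (auto simp: vec_eq_iff forall_2 axis_def)
      then have "frechet_derivative p (at y) h = h $ 1 * partial 1 p y + h $ 2 * partial 2 p y"
        unfolding partial_def by (metis add scaleR real_scaleR_def)
      also have "\<dots> = h $ 1 * grad p y $ 1 + h $ 2 * grad p y $ 2" by (simp add: grad_def)
      finally show ?thesis using D(3) x y by auto
    qed
    then have "frechet_derivative p (at y) = (\<lambda>h. 0)" by auto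
    then show ?thesis
      using smooth_has_derivative[OF polys_smooth[OF p], of y] has_derivative_at_withinI by metis
  qed
  from has_derivative_zero_constant[OF convex_ball this]
  obtain c where c: "\<forall>y\<in>ball x r. p y = c" by blast
  have "(\<lambda>x. 1 * p x + (-1) * c) = (\<lambda>x. 0)"
    by (rule polys_zero_on_open[OF polys_combination[OF p polys_const] open_ball[of x r]]) (use c x in auto)
  then show ?thesis using that[of c] by (auto simp: fun_eq_iff)
qed

text \<open>Vanishing almost everywhere becomes vanishing everywhere in \<open>D\<close>, since the
  zero set is closed and \<open>D\<close> is open.\<close>

lemma (in bounded_open) l2_inner_self_eq_0:
  fixes f :: "real^2 \<Rightarrow> 'a::euclidean_space"
  assumes "continuous_on UNIV f" "l2_inner D f f = 0" "x \<in> D"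
  shows "f x = 0"
proof -
  have "integrable lebesgue (\<lambda>x. indicator D x *\<^sub>R (f x \<bullet> f x))"
    using L2_inner_integrable[OF continuous_L2[OF assms(1)] continuous_L2[OF assms(1)]] by (simp add: set_integrable_def)
  then have "AE x in lebesgue. indicator D x *\<^sub>R (f x \<bullet> f x) = 0"
    using assms(2) unfolding l2_inner_def set_lebesgue_integral_def
    by (subst (asm) integral_nonneg_eq_0_iff_AE) auto
  then have "AE x in lebesgue. x \<in> D \<longrightarrow> x \<in> {x. f x = 0}"
    by eventually_elim (auto simp: indicator_def)
  moreover have "closed {x. f x = 0}"
    using continuous_closed_preimage_constant[OF assms(1) closed_UNIV, of 0] by simp
  ultimately show ?thesis
    using mem_closed_if_AE_lebesgue_open[OF open_D] assms(3) by blast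
qed


section \<open>Projections and degrees of freedom\<close>

context polygon
begin

lemma polys_L2: "p \<in> polys k \<Longrightarrow> p \<in> L2 (cell P)"
  by (intro smooth_L2 polys_smooth)

lemma grad_polys_L2: "p \<in> polys k \<Longrightarrow> grad p \<in> L2 (cell P)"
  by (intro grad_L2 polys_smooth)

lemma definite_form_l2: "definite_form (polys k) (l2_inner (cell P))"
proof
  fix f assume f: "f \<in> polys k" "l2_inner (cell P) f f = 0"
  show "f = (\<lambda>x. 0)"
    using l2_inner_self_eq_0[OF smooth_continuous_on[OF polys_smooth[OF f(1)]] f(2)]
    by (intro polys_zero_on_open[OF f(1) open_cell cell_nonempty])
qed (auto intro: polys_const polys_combination l2_inner_combination_left polys_L2 l2_inner_commute)

definition is_Pi0 :: "nat \<Rightarrow> (real^2 \<Rightarrow> real) \<Rightarrow> (real^2 \<Rightarrow> real) \<Rightarrow> bool" where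
  "is_Pi0 k v p \<longleftrightarrow> p \<in> polys k \<and> (\<forall>q\<in>polys k. l2_inner (cell P) p q = l2_inner (cell P) v q)"

lemma Pi0_unique:
  assumes "v \<in> L2 (cell P)"
  shows "\<exists>!p. is_Pi0 k v p"
proof -
  interpret definite_form "polys k" "l2_inner (cell P)" by (rule definite_form_l2)
  have "linear_functional (l2_inner (cell P) v)"
    unfolding linear_functional_def using assms by (auto intro!: l2_inner_combination_right polys_L2)
  from riesz_unique[OF finite_powers polys_eq_fspan this] show ?thesis
    by (simp add: is_Pi0_def)
qed

lemma Pi0_is_Pi0: "v \<in> L2 (cell P) \<Longrightarrow> is_Pi0 k v (Pi0 P k v)"
  using theI'[OF Pi0_unique] unfolding Pi0_def is_Pi0_def by simp

lemma Pi0_polys: "v \<in> L2 (cell P) \<Longrightarrow> Pi0 P k v \<in> polys k"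
  using Pi0_is_Pi0 by (auto simp: is_Pi0_def)

text \<open>The combination of the projections satisfies the defining equations, whose solution is
  unique as a polynomial; hence equality on the whole plane.\<close>

lemma Pi0_combination:
  assumes "v \<in> L2 (cell P)" "v' \<in> L2 (cell P)"
  shows "Pi0 P k (\<lambda>x. a * v x + b * v' x) = (\<lambda>x. a * Pi0 P k v x + b * Pi0 P k v' x)"
proof -
  have "is_Pi0 k (\<lambda>x. a * v x + b * v' x) (\<lambda>x. a * Pi0 P k v x + b * Pi0 P k v' x)"
    using Pi0_is_Pi0[OF assms(1), of k] Pi0_is_Pi0[OF assms(2), of k] assms
    by (auto simp: is_Pi0_def l2_inner_combination_left polys_L2 intro: polys_combination)
  then show ?thesis
    using Pi0_unique[OF L2_combination[OF assms]] Pi0_is_Pi0[OF L2_combination[OF assms]] by blast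
qed

lemma P0_combination:
  assumes "v \<in> traceable P" "v' \<in> traceable P"
  shows "P0 P k (\<lambda>x. a * v x + b * v' x) = a * P0 P k v + b * P0 P k v'"
proof (cases "k = 1")
  case True
  then show ?thesis
    using assms bdry_val_combination[OF assms vertex_in_boundary]
    by (simp add: P0_def sum.distrib sum_distrib_left add_divide_distrib)
next
  case False
  have "(LINT x:cell P|lebesgue. a * v x + b * v' x) = a * (LINT x:cell P|lebesgue. v x) + b * (LINT x:cell P|lebesgue. v' x)"
    using L2_integrable[OF traceable_L2[OF assms(1)]] L2_integrable[OF traceable_L2[OF assms(2)]] by simp
  with False show ?thesis by (simp add: P0_def algebra_simps add_divide_distrib)
qed

lemma area_pos: "area P > 0"
proof -
  have "\<not> negligible (cell P)"
    using open_not_negligible open_cell cell_nonempty by blast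
  moreover have "cell P \<in> lmeasurable"
    by (intro lmeasurable_open bounded_cell open_cell)
  ultimately show ?thesis
    by (simp add: negligible_iff_measure0 zero_less_measure_iff)
qed

lemma P0_one: "P0 P k (\<lambda>x. 1) = 1"
proof (cases "k = 1")
  case True
  \<comment> \<open>Distinctness gives the sum over \<open>set P\<close> exactly
    \<open>length P\<close> terms.\<close>
  have "P \<noteq> []" "distinct P" using simple by (auto simp: simple_polygon_def)
  with True show ?thesis
    by (simp add: P0_def bdry_val_smooth vertex_in_boundary distinct_card)
next
  case False
  have "(LINT x:cell P|lebesgue. (1::real)) = area P"
    by (simp add: set_lebesgue_integral_def)
  with False area_pos show ?thesis by (simp add: P0_def)
qed

lemma polys_traceable: "p \<in> polys k \<Longrightarrow> p \<in> traceable P"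
  by (intro smooth_traceable polys_smooth)

lemma grad_const: "grad (\<lambda>x. c) = (\<lambda>x. 0)"
  by (simp add: grad_def fun_eq_iff vec_eq_iff)

lemma grad_polys_combination:
  assumes "p \<in> polys k" "q \<in> polys k"
  shows "grad (\<lambda>x. a * p x + b * q x) = (\<lambda>x. a *\<^sub>R grad p x + b *\<^sub>R grad q x)"
  using assms by (simp add: grad_combination polys_smooth fun_eq_iff)

text \<open>The gradient equations for \<open>Pi1\<close> leave a constant free, and the condition
  on \<open>P0\<close> fixes it. Adding the product of the \<open>P0\<close> values merges the two
  conditions into one definite form.\<close>

definition H1_form :: "nat \<Rightarrow> (real^2 \<Rightarrow> real) \<Rightarrow> (real^2 \<Rightarrow> real) \<Rightarrow> real" where
  "H1_form k p q = l2_inner (cell P) (grad p) (grad q) + P0 P k p * P0 P k q"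

text \<open>An isotropic polynomial has zero gradient on the cell and is constant; since
  \<open>P0\<close> reproduces constants, the second summand forces it to be zero.\<close>

lemma definite_form_H1: "definite_form (polys k) (H1_form m)"
proof
  fix f g h :: "real^2 \<Rightarrow> real" and a b assume "f \<in> polys k" "g \<in> polys k" "h \<in> polys k"
  then show "H1_form m (\<lambda>x. a * f x + b * g x) h = a * H1_form m f h + b * H1_form m g h"
    by (simp add: H1_form_def P0_combination polys_traceable grad_polys_combination l2_inner_linear_left
        grad_polys_L2 algebra_simps)
next
  fix f assume f: "f \<in> polys k" "H1_form m f f = 0"
  have "l2_inner (cell P) (grad f) (grad f) = 0" "P0 P m f = 0"
    using f(2) l2_inner_self_nonneg[of "cell P" "grad f"] zero_le_square[of "P0 P m f"]
    unfolding H1_form_def by (auto simp: add_nonneg_eq_0_iff)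
  then obtain c where c: "f = (\<lambda>x. c)"
    using l2_inner_self_eq_0[OF smooth_grad_continuous_on[OF polys_smooth[OF f(1)]]]
      polys_constant_if_grad_zero[OF f(1) open_cell cell_nonempty] by blast
  have "P0 P m f = c"
    using P0_combination[of "\<lambda>x. 1" "\<lambda>x. 1" m c 0] P0_one[of m] smooth_traceable[OF smooth_const[of 1]] c by simp
  with \<open>P0 P m f = 0\<close> c show "f = (\<lambda>x. 0)" by simp
qed (auto simp: H1_form_def mult.commute intro: polys_const polys_combination l2_inner_commute)

definition is_Pi1 :: "nat \<Rightarrow> (real^2 \<Rightarrow> real) \<Rightarrow> (real^2 \<Rightarrow> real) \<Rightarrow> bool" where
  "is_Pi1 k v p \<longleftrightarrow> p \<in> polys k \<and>
     (\<forall>q\<in>polys k. l2_inner (cell P) (grad p) (grad q) = l2_inner (cell P) (weak_grad (cell P) v) (grad q)) \<and>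
     P0 P k p = P0 P k v"

text \<open>Testing with the constant \<open>1\<close>, whose gradient vanishes and whose
  \<open>P0\<close> value is \<open>1\<close>, recovers the condition on \<open>P0\<close>;
  cancelling it leaves the gradient equations.\<close>

lemma is_Pi1_iff:
  "is_Pi1 k v p \<longleftrightarrow> p \<in> polys k \<and>
    (\<forall>q\<in>polys k. H1_form k p q = l2_inner (cell P) (weak_grad (cell P) v) (grad q) + P0 P k v * P0 P k q)"
proof
  assume r: "p \<in> polys k \<and>
    (\<forall>q\<in>polys k. H1_form k p q = l2_inner (cell P) (weak_grad (cell P) v) (grad q) + P0 P k v * P0 P k q)"
  then have "H1_form k p (\<lambda>x. 1) = l2_inner (cell P) (weak_grad (cell P) v) (grad (\<lambda>x. 1)) + P0 P k v * P0 P k (\<lambda>x. 1)"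
    using polys_const by blast
  then have "P0 P k p = P0 P k v"
    by (simp add: H1_form_def grad_const P0_one l2_inner_def)
  with r show "is_Pi1 k v p" by (simp add: is_Pi1_def H1_form_def)
qed (auto simp: is_Pi1_def H1_form_def)

lemma Pi1_unique:
  assumes "v \<in> traceable P"
  shows "\<exists>!p. is_Pi1 k v p"
proof -
  interpret definite_form "polys k" "H1_form k" by (rule definite_form_H1)
  have "linear_functional (\<lambda>q. l2_inner (cell P) (weak_grad (cell P) v) (grad q) + P0 P k v * P0 P k q)"
    unfolding linear_functional_def
  proof (intro ballI allI)
    fix f g :: "real^2 \<Rightarrow> real" and a b assume fg: "f \<in> polys k" "g \<in> polys k"
    have "l2_inner (cell P) (weak_grad (cell P) v) (grad (\<lambda>x. a * f x + b * g x))
        = a * l2_inner (cell P) (weak_grad (cell P) v) (grad f) + b * l2_inner (cell P) (weak_grad (cell P) v) (grad g)"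
      unfolding grad_polys_combination[OF fg] l2_inner_commute[of _ "weak_grad (cell P) v"]
      by (intro l2_inner_linear_left grad_polys_L2[OF fg(1)] grad_polys_L2[OF fg(2)] weak_grad_L2 traceable_sobolev assms)
    then show "l2_inner (cell P) (weak_grad (cell P) v) (grad (\<lambda>x. a * f x + b * g x)) + P0 P k v * P0 P k (\<lambda>x. a * f x + b * g x)
      = a * (l2_inner (cell P) (weak_grad (cell P) v) (grad f) + P0 P k v * P0 P k f)
      + b * (l2_inner (cell P) (weak_grad (cell P) v) (grad g) + P0 P k v * P0 P k g)"
      using P0_combination[OF polys_traceable[OF fg(1)] polys_traceable[OF fg(2)], of k a b]
      by (simp add: algebra_simps)
  qed
  from riesz_unique[OF finite_powers polys_eq_fspan this] show ?thesis
    by (simp add: is_Pi1_iff)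
qed

lemma Pi1_is_Pi1: "v \<in> traceable P \<Longrightarrow> is_Pi1 k v (Pi1 P k v)"
  using theI'[OF Pi1_unique] unfolding Pi1_def is_Pi1_def by simp

lemma Pi1_polys: "v \<in> traceable P \<Longrightarrow> Pi1 P k v \<in> polys k"
  using Pi1_is_Pi1 by (auto simp: is_Pi1_def)

text \<open>By uniqueness, as for \<open>Pi0\<close>. The weak gradient occurs in the defining
  equations only under an integral, so its almost-everywhere linearity suffices.\<close>

lemma Pi1_combination:
  assumes "v \<in> traceable P" "v' \<in> traceable P"
  shows "Pi1 P k (\<lambda>x. a * v x + b * v' x) = (\<lambda>x. a * Pi1 P k v x + b * Pi1 P k v' x)"
proof -
  have pol: "Pi1 P k v \<in> polys k" "Pi1 P k v' \<in> polys k" using assms Pi1_polys by auto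
  have wg: "l2_inner (cell P) (weak_grad (cell P) (\<lambda>x. a * v x + b * v' x)) (grad q)
      = a * l2_inner (cell P) (weak_grad (cell P) v) (grad q) + b * l2_inner (cell P) (weak_grad (cell P) v') (grad q)"
    if "q \<in> polys k" for q
  proof -
    have "l2_inner (cell P) (weak_grad (cell P) (\<lambda>x. a * v x + b * v' x)) (grad q)
        = l2_inner (cell P) (\<lambda>x. a *\<^sub>R weak_grad (cell P) v x + b *\<^sub>R weak_grad (cell P) v' x) (grad q)"
      by (intro l2_inner_cong_AE weak_grad_combination weak_grad_L2 L2_linear_combination sobolev_combination
          traceable_sobolev assms grad_polys_L2[OF that])
    also have "\<dots> = a * l2_inner (cell P) (weak_grad (cell P) v) (grad q) + b * l2_inner (cell P) (weak_grad (cell P) v') (grad q)"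
      by (intro l2_inner_linear_left weak_grad_L2 traceable_sobolev assms grad_polys_L2[OF that])
    finally show ?thesis .
  qed
  have "is_Pi1 k (\<lambda>x. a * v x + b * v' x) (\<lambda>x. a * Pi1 P k v x + b * Pi1 P k v' x)"
    using Pi1_is_Pi1[OF assms(1), of k] Pi1_is_Pi1[OF assms(2), of k] pol wg
    by (auto simp: is_Pi1_def P0_combination assms polys_traceable grad_polys_combination
        l2_inner_linear_left grad_polys_L2 intro: polys_combination)
  then show ?thesis
    using Pi1_unique[OF traceable_combination[OF assms]] Pi1_is_Pi1[OF traceable_combination[OF assms]] by blast
qed

lemma edge_monomial_continuous: "continuous_on S (edge_monomial e j)"
  unfolding edge_monomial_def divide_inverse by (intro continuous_intros)

lemma scaled_monomial_L2: "scaled_monomial P a b \<in> L2 (cell P)"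
proof (rule continuous_L2)
  show "continuous_on UNIV (scaled_monomial P a b)"
    unfolding scaled_monomial_def divide_inverse by (intro continuous_intros)
qed

text \<open>Vertex values and edge moments see \<open>v\<close> only through \<open>bdry_val\<close>
  at boundary points, where it is linear; the interior moments are integrals of \<open>v\<close>
  itself.\<close>

lemma dofs_combination:
  assumes "\<phi> \<in> set (dofs P k)" and v: "v \<in> traceable P" "v' \<in> traceable P"
  shows "\<phi> (\<lambda>x. a * v x + b * v' x) = a * \<phi> v + b * \<phi> v'"
proof -
  note bv = bdry_val_combination[OF v, of _ a b]
  consider (vertex) z where "z \<in> set P" "\<phi> = (\<lambda>v. bdry_val P v z)"
    | (edge) e j where "e \<in> set (edges P)" "\<phi> = (\<lambda>v. 1 / edge_length e * edge_integral e (\<lambda>x. bdry_val P v x * edge_monomial e j x))"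
    | (inner) i j where "\<phi> = (\<lambda>v. 1 / area P * l2_inner (cell P) v (scaled_monomial P i j))"
    using assms(1) unfolding dofs_def by auto
  then show ?thesis
  proof cases
    case vertex
    then show ?thesis using bv vertex_in_boundary by simp
  next
    case (edge e j)
    let ?m = "edge_monomial e j"
    have c: "continuous_on (boundary P) (\<lambda>x. bdry_val P v x * ?m x)" "continuous_on (boundary P) (\<lambda>x. bdry_val P v' x * ?m x)"
      by (intro continuous_on_mult bdry_val(1) v edge_monomial_continuous)+
    have "edge_integral e (\<lambda>x. bdry_val P (\<lambda>x. a * v x + b * v' x) x * ?m x)
        = edge_integral e (\<lambda>x. a * (bdry_val P v x * ?m x) + b * (bdry_val P v' x * ?m x))"
    proof -
      have "linepath (fst e) (snd e) t \<in> boundary P" if "t \<in> {0..1}" for t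
        using edge_parametrization(2)[of "fst e" "snd e"] edge(1) that by auto
      then show ?thesis
        unfolding edge_integral_def
        by (intro arg_cong[where f = "(*) _"] set_lebesgue_integral_cong) (auto simp: bv algebra_simps)
    qed
    also have "\<dots> = a * edge_integral e (\<lambda>x. bdry_val P v x * ?m x) + b * edge_integral e (\<lambda>x. bdry_val P v' x * ?m x)"
      by (rule edge_integral_combination[OF edge(1) c])
    finally show ?thesis by (simp add: edge(2) algebra_simps add_divide_distrib)
  next
    case (inner i j)
    then show ?thesis
      by (simp add: l2_inner_combination_left traceable_L2 v scaled_monomial_L2 add_divide_distrib)
  qed
qed

end

section \<open>The discrete spaces and bilinear forms\<close>

context polygon
begin

lemma bdry_polys_continuous: "g \<in> bdry_polys P k \<Longrightarrow> continuous_on (boundary P) g"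
  by (simp add: bdry_polys_def)

lemma bdry_polys_combination:
  assumes "g \<in> bdry_polys P k" "g' \<in> bdry_polys P k"
  shows "(\<lambda>x. a * g x + b * g' x) \<in> bdry_polys P k"
proof -
  have "\<exists>q :: real poly. degree q \<le> k \<and>
      (\<forall>t\<in>{0..1}. a * g (linepath (fst e) (snd e) t) + b * g' (linepath (fst e) (snd e) t) = poly q t)"
    if "e \<in> set (edges P)" for e
  proof -
    obtain q where q: "degree q \<le> k" "\<forall>t\<in>{0..1}. g (linepath (fst e) (snd e) t) = poly q t"
      using assms(1) \<open>e \<in> set (edges P)\<close> unfolding bdry_polys_def by blast
    obtain q' where q': "degree q' \<le> k" "\<forall>t\<in>{0..1}. g' (linepath (fst e) (snd e) t) = poly q' t"
      using assms(2) \<open>e \<in> set (edges P)\<close> unfolding bdry_polys_def by blast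
    have "degree (smult a q + smult b q') \<le> k"
      using q(1) q'(1) by (intro degree_add_le order_trans[OF degree_smult_le])
    with q q' show ?thesis by (intro exI[of _ "smult a q + smult b q'"]) simp
  qed
  moreover have "continuous_on (boundary P) (\<lambda>x. a * g x + b * g' x)"
    by (intro continuous_intros bdry_polys_continuous[OF assms(1)] bdry_polys_continuous[OF assms(2)])
  ultimately show ?thesis by (simp add: bdry_polys_def)
qed

lemma W_space_traceable: "v \<in> W_space P k \<Longrightarrow> v \<in> traceable P"
  unfolding W_space_def traceable_def using bdry_polys_continuous by blast

lemma V_local_traceable: "v \<in> V_local P k \<Longrightarrow> v \<in> traceable P"
  unfolding V_local_def using W_space_traceable by blast

lemma W_space_combination:
  assumes "v \<in> W_space P k" "v' \<in> W_space P k"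
  shows "(\<lambda>x. a * v x + b * v' x) \<in> W_space P k"
proof -
  obtain p g where v: "v \<in> sobolev (cell P) 1" "p \<in> polys k" "has_weak_laplacian (cell P) v p"
      "g \<in> bdry_polys P k" "has_trace P v g"
    using assms(1) unfolding W_space_def by blast
  obtain p' g' where v': "v' \<in> sobolev (cell P) 1" "p' \<in> polys k" "has_weak_laplacian (cell P) v' p'"
      "g' \<in> bdry_polys P k" "has_trace P v' g'"
    using assms(2) unfolding W_space_def by blast
  have "has_weak_laplacian (cell P) (\<lambda>x. a * v x + b * v' x) (\<lambda>x. a * p x + b * p' x)"
    by (intro has_weak_laplacian_combination sobolev_L2[OF v(1)] sobolev_L2[OF v'(1)]
        polys_L2[OF v(2)] polys_L2[OF v'(2)] v(3) v'(3))
  moreover have "has_trace P (\<lambda>x. a * v x + b * v' x) (\<lambda>x. a * g x + b * g' x)"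
    by (intro has_trace_combination v(5) v'(5) bdry_polys_continuous[OF v(4)] bdry_polys_continuous[OF v'(4)])
  ultimately show ?thesis
    unfolding W_space_def
    using sobolev_combination[OF v(1) v'(1), of a b] polys_combination[OF v(2) v'(2), of a b]
      bdry_polys_combination[OF v(4) v'(4), of a b] by blast
qed

lemma scaled_monomials_L2: "q \<in> scaled_monomials P s \<Longrightarrow> q \<in> L2 (cell P)"
  by (auto simp: scaled_monomials_def scaled_monomial_L2)

text \<open>The constraint comparing \<open>v\<close> with \<open>Pi1 P k v\<close> is linear
  because \<open>Pi1\<close> is.\<close>

lemma V_local_combination:
  assumes "v \<in> V_local P k" "v' \<in> V_local P k"
  shows "(\<lambda>x. a * v x + b * v' x) \<in> V_local P k"
proof -
  have tr: "v \<in> traceable P" "v' \<in> traceable P" using assms V_local_traceable by auto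
  have "l2_inner (cell P) (\<lambda>x. a * v x + b * v' x) q = l2_inner (cell P) (Pi1 P k (\<lambda>x. a * v x + b * v' x)) q"
    if q: "q \<in> scaled_monomials P (int k) - scaled_monomials P (int k - 2)" for q
  proof -
    have "q \<in> L2 (cell P)" using q scaled_monomials_L2 by blast
    moreover have "l2_inner (cell P) v q = l2_inner (cell P) (Pi1 P k v) q"
      "l2_inner (cell P) v' q = l2_inner (cell P) (Pi1 P k v') q"
      using assms q unfolding V_local_def by auto
    ultimately show ?thesis
      unfolding Pi1_combination[OF tr]
      using l2_inner_combination_left[OF traceable_L2[OF tr(1)] traceable_L2[OF tr(2)], of q a b]
        l2_inner_combination_left[OF polys_L2[OF Pi1_polys[OF tr(1)]] polys_L2[OF Pi1_polys[OF tr(2)]], of q a k b k]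
      by simp
  qed
  moreover have "(\<lambda>x. a * v x + b * v' x) \<in> W_space P k"
    using assms W_space_combination unfolding V_local_def by auto
  ultimately show ?thesis unfolding V_local_def by blast
qed

lemma dofs_product_combination:
  assumes "v \<in> traceable P" "v' \<in> traceable P"
  shows "(\<Sum>\<phi>\<leftarrow>dofs P k. \<phi> (\<lambda>x. a * v x + b * v' x) * \<phi> w)
    = a * (\<Sum>\<phi>\<leftarrow>dofs P k. \<phi> v * \<phi> w) + b * (\<Sum>\<phi>\<leftarrow>dofs P k. \<phi> v' * \<phi> w)"
proof -
  have "(\<Sum>\<phi>\<leftarrow>xs. \<phi> (\<lambda>x. a * v x + b * v' x) * \<phi> w)
    = a * (\<Sum>\<phi>\<leftarrow>xs. \<phi> v * \<phi> w) + b * (\<Sum>\<phi>\<leftarrow>xs. \<phi> v' * \<phi> w)" if "set xs \<subseteq> set (dofs P k)" for xs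
    using that by (induction xs) (auto simp: dofs_combination[OF _ assms] algebra_simps)
  then show ?thesis by blast
qed

lemma minus_polys_traceable: "v \<in> traceable P \<Longrightarrow> p \<in> polys k \<Longrightarrow> (\<lambda>x. v x - p x) \<in> traceable P"
  using traceable_combination[OF _ polys_traceable, of v p k 1 "-1"] by simp

end

locale mesh_on = bounded_open \<Omega> for \<Omega> +
  fixes \<T> :: "polygon set"
  assumes finite_mesh: "finite \<T>" and simple_cells: "P \<in> \<T> \<Longrightarrow> simple_polygon P"
begin

lemma polygonI: "P \<in> \<T> \<Longrightarrow> polygon P"
  by unfold_locales (rule simple_cells)

lemma V_h_traceable: "v \<in> V_h \<Omega> \<T> k \<Longrightarrow> P \<in> \<T> \<Longrightarrow> v \<in> traceable P"
  using polygon.V_local_traceable[OF polygonI] by (auto simp: V_h_def)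

lemma V_h_combination:
  assumes "v \<in> V_h \<Omega> \<T> k" "v' \<in> V_h \<Omega> \<T> k"
  shows "(\<lambda>x. a * v x + b * v' x) \<in> V_h \<Omega> \<T> k"
  using assms sobolev_zero_combination polygon.V_local_combination[OF polygonI] by (auto simp: V_h_def)

lemma a_h_commute: "a_h \<T> k v w = a_h \<T> k w v"
  unfolding a_h_def by (simp add: l2_inner_commute[of _ "grad (Pi1 _ k v)"] mult.commute)

lemma m_h_commute: "m_h \<T> k v w = m_h \<T> k w v"
  unfolding m_h_def by (simp add: l2_inner_commute[of _ "Pi0 _ k v"] mult.commute)

text \<open>Cell by cell: \<open>Pi1\<close> is linear, hence so is the argument
  \<open>v - Pi1 P k v\<close> of the degrees of freedom. Linearity in the other slot is available
  through \<open>a_h_commute\<close>.\<close>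

lemma a_h_combination:
  assumes "v \<in> V_h \<Omega> \<T> k" "v' \<in> V_h \<Omega> \<T> k" "w \<in> V_h \<Omega> \<T> k"
  shows "a_h \<T> k (\<lambda>x. a * v x + b * v' x) w = a * a_h \<T> k v w + b * a_h \<T> k v' w"
  unfolding a_h_def sum_distrib_left sum.distrib[symmetric]
proof (rule sum.cong[OF refl])
  fix P assume P: "P \<in> \<T>"
  interpret polygon P using P by (rule polygonI)
  have tr: "v \<in> traceable P" "v' \<in> traceable P" "w \<in> traceable P"
    using assms P V_h_traceable by auto
  note pol = Pi1_polys[OF tr(1), of k] Pi1_polys[OF tr(2), of k] Pi1_polys[OF tr(3), of k]
  have "l2_inner (cell P) (grad (Pi1 P k (\<lambda>x. a * v x + b * v' x))) (grad (Pi1 P k w))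
      = a * l2_inner (cell P) (grad (Pi1 P k v)) (grad (Pi1 P k w)) + b * l2_inner (cell P) (grad (Pi1 P k v')) (grad (Pi1 P k w))"
    using pol by (simp add: Pi1_combination tr grad_polys_combination l2_inner_linear_left grad_polys_L2)
  moreover have "(\<lambda>x. a * v x + b * v' x - Pi1 P k (\<lambda>x. a * v x + b * v' x) x)
      = (\<lambda>x. a * (v x - Pi1 P k v x) + b * (v' x - Pi1 P k v' x))"
    by (simp add: Pi1_combination tr algebra_simps)
  ultimately show "l2_inner (cell P) (grad (Pi1 P k (\<lambda>x. a * v x + b * v' x))) (grad (Pi1 P k w)) +
      (\<Sum>\<phi>\<leftarrow>dofs P k. \<phi> (\<lambda>x. a * v x + b * v' x - Pi1 P k (\<lambda>x. a * v x + b * v' x) x) * \<phi> (\<lambda>x. w x - Pi1 P k w x)) =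
    a * (l2_inner (cell P) (grad (Pi1 P k v)) (grad (Pi1 P k w)) +
      (\<Sum>\<phi>\<leftarrow>dofs P k. \<phi> (\<lambda>x. v x - Pi1 P k v x) * \<phi> (\<lambda>x. w x - Pi1 P k w x))) +
    b * (l2_inner (cell P) (grad (Pi1 P k v')) (grad (Pi1 P k w)) +
      (\<Sum>\<phi>\<leftarrow>dofs P k. \<phi> (\<lambda>x. v' x - Pi1 P k v' x) * \<phi> (\<lambda>x. w x - Pi1 P k w x)))"
    using dofs_product_combination[OF minus_polys_traceable[OF tr(1) pol(1)] minus_polys_traceable[OF tr(2) pol(2)],
        where k = k and a = a and b = b and w = "\<lambda>x. w x - Pi1 P k w x"]
    by (simp add: algebra_simps)
qed

lemma m_h_combination:
  assumes "v \<in> V_h \<Omega> \<T> k" "v' \<in> V_h \<Omega> \<T> k" "w \<in> V_h \<Omega> \<T> k"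
  shows "m_h \<T> k (\<lambda>x. a * v x + b * v' x) w = a * m_h \<T> k v w + b * m_h \<T> k v' w"
  unfolding m_h_def sum_distrib_left sum.distrib[symmetric]
proof (rule sum.cong[OF refl])
  fix P assume P: "P \<in> \<T>"
  interpret polygon P using P by (rule polygonI)
  have tr: "v \<in> traceable P" "v' \<in> traceable P" "w \<in> traceable P"
    using assms P V_h_traceable by auto
  note L2 = traceable_L2[OF tr(1)] traceable_L2[OF tr(2)] traceable_L2[OF tr(3)]
  note pol = Pi0_polys[OF L2(1), of k] Pi0_polys[OF L2(2), of k] Pi0_polys[OF L2(3), of k]
  have "l2_inner (cell P) (Pi0 P k (\<lambda>x. a * v x + b * v' x)) (Pi0 P k w)
      = a * l2_inner (cell P) (Pi0 P k v) (Pi0 P k w) + b * l2_inner (cell P) (Pi0 P k v') (Pi0 P k w)"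
    using pol by (simp add: Pi0_combination L2 l2_inner_combination_left polys_L2)
  moreover have "(\<lambda>x. a * v x + b * v' x - Pi0 P k (\<lambda>x. a * v x + b * v' x) x)
      = (\<lambda>x. a * (v x - Pi0 P k v x) + b * (v' x - Pi0 P k v' x))"
    by (simp add: Pi0_combination L2 algebra_simps)
  ultimately show "l2_inner (cell P) (Pi0 P k (\<lambda>x. a * v x + b * v' x)) (Pi0 P k w) + (cell_diam P)\<^sup>2 *
      (\<Sum>\<phi>\<leftarrow>dofs P k. \<phi> (\<lambda>x. a * v x + b * v' x - Pi0 P k (\<lambda>x. a * v x + b * v' x) x) * \<phi> (\<lambda>x. w x - Pi0 P k w x)) =
    a * (l2_inner (cell P) (Pi0 P k v) (Pi0 P k w) + (cell_diam P)\<^sup>2 *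
      (\<Sum>\<phi>\<leftarrow>dofs P k. \<phi> (\<lambda>x. v x - Pi0 P k v x) * \<phi> (\<lambda>x. w x - Pi0 P k w x))) +
    b * (l2_inner (cell P) (Pi0 P k v') (Pi0 P k w) + (cell_diam P)\<^sup>2 *
      (\<Sum>\<phi>\<leftarrow>dofs P k. \<phi> (\<lambda>x. v' x - Pi0 P k v' x) * \<phi> (\<lambda>x. w x - Pi0 P k w x)))"
    using dofs_product_combination[OF minus_polys_traceable[OF tr(1) pol(1)] minus_polys_traceable[OF tr(2) pol(2)],
        where k = k and a = a and b = b and w = "\<lambda>x. w x - Pi0 P k w x"]
    by (simp add: algebra_simps)
qed

lemma m_h_self_nonneg: "0 \<le> m_h \<T> k w w"
  unfolding m_h_def
  by (intro sum_nonneg add_nonneg_nonneg l2_inner_self_nonneg mult_nonneg_nonneg sum_list_nonneg) auto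

lemma Pi0h_combination:
  assumes "v \<in> V_h \<Omega> \<T> k" "v' \<in> V_h \<Omega> \<T> k"
  shows "Pi0h \<T> k (\<lambda>x. a * v x + b * v' x) x = a * Pi0h \<T> k v x + b * Pi0h \<T> k v' x"
  unfolding Pi0h_def sum_distrib_left sum.distrib[symmetric]
proof (rule sum.cong[OF refl])
  fix P assume P: "P \<in> \<T>"
  have "v \<in> L2 (cell P)" "v' \<in> L2 (cell P)"
    using assms P V_h_traceable traceable_L2 by auto
  from polygon.Pi0_combination[OF polygonI[OF P] this]
  show "(if x \<in> cell P then Pi0 P k (\<lambda>x. a * v x + b * v' x) x else 0)
      = a * (if x \<in> cell P then Pi0 P k v x else 0) + b * (if x \<in> cell P then Pi0 P k v' x else 0)"
    by simp
qed

lemma Pi0h_measurable: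
  assumes "v \<in> V_h \<Omega> \<T> k"
  shows "Pi0h \<T> k v \<in> borel_measurable borel"
proof -
  have "(\<lambda>x. if x \<in> cell P then Pi0 P k v x else 0) \<in> borel_measurable borel" if P: "P \<in> \<T>" for P
  proof -
    interpret polygon P using P by (rule polygonI)
    have "continuous_on UNIV (Pi0 P k v)"
      by (intro smooth_continuous_on polys_smooth[of _ k] Pi0_polys traceable_L2 V_h_traceable[OF assms P])
    then have "Pi0 P k v \<in> borel_measurable borel" by (rule borel_measurable_continuous_onI)
    then show ?thesis by (intro measurable_If) auto
  qed
  then show ?thesis
    unfolding Pi0h_def[abs_def] by (intro borel_measurable_sum)
qed

text \<open>Finitely many polynomials, each on a bounded cell. Boundedness makes the squares of the
  projections square integrable, as the quartic energy term demands.\<close>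

lemma Pi0h_bounded:
  assumes "v \<in> V_h \<Omega> \<T> k"
  obtains B where "\<And>x. \<bar>Pi0h \<T> k v x\<bar> \<le> B"
proof -
  have "\<exists>B. \<forall>x. \<bar>if x \<in> cell P then Pi0 P k v x else 0\<bar> \<le> B" if P: "P \<in> \<T>" for P
  proof -
    interpret polygon P using P by (rule polygonI)
    have "continuous_on (closure (cell P)) (Pi0 P k v)"
      by (intro smooth_continuous_on polys_smooth[of _ k] Pi0_polys traceable_L2 V_h_traceable[OF assms P])
    then have "bounded (Pi0 P k v ` closure (cell P))"
      using bounded_cell by (intro compact_imp_bounded compact_continuous_image) auto
    then obtain B where "\<And>x. x \<in> closure (cell P) \<Longrightarrow> \<bar>Pi0 P k v x\<bar> \<le> B"
      by (auto simp: bounded_iff)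
    then have "\<bar>if x \<in> cell P then Pi0 P k v x else 0\<bar> \<le> max B 0" for x
      using closure_subset[of "cell P"] by (auto simp: le_max_iff_disj)
    then show ?thesis by blast
  qed
  then obtain B where B: "\<And>P x. P \<in> \<T> \<Longrightarrow> \<bar>if x \<in> cell P then Pi0 P k v x else 0\<bar> \<le> B P"
    by metis
  have "\<bar>Pi0h \<T> k v x\<bar> \<le> (\<Sum>P\<in>\<T>. B P)" for x
    unfolding Pi0h_def by (rule order_trans[OF sum_abs sum_mono]) (rule B)
  then show ?thesis by (rule that)
qed

lemma Pi0h_product_L2:
  assumes "v \<in> V_h \<Omega> \<T> k" "w \<in> V_h \<Omega> \<T> k"
  shows "(\<lambda>x. Pi0h \<T> k v x * Pi0h \<T> k w x) \<in> L2 \<Omega>"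
proof -
  obtain B C where B: "\<And>x. \<bar>Pi0h \<T> k v x\<bar> \<le> B" "\<And>x. \<bar>Pi0h \<T> k w x\<bar> \<le> C"
    using Pi0h_bounded[OF assms(1)] Pi0h_bounded[OF assms(2)] by metis
  show ?thesis
  proof (rule bounded_measurable_L2)
    have "(\<lambda>x. indicator \<Omega> x *\<^sub>R (Pi0h \<T> k v x * Pi0h \<T> k w x)) \<in> borel_measurable borel"
      using Pi0h_measurable[OF assms(1)] Pi0h_measurable[OF assms(2)]
      by (intro borel_measurable_scaleR borel_measurable_times borel_measurable_indicator sets_D)
    then show "set_borel_measurable lebesgue \<Omega> (\<lambda>x. Pi0h \<T> k v x * Pi0h \<T> k w x)"
      unfolding set_borel_measurable_def by (intro measurable_completion) simp
    show "norm (Pi0h \<T> k v x * Pi0h \<T> k w x) \<le> B * C" for x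
      using B(1)[of x] B(2)[of x] by (simp add: abs_mult mult_mono')
  qed
qed

section \<open>Energy decay\<close>

text \<open>The second equation, applied at both time levels, turns \<open>a_h\<close> of the mean of \<open>v\<close> and the
  difference quotient of \<open>u\<close> into a difference of squared norms. The lagged iterate \<open>z\<close> is \<open>u'\<close> in
  the first step.\<close>

lemma energy_step:
  assumes s: "s > 0"
    and V: "u \<in> V_h \<Omega> \<T> k" "u' \<in> V_h \<Omega> \<T> k" "v \<in> V_h \<Omega> \<T> k" "v' \<in> V_h \<Omega> \<T> k" "z \<in> V_h \<Omega> \<T> k"
    and second: "\<And>\<psi>. \<psi> \<in> V_h \<Omega> \<T> k \<Longrightarrow> m_h \<T> k v \<psi> = a_h \<T> k u \<psi>"
      "\<And>\<psi>. \<psi> \<in> V_h \<Omega> \<T> k \<Longrightarrow> m_h \<T> k v' \<psi> = a_h \<T> k u' \<psi>"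
    and first: "\<And>\<phi>. \<phi> \<in> V_h \<Omega> \<T> k \<Longrightarrow>
      m_h \<T> k (\<lambda>x. (u x - u' x) / s) \<phi> + \<gamma> * a_h \<T> k (\<lambda>x. (v x + v' x) / 2) \<phi> + a_h \<T> k (\<lambda>x. (u x + u' x) / 2) \<phi>
      + l2_inner \<Omega> (\<lambda>x. (Pi0h \<T> k z x)\<^sup>2 * Pi0h \<T> k (\<lambda>x. (u x + u' x) / 2) x) (Pi0h \<T> k \<phi>)
      - m_h \<T> k (\<lambda>x. (u x + u' x) / 2) \<phi> = 0"
  shows "\<gamma> * (m_h \<T> k v v - m_h \<T> k v' v') + (a_h \<T> k u u - a_h \<T> k u' u')
    + (l2_inner \<Omega> (\<lambda>x. (Pi0h \<T> k u x)\<^sup>2) (\<lambda>x. (Pi0h \<T> k z x)\<^sup>2)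
       - l2_inner \<Omega> (\<lambda>x. (Pi0h \<T> k u' x)\<^sup>2) (\<lambda>x. (Pi0h \<T> k z x)\<^sup>2))
    - (m_h \<T> k u u - m_h \<T> k u' u') \<le> 0"
proof -
  \<comment> \<open>The step \<open>s\<close> is \<open>\<tau>\<close> at the start and
    \<open>2 * \<tau>\<close> afterwards. \<open>D\<close>, \<open>U\<close> and \<open>W\<close>
    are put in the shape to which the combination lemmas apply.\<close>
  define D where "D = (\<lambda>x. (1 / s) * u x + (- (1 / s)) * u' x)"
  define U where "U = (\<lambda>x. (1 / 2) * u x + (1 / 2) * u' x)"
  define W where "W = (\<lambda>x. (1 / 2) * v x + (1 / 2) * v' x)"
  have eqs: "(\<lambda>x. (u x - u' x) / s) = D" "(\<lambda>x. (u x + u' x) / 2) = U" "(\<lambda>x. (v x + v' x) / 2) = W"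
    by (auto simp: D_def U_def W_def diff_divide_distrib add_divide_distrib)
  have mem: "D \<in> V_h \<Omega> \<T> k" "U \<in> V_h \<Omega> \<T> k" "W \<in> V_h \<Omega> \<T> k"
    unfolding D_def U_def W_def by (intro V_h_combination V)+
  have D_left: "a_h \<T> k D w = (1 / s) * (a_h \<T> k u w - a_h \<T> k u' w)"
    "m_h \<T> k D w = (1 / s) * (m_h \<T> k u w - m_h \<T> k u' w)" if "w \<in> V_h \<Omega> \<T> k" for w
    unfolding D_def a_h_combination[OF V(1,2) that] m_h_combination[OF V(1,2) that] by (simp_all add: algebra_simps)
  have U_left: "a_h \<T> k U w = (1 / 2) * (a_h \<T> k u w + a_h \<T> k u' w)"
    "m_h \<T> k U w = (1 / 2) * (m_h \<T> k u w + m_h \<T> k u' w)" if "w \<in> V_h \<Omega> \<T> k" for w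
    unfolding U_def a_h_combination[OF V(1,2) that] m_h_combination[OF V(1,2) that] by (simp_all add: algebra_simps)
  have W_left: "m_h \<T> k W w = (1 / 2) * (m_h \<T> k v w + m_h \<T> k v' w)" if "w \<in> V_h \<Omega> \<T> k" for w
    unfolding W_def m_h_combination[OF V(3,4) that] by (simp add: algebra_simps)
  \<comment> \<open>By symmetry, the mixed terms cancel when the half-sum is paired with the
    difference.\<close>
  have aUD: "a_h \<T> k U D = (1 / (2 * s)) * (a_h \<T> k u u - a_h \<T> k u' u')"
  proof -
    have "a_h \<T> k u U - a_h \<T> k u' U = (a_h \<T> k u u - a_h \<T> k u' u') / 2"
      using a_h_commute[of k u U] a_h_commute[of k u' U] a_h_commute[of k u u']
        U_left(1)[OF V(1)] U_left(1)[OF V(2)] by (simp add: field_simps)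
    then show ?thesis unfolding a_h_commute[of k U D] D_left(1)[OF mem(2)] by (simp only:) simp
  qed
  have mUD: "m_h \<T> k U D = (1 / (2 * s)) * (m_h \<T> k u u - m_h \<T> k u' u')"
  proof -
    have "m_h \<T> k u U - m_h \<T> k u' U = (m_h \<T> k u u - m_h \<T> k u' u') / 2"
      using m_h_commute[of k u U] m_h_commute[of k u' U] m_h_commute[of k u u']
        U_left(2)[OF V(1)] U_left(2)[OF V(2)] by (simp add: field_simps)
    then show ?thesis unfolding m_h_commute[of k U D] D_left(2)[OF mem(2)] by (simp only:) simp
  qed
  have aWD: "a_h \<T> k W D = (1 / (2 * s)) * (m_h \<T> k v v - m_h \<T> k v' v')"
  proof -
    have "a_h \<T> k u W - a_h \<T> k u' W = (m_h \<T> k v v - m_h \<T> k v' v') / 2"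
      using m_h_commute[of k v W] m_h_commute[of k v' W] m_h_commute[of k v v']
        W_left[OF V(3)] W_left[OF V(4)] second(1)[OF mem(3)] second(2)[OF mem(3)] by (simp add: field_simps)
    then show ?thesis unfolding a_h_commute[of k W D] D_left(1)[OF mem(3)] by (simp only:) simp
  qed
  have nonlinear: "l2_inner \<Omega> (\<lambda>x. (Pi0h \<T> k z x)\<^sup>2 * Pi0h \<T> k U x) (Pi0h \<T> k D)
    = (1 / (2 * s)) * (l2_inner \<Omega> (\<lambda>x. (Pi0h \<T> k u x)\<^sup>2) (\<lambda>x. (Pi0h \<T> k z x)\<^sup>2)
       - l2_inner \<Omega> (\<lambda>x. (Pi0h \<T> k u' x)\<^sup>2) (\<lambda>x. (Pi0h \<T> k z x)\<^sup>2))"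
  proof -
    have L2: "(\<lambda>x. (Pi0h \<T> k w x)\<^sup>2) \<in> L2 \<Omega>" if "w \<in> V_h \<Omega> \<T> k" for w
      using Pi0h_product_L2[OF that that] by (simp add: power2_eq_square)
    \<comment> \<open>At each point the half-sum times the difference quotient is a difference of
      squares over \<open>2 * s\<close>, and the lagged weight can be moved to the other side of the
      inner product.\<close>
    have "l2_inner \<Omega> (\<lambda>x. (Pi0h \<T> k z x)\<^sup>2 * Pi0h \<T> k U x) (Pi0h \<T> k D)
      = l2_inner \<Omega> (\<lambda>x. (1 / (2 * s)) * (Pi0h \<T> k u x)\<^sup>2 + (- (1 / (2 * s))) * (Pi0h \<T> k u' x)\<^sup>2) (\<lambda>x. (Pi0h \<T> k z x)\<^sup>2)"
      unfolding l2_inner_def U_def D_def Pi0h_combination[OF V(1,2)]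
      by (rule arg_cong[where f = "set_lebesgue_integral lebesgue \<Omega>"], rule ext)
        (use s in \<open>simp add: power2_eq_square field_simps\<close>)
    then show ?thesis
      using l2_inner_combination_left[OF L2[OF V(1)] L2[OF V(2)] L2[OF V(5)], of "1 / (2 * s)" "- (1 / (2 * s))"]
      by (simp add: algebra_simps)
  qed
  have "m_h \<T> k D D + (1 / (2 * s)) * (\<gamma> * (m_h \<T> k v v - m_h \<T> k v' v') + (a_h \<T> k u u - a_h \<T> k u' u')
    + (l2_inner \<Omega> (\<lambda>x. (Pi0h \<T> k u x)\<^sup>2) (\<lambda>x. (Pi0h \<T> k z x)\<^sup>2)
       - l2_inner \<Omega> (\<lambda>x. (Pi0h \<T> k u' x)\<^sup>2) (\<lambda>x. (Pi0h \<T> k z x)\<^sup>2))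
    - (m_h \<T> k u u - m_h \<T> k u' u')) = 0"
    using first[OF mem(1)] unfolding eqs aUD mUD aWD nonlinear by (simp add: algebra_simps)
  with m_h_self_nonneg[of k D] have "(1 / (2 * s)) * (\<gamma> * (m_h \<T> k v v - m_h \<T> k v' v') + (a_h \<T> k u u - a_h \<T> k u' u')
    + (l2_inner \<Omega> (\<lambda>x. (Pi0h \<T> k u x)\<^sup>2) (\<lambda>x. (Pi0h \<T> k z x)\<^sup>2)
       - l2_inner \<Omega> (\<lambda>x. (Pi0h \<T> k u' x)\<^sup>2) (\<lambda>x. (Pi0h \<T> k z x)\<^sup>2))
    - (m_h \<T> k u u - m_h \<T> k u' u')) \<le> 0" by linarith
  moreover have "0 < 1 / (2 * s)" using s by simp
  ultimately show ?thesis by (simp only: mult_le_0_iff) auto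
qed

end

theorem theorem3p2:
  fixes \<Omega> :: "(real^2) set" and \<T> :: "polygon set" and \<rho> :: real
    and u0 :: "real^2 \<Rightarrow> real" and \<gamma> T \<tau> :: real and k N :: nat
    and u v :: "nat \<Rightarrow> real^2 \<Rightarrow> real"
  assumes domain: "convex_polygonal_domain \<Omega>"
    and mesh: "polygonal_mesh \<Omega> \<T>" "0 < \<rho>" "\<rho> < 1" "mesh_regular \<rho> \<T>"
    and params: "0 < \<gamma>" "1 \<le> k" "0 < T" "1 \<le> N" "\<tau> = T / real N"
    and u0: "u0 \<in> sobolev_zero \<Omega>" "u0 \<in> sobolev \<Omega> (k + 1)"
    and spaces: "\<forall>n\<le>N. u n \<in> V_h \<Omega> \<T> k" "\<forall>n\<le>N. v n \<in> V_h \<Omega> \<T> k"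
    and start: "is_elliptic_projection \<Omega> \<T> k u0 (u 0)"
      "\<forall>\<psi>\<in>V_h \<Omega> \<T> k. m_h \<T> k (v 0) \<psi> = a_h \<T> k (u 0) \<psi>"
    and step1: "\<forall>\<phi>\<in>V_h \<Omega> \<T> k.
        m_h \<T> k (D_tau \<tau> u 1) \<phi> + \<gamma> * a_h \<T> k (hat v 1) \<phi> + a_h \<T> k (hat u 1) \<phi>
        + l2_inner \<Omega> (\<lambda>x. (Pi0h \<T> k (u 0) x)\<^sup>2 * Pi0h \<T> k (hat u 1) x) (Pi0h \<T> k \<phi>)
        - m_h \<T> k (hat u 1) \<phi> = 0"
      "\<forall>\<psi>\<in>V_h \<Omega> \<T> k. m_h \<T> k (v 1) \<psi> = a_h \<T> k (u 1) \<psi>"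
    and stepn: "\<forall>n. 2 \<le> n \<and> n \<le> N \<longrightarrow> (\<forall>\<phi>\<in>V_h \<Omega> \<T> k.
        m_h \<T> k (D_tau \<tau> u n) \<phi> + \<gamma> * a_h \<T> k (hat v n) \<phi> + a_h \<T> k (hat u n) \<phi>
        + l2_inner \<Omega> (\<lambda>x. (Pi0h \<T> k (u (n - 1)) x)\<^sup>2 * Pi0h \<T> k (hat u n) x) (Pi0h \<T> k \<phi>)
        - m_h \<T> k (hat u n) \<phi> = 0)"
      "\<forall>n. 2 \<le> n \<and> n \<le> N \<longrightarrow> (\<forall>\<psi>\<in>V_h \<Omega> \<T> k. m_h \<T> k (v n) \<psi> = a_h \<T> k (u n) \<psi>)"
  shows "\<forall>n. 1 \<le> n \<and> n \<le> N \<longrightarrow>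
    energy \<Omega> \<T> k \<gamma> u v n \<le> energy \<Omega> \<T> k \<gamma> u v (n - 1)"
proof (intro allI impI)
  fix n assume n: "1 \<le> n \<and> n \<le> N"
  \<comment> \<open>The domain is itself the cell of a simple polygon, so its openness and
    boundedness come from the same results as for the mesh cells.\<close>
  obtain Q where Q: "simple_polygon Q" "\<Omega> = cell Q"
    using domain unfolding convex_polygonal_domain_def by blast
  interpret Q: polygon Q by unfold_locales (rule Q(1))
  interpret mesh_on \<Omega> \<T>
    by unfold_locales (use Q(2) Q.open_cell Q.bounded_cell mesh(1) in \<open>auto simp: polygonal_mesh_def\<close>)
  have tau: "0 < \<tau>" using params by simp
  have V: "u j \<in> V_h \<Omega> \<T> k" "v j \<in> V_h \<Omega> \<T> k" if "j \<le> N" for j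
    using spaces that by auto
  have second: "m_h \<T> k (v j) \<psi> = a_h \<T> k (u j) \<psi>" if "\<psi> \<in> V_h \<Omega> \<T> k" "j \<le> N" for j \<psi>
  proof -
    consider "j = 0" | "j = 1" | "2 \<le> j" by linarith
    then show ?thesis
      by cases (use start(2) step1(2) stepn(2) that in auto)
  qed
  show "energy \<Omega> \<T> k \<gamma> u v n \<le> energy \<Omega> \<T> k \<gamma> u v (n - 1)"
  proof (cases "n = 1")
    case True
    \<comment> \<open>The squared norm in the initial energy is the older quartic pairing of
      \<open>energy_step\<close> for \<open>z = u 0\<close>. The energy difference is then a quarter
      of the expression bounded there.\<close>
    have "(l2_norm \<Omega> (\<lambda>x. (Pi0h \<T> k (u 0) x)\<^sup>2))\<^sup>2
        = l2_inner \<Omega> (\<lambda>x. (Pi0h \<T> k (u 0) x)\<^sup>2) (\<lambda>x. (Pi0h \<T> k (u 0) x)\<^sup>2)"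
      by (simp add: l2_norm_def l2_inner_self_nonneg)
    then show ?thesis
      using energy_step[OF tau V(1)[of 1] V(1)[of 0] V(2)[of 1] V(2)[of 0] V(1)[of 0], of \<gamma>]
        second[of _ 1] second[of _ 0] step1(1) True n
      by (simp add: energy_def D_tau_def hat_def algebra_simps)
  next
    case False
    with n obtain m where m: "n = Suc (Suc m)"
      by (cases n rule: nat.exhaust; cases "n - 1") auto
    with n have le: "Suc (Suc m) \<le> N" "Suc m \<le> N" "m \<le> N" by auto
    \<comment> \<open>The levels compared are \<open>m + 2\<close> and \<open>m\<close>, with step
      \<open>2 * \<tau>\<close> and lagged iterate at \<open>m + 1\<close>. The averages at level
      \<open>m + 1\<close> cancel, leaving again a quarter of the expression bounded in
      \<open>energy_step\<close>.\<close>
    have "0 < 2 * \<tau>" using tau by simp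
    from energy_step[OF this V(1)[OF le(1)] V(1)[OF le(3)] V(2)[OF le(1)] V(2)[OF le(3)] V(1)[OF le(2)],
        of \<gamma>, OF second[OF _ le(1)] second[OF _ le(3)]]
      stepn(1)[rule_format, of "Suc (Suc m)"] le
    show ?thesis
      \<comment> \<open>The previous energy pairs the squares at the levels \<open>m + 1\<close> and
        \<open>m\<close> in the opposite order.\<close>
      using l2_inner_commute[of \<Omega> "\<lambda>x. (Pi0h \<T> k (u m) x)\<^sup>2"]
      by (simp add: m energy_def D_tau_def hat_def algebra_simps)
  qed
qed

end
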